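(* Assume the system $\textsf{P}+\Pi^1_1\text{-}\textsf{TRANS}$ is consistent. Then $\textsf{P}+\Pi^1_1\text{-}\textsf{TRANS}$ does not prove $\textsf{LMP}$.
   Context: Types: $0$ is the type of natural numbers, $1=0\to0$, $2=1\to0$, and $\tau^*$ is the type of finite sequences of objects of type $\tau$. $\textsf{E-PA}^{\omega*}$ is classical Peano arithmetic in all finite types with the axiom of extensionality, definitionally extended with the types $\tau^*$. The language of $\textsf{P}$ adds a predicate $\text{st}$ ("is standard") for every type. $(\forall^{\text{st}}x)A$ abbreviates $(\forall x)(\text{st}(x)\to A)$ and $(\exists^{\text{st}}x)A$ abbreviates $(\exists x)(\text{st}(x)\wedge A)$; a formula is internal if it does not involve $\text{st}$. The system $\textsf{P}$ consists of $\textsf{E-PA}^{\omega*}$ (axioms for internal formulas) plus: (1) $\text{st}(x)\wedge x=y\to\text{st}(y)$; $\text{st}(t)$ for every closed term $t$ of $\textsf{E-PA}^{\omega*}$; $\text{st}(f)\wedge\text{st}(x)\to\text{st}(f(x))$; (2) external induction: $\Phi(0)\wedge(\forall^{\text{st}}n^0)(\Phi(n)\to\Phi(n+1))\to(\forall^{\text{st}}n^0)\Phi(n)$ for every (possibly external) $\Phi$; (3) Idealisation $\textsf{I}$: $(\forall^{\text{st}}x^{\sigma^*})(\exists y^\tau)(\forall z^\sigma\in x)\varphi(z,y)\to(\exists y^\tau)(\forall^{\text{st}}x^\sigma)\varphi(x,y)$ for internal $\varphi$; (4) $\textsf{HAC}_{\textsf{int}}$: $(\forall^{\text{st}}x^\rho)(\exists^{\text{st}}y^\tau)\varphi(x,y)\to(\exists^{\text{st}}F^{\rho\to\tau^*})(\forall^{\text{st}}x^\rho)(\exists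 y^\tau\in F(x))\varphi(x,y)$ for internal $\varphi$. $\overline{g}n$ is (the code of) the initial segment $\langle g(0),\dots,g(n-1)\rangle$. $\Pi^1_1\text{-}\textsf{TRANS}$: $(\forall^{\text{st}}f^1)\big[(\exists g^1)(\forall n^0)(f(\overline{g}n)=0)\to(\exists^{\text{st}}g^1)(\forall n^0)(f(\overline{g}n)=0)\big]$. $\textsf{LMP}$: $(\forall T\leq_11)\big[\mu(T)\gg0\to(\exists^{\text{st}}\beta^1\leq_11)(\forall^{\text{st}}m^0)(\overline{\beta}m\in T)\big]$, where $T\leq_11$ ranges over (possibly nonstandard) binary trees given by characteristic functions, $\beta\leq_11$ means $\beta(n)\le 1$ for all $n$, and $\mu(T)\gg0$ is the formula $(\exists^{\text{st}}k^0)(\forall^{\text{st}}n^0)\Big(\frac{|\{\sigma\in T:|\sigma|=n\}|}{2^n}\geq\frac1k\Big)$. *)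

theory Defs
  imports Main
begin

section \<open>The language of P\<close>

datatype ty = NN | Arr ty ty (infixr "\<rightarrow>" 65) | Seq ty ("_\<^sup>\<star>" [1000] 1000)

text \<open>A variable is an index together with its type; the same index at two types gives two
  different variables.\<close>

type_synonym var = "nat \<times> ty"

datatype cst =
    CZero | CSucc
  | CK ty ty | CS ty ty ty
  | CRec ty
  | CNil ty | CCons ty
  | CFold ty ty

datatype tm = Var var | Cst cst | App tm tm (infixl "\<cdot>" 90)

fun cty :: "cst \<Rightarrow> ty" where
  "cty CZero = NN"
| "cty CSucc = NN \<rightarrow> NN"
| "cty (CK \<sigma> \<tau>) = \<sigma> \<rightarrow> \<tau> \<rightarrow> \<sigma>"
| "cty (CS \<rho> \<sigma> \<tau>) = (\<rho> \<rightarrow> \<sigma> \<rightarrow> \<tau>) \<rightarrow> (\<rho> \<rightarrow> \<sigma>) \<rightarrow> \<rho> \<rightarrow> \<tau>"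
| "cty (CRec \<rho>) = \<rho> \<rightarrow> (NN \<rightarrow> \<rho> \<rightarrow> \<rho>) \<rightarrow> NN \<rightarrow> \<rho>"
| "cty (CNil \<sigma>) = \<sigma>\<^sup>\<star>"
| "cty (CCons \<sigma>) = \<sigma> \<rightarrow> \<sigma>\<^sup>\<star> \<rightarrow> \<sigma>\<^sup>\<star>"
| "cty (CFold \<sigma> \<rho>) = \<rho> \<rightarrow> (\<sigma> \<rightarrow> \<rho> \<rightarrow> \<rho>) \<rightarrow> \<sigma>\<^sup>\<star> \<rightarrow> \<rho>"

text \<open>The result of \<open>tyof\<close> is meaningful for well-typed terms only.\<close>

fun tyof :: "tm \<Rightarrow> ty" where
  "tyof (Var x) = snd x"
| "tyof (Cst c) = cty c"
| "tyof (t \<cdot> s) = (case tyof t of \<sigma> \<rightarrow> \<tau> \<Rightarrow> \<tau> | _ \<Rightarrow> NN)"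

fun wt :: "tm \<Rightarrow> bool" where
  "wt (Var x) = True"
| "wt (Cst c) = True"
| "wt (t \<cdot> s) = (wt t \<and> wt s \<and> (\<exists>\<tau>. tyof t = tyof s \<rightarrow> \<tau>))"

definition has_ty :: "tm \<Rightarrow> ty \<Rightarrow> bool" (infix "\<triangleright>" 50) where
  "t \<triangleright> \<sigma> \<longleftrightarrow> wt t \<and> tyof t = \<sigma>"

datatype fm =
    Bot
  | Eq tm tm (infix "\<^bold>=" 60)
  | St tm
  | Imp fm fm (infixr "\<^bold>\<longrightarrow>" 51)
  | Forall var fm

abbreviation Neg :: "fm \<Rightarrow> fm" ("\<^bold>\<not> _" [58] 58) where
  "\<^bold>\<not> \<phi> \<equiv> \<phi> \<^bold>\<longrightarrow> Bot"
abbreviation And :: "fm \<Rightarrow> fm \<Rightarrow> fm" (infixr "\<^bold>\<and>" 55) where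
  "\<phi> \<^bold>\<and> \<psi> \<equiv> \<^bold>\<not> (\<phi> \<^bold>\<longrightarrow> \<^bold>\<not> \<psi>)"
abbreviation Or :: "fm \<Rightarrow> fm \<Rightarrow> fm" (infixr "\<^bold>\<or>" 53) where
  "\<phi> \<^bold>\<or> \<psi> \<equiv> \<^bold>\<not> \<phi> \<^bold>\<longrightarrow> \<psi>"
abbreviation Exists :: "var \<Rightarrow> fm \<Rightarrow> fm" where
  "Exists x \<phi> \<equiv> \<^bold>\<not> Forall x (\<^bold>\<not> \<phi>)"
abbreviation Forallst :: "var \<Rightarrow> fm \<Rightarrow> fm" where
  "Forallst x \<phi> \<equiv> Forall x (St (Var x) \<^bold>\<longrightarrow> \<phi>)"
abbreviation Existsst :: "var \<Rightarrow> fm \<Rightarrow> fm" where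
  "Existsst x \<phi> \<equiv> Exists x (St (Var x) \<^bold>\<and> \<phi>)"

fun wff :: "fm \<Rightarrow> bool" where
  "wff Bot = True"
| "wff (s \<^bold>= t) = (wt s \<and> wt t \<and> tyof s = tyof t)"
| "wff (St t) = wt t"
| "wff (\<phi> \<^bold>\<longrightarrow> \<psi>) = (wff \<phi> \<and> wff \<psi>)"
| "wff (Forall x \<phi>) = wff \<phi>"

fun internal :: "fm \<Rightarrow> bool" where
  "internal Bot = True"
| "internal (s \<^bold>= t) = True"
| "internal (St t) = False"
| "internal (\<phi> \<^bold>\<longrightarrow> \<psi>) = (internal \<phi> \<and> internal \<psi>)"
| "internal (Forall x \<phi>) = internal \<phi>"

fun fvt :: "tm \<Rightarrow> var set" where
  "fvt (Var x) = {x}"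
| "fvt (Cst c) = {}"
| "fvt (t \<cdot> s) = fvt t \<union> fvt s"

fun fv :: "fm \<Rightarrow> var set" where
  "fv Bot = {}"
| "fv (s \<^bold>= t) = fvt s \<union> fvt t"
| "fv (St t) = fvt t"
| "fv (\<phi> \<^bold>\<longrightarrow> \<psi>) = fv \<phi> \<union> fv \<psi>"
| "fv (Forall x \<phi>) = fv \<phi> - {x}"

fun substt :: "var \<Rightarrow> tm \<Rightarrow> tm \<Rightarrow> tm" where
  "substt x u (Var y) = (if y = x then u else Var y)"
| "substt x u (Cst c) = Cst c"
| "substt x u (t \<cdot> s) = substt x u t \<cdot> substt x u s"

text \<open>Substitution of \<open>u\<close> for the free occurrences of \<open>x\<close>. It does not rename bound variables;
  capture is excluded where it is used, by \<open>free_for\<close>.\<close>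

fun subst :: "var \<Rightarrow> tm \<Rightarrow> fm \<Rightarrow> fm" where
  "subst x u Bot = Bot"
| "subst x u (s \<^bold>= t) = (substt x u s \<^bold>= substt x u t)"
| "subst x u (St t) = St (substt x u t)"
| "subst x u (\<phi> \<^bold>\<longrightarrow> \<psi>) = (subst x u \<phi> \<^bold>\<longrightarrow> subst x u \<psi>)"
| "subst x u (Forall y \<phi>) = (if y = x then Forall y \<phi> else Forall y (subst x u \<phi>))"

fun free_for :: "tm \<Rightarrow> var \<Rightarrow> fm \<Rightarrow> bool" where
  "free_for u x Bot = True"
| "free_for u x (s \<^bold>= t) = True"
| "free_for u x (St t) = True"
| "free_for u x (\<phi> \<^bold>\<longrightarrow> \<psi>) = (free_for u x \<phi> \<and> free_for u x \<psi>)"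
| "free_for u x (Forall y \<phi>) = (x \<notin> fv (Forall y \<phi>) \<or> (y \<notin> fvt u \<and> free_for u x \<phi>))"

section \<open>Classical many-sorted predicate logic\<close>

text \<open>Equality is not a logical symbol here; its axioms are part of the arithmetical theory.
  Generalisation is unrestricted, so the free variables of the axioms in \<open>\<Gamma>\<close> are read
  universally.\<close>

inductive derives :: "fm set \<Rightarrow> fm \<Rightarrow> bool" (infix "\<turnstile>" 40) for \<Gamma> :: "fm set" where
  ax: "\<phi> \<in> \<Gamma> \<Longrightarrow> wff \<phi> \<Longrightarrow> \<Gamma> \<turnstile> \<phi>"
| imp1: "wff \<phi> \<Longrightarrow> wff \<psi> \<Longrightarrow> \<Gamma> \<turnstile> \<phi> \<^bold>\<longrightarrow> \<psi> \<^bold>\<longrightarrow> \<phi>"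
| imp2: "wff \<phi> \<Longrightarrow> wff \<psi> \<Longrightarrow> wff \<chi> \<Longrightarrow>
    \<Gamma> \<turnstile> (\<phi> \<^bold>\<longrightarrow> \<psi> \<^bold>\<longrightarrow> \<chi>) \<^bold>\<longrightarrow> (\<phi> \<^bold>\<longrightarrow> \<psi>) \<^bold>\<longrightarrow> \<phi> \<^bold>\<longrightarrow> \<chi>"
| dneg: "wff \<phi> \<Longrightarrow> \<Gamma> \<turnstile> \<^bold>\<not> (\<^bold>\<not> \<phi>) \<^bold>\<longrightarrow> \<phi>"
| all_inst: "wff \<phi> \<Longrightarrow> u \<triangleright> snd x \<Longrightarrow> free_for u x \<phi> \<Longrightarrow> \<Gamma> \<turnstile> Forall x \<phi> \<^bold>\<longrightarrow> subst x u \<phi>"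
| all_dist: "wff \<phi> \<Longrightarrow> wff \<psi> \<Longrightarrow> x \<notin> fv \<phi> \<Longrightarrow>
    \<Gamma> \<turnstile> Forall x (\<phi> \<^bold>\<longrightarrow> \<psi>) \<^bold>\<longrightarrow> \<phi> \<^bold>\<longrightarrow> Forall x \<psi>"
| mp: "\<Gamma> \<turnstile> \<phi> \<^bold>\<longrightarrow> \<psi> \<Longrightarrow> \<Gamma> \<turnstile> \<phi> \<Longrightarrow> \<Gamma> \<turnstile> \<psi>"
| gen: "\<Gamma> \<turnstile> \<phi> \<Longrightarrow> \<Gamma> \<turnstile> Forall x \<phi>"

definition consistent :: "fm set \<Rightarrow> bool" where
  "consistent \<Gamma> \<longleftrightarrow> \<not> (\<Gamma> \<turnstile> Bot)"

section \<open>Defined terms and formulas\<close>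

text \<open>Bracket abstraction: \<open>lam x t\<close> is the combinatory term for the function sending \<open>x\<close>
  to \<open>t\<close>.\<close>

fun lam :: "var \<Rightarrow> tm \<Rightarrow> tm" where
  "lam x (Var y) =
    (let \<sigma> = snd x in
     if x = y then Cst (CS \<sigma> (\<sigma> \<rightarrow> \<sigma>) \<sigma>) \<cdot> Cst (CK \<sigma> (\<sigma> \<rightarrow> \<sigma>)) \<cdot> Cst (CK \<sigma> \<sigma>)
     else Cst (CK (snd y) \<sigma>) \<cdot> Var y)"
| "lam x (Cst c) = Cst (CK (cty c) (snd x)) \<cdot> Cst c"
| "lam x (t \<cdot> s) = Cst (CS (snd x) (tyof s) (tyof (t \<cdot> s))) \<cdot> lam x t \<cdot> lam x s"

abbreviation Ze :: tm where "Ze \<equiv> Cst CZero"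
abbreviation Su :: "tm \<Rightarrow> tm" where "Su t \<equiv> Cst CSucc \<cdot> t"
abbreviation cons :: "ty \<Rightarrow> tm \<Rightarrow> tm \<Rightarrow> tm" where "cons \<sigma> a s \<equiv> Cst (CCons \<sigma>) \<cdot> a \<cdot> s"

definition addT :: tm where
  "addT = (let x = (0, NN); r = (1, NN); i = (2, NN) in
     lam x (Cst (CRec NN) \<cdot> Var x \<cdot> lam i (lam r (Su (Var r)))))"

abbreviation add :: "tm \<Rightarrow> tm \<Rightarrow> tm" (infixl "\<^bold>+" 65) where
  "s \<^bold>+ t \<equiv> addT \<cdot> s \<cdot> t"

definition mulT :: tm where
  "mulT = (let x = (0, NN); r = (1, NN); i = (2, NN) in
     lam x (Cst (CRec NN) \<cdot> Ze \<cdot> lam i (lam r (Var r \<^bold>+ Var x))))"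

abbreviation mul :: "tm \<Rightarrow> tm \<Rightarrow> tm" (infixl "\<^bold>*" 70) where
  "s \<^bold>* t \<equiv> mulT \<cdot> s \<cdot> t"

definition pow2T :: tm where
  "pow2T = (let r = (1, NN); i = (2, NN) in
     Cst (CRec NN) \<cdot> Su Ze \<cdot> lam i (lam r (Var r \<^bold>+ Var r)))"

text \<open>\<open>triT\<close> gives the triangular numbers, and \<open>pairT\<close> is the Cantor pairing
  \<open>(x, y) \<mapsto> (x + y) (x + y + 1) / 2 + y\<close>.\<close>

definition triT :: tm where
  "triT = (let r = (1, NN); i = (2, NN) in
     Cst (CRec NN) \<cdot> Ze \<cdot> lam i (lam r (Var r \<^bold>+ Su (Var i))))"

definition pairT :: tm where
  "pairT = (let x = (0, NN); y = (1, NN) in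
     lam x (lam y (triT \<cdot> (Var x \<^bold>+ Var y) \<^bold>+ Var y)))"

text \<open>The code of the empty sequence is \<open>0\<close>, that of \<open>a\<close> followed by \<open>s\<close> is one more than the
  pair of \<open>a\<close> and the code of \<open>s\<close>. This is a bijection between finite sequences of numbers and
  numbers.\<close>

definition codeT :: tm where
  "codeT = (let a = (0, NN); r = (1, NN) in
     Cst (CFold NN NN) \<cdot> Ze \<cdot> lam a (lam r (Su (pairT \<cdot> Var a \<cdot> Var r))))"

definition appendT :: "ty \<Rightarrow> tm" where
  "appendT \<sigma> = (let s = (0, \<sigma>\<^sup>\<star>); t = (1, \<sigma>\<^sup>\<star>) in
     lam s (lam t (Cst (CFold \<sigma> (\<sigma>\<^sup>\<star>)) \<cdot> Var t \<cdot> Cst (CCons \<sigma>) \<cdot> Var s)))"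

definition lenT :: "ty \<Rightarrow> tm" where
  "lenT \<sigma> = (let a = (0, \<sigma>); r = (1, NN) in
     Cst (CFold \<sigma> NN) \<cdot> Ze \<cdot> lam a (lam r (Su (Var r))))"

fun zeroT :: "ty \<Rightarrow> tm" where
  "zeroT NN = Ze"
| "zeroT (\<sigma> \<rightarrow> \<tau>) = Cst (CK \<tau> \<sigma>) \<cdot> zeroT \<tau>"
| "zeroT (\<sigma>\<^sup>\<star>) = Cst (CNil \<sigma>)"

text \<open>\<open>nthT \<sigma> \<cdot> s \<cdot> i\<close> is the \<open>i\<close>-th entry of \<open>s\<close> (counting from \<open>0\<close>), and \<open>zeroT \<sigma>\<close> if \<open>i\<close> is
  out of range.\<close>

definition nthT :: "ty \<Rightarrow> tm" where
  "nthT \<sigma> = (let a = (0, \<sigma>); r = (1, NN \<rightarrow> \<sigma>); i = (2, NN); j = (3, NN); u = (4, \<sigma>) in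
     Cst (CFold \<sigma> (NN \<rightarrow> \<sigma>)) \<cdot> zeroT (NN \<rightarrow> \<sigma>)
       \<cdot> lam a (lam r (lam i (Cst (CRec \<sigma>) \<cdot> Var a \<cdot> lam j (lam u (Var r \<cdot> Var j)) \<cdot> Var i))))"

text \<open>\<open>initT \<cdot> g \<cdot> n\<close> is the sequence \<open>\<langle>g 0, \<dots>, g (n - 1)\<rangle>\<close>, and \<open>initseg g n\<close> is its code.\<close>

definition initT :: tm where
  "initT = (let g = (0, NN \<rightarrow> NN); i = (1, NN); r = (2, NN\<^sup>\<star>) in
     lam g (Cst (CRec (NN\<^sup>\<star>)) \<cdot> Cst (CNil NN)
       \<cdot> lam i (lam r (appendT NN \<cdot> Var r \<cdot> cons NN (Var g \<cdot> Var i) (Cst (CNil NN))))))"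

abbreviation initseg :: "tm \<Rightarrow> tm \<Rightarrow> tm" where
  "initseg g n \<equiv> codeT \<cdot> (initT \<cdot> g \<cdot> n)"

text \<open>\<open>wordsT \<cdot> n\<close> lists the \<open>2\<^sup>n\<close> binary sequences of length \<open>n\<close>, each of them once.\<close>

definition prefixT :: "tm \<Rightarrow> tm" where
  "prefixT b = (let s = (0, NN\<^sup>\<star>); r = (1, (NN\<^sup>\<star>)\<^sup>\<star>) in
     Cst (CFold (NN\<^sup>\<star>) ((NN\<^sup>\<star>)\<^sup>\<star>)) \<cdot> Cst (CNil (NN\<^sup>\<star>))
       \<cdot> lam s (lam r (cons (NN\<^sup>\<star>) (cons NN b (Var s)) (Var r))))"

definition wordsT :: tm where
  "wordsT = (let i = (0, NN); r = (1, (NN\<^sup>\<star>)\<^sup>\<star>) in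
     Cst (CRec ((NN\<^sup>\<star>)\<^sup>\<star>)) \<cdot> cons (NN\<^sup>\<star>) (Cst (CNil NN)) (Cst (CNil (NN\<^sup>\<star>)))
       \<cdot> lam i (lam r (appendT (NN\<^sup>\<star>) \<cdot> (prefixT Ze \<cdot> Var r) \<cdot> (prefixT (Su Ze) \<cdot> Var r))))"

text \<open>For \<open>T\<close> with values in \<open>{0, 1}\<close>, \<open>countT \<cdot> T \<cdot> n\<close> is the number of binary sequences of
  length \<open>n\<close> whose code is mapped to \<open>1\<close>.\<close>

definition countT :: tm where
  "countT = (let T = (0, NN \<rightarrow> NN); n = (1, NN); s = (2, NN\<^sup>\<star>); r = (3, NN) in
     lam T (lam n (Cst (CFold (NN\<^sup>\<star>) NN) \<cdot> Ze
       \<cdot> lam s (lam r (Var T \<cdot> (codeT \<cdot> Var s) \<^bold>+ Var r)) \<cdot> (wordsT \<cdot> Var n))))"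

fun maxvar :: "tm \<Rightarrow> nat" where
  "maxvar (Var x) = fst x"
| "maxvar (Cst c) = 0"
| "maxvar (t \<cdot> s) = max (maxvar t) (maxvar s)"

definition fresh :: "tm \<Rightarrow> tm \<Rightarrow> var" where
  "fresh s t = (Suc (max (maxvar s) (maxvar t)), NN)"

definition le :: "tm \<Rightarrow> tm \<Rightarrow> fm" (infix "\<^bold>\<le>" 60) where
  "s \<^bold>\<le> t = (let z = fresh s t in Exists z (s \<^bold>+ Var z \<^bold>= t))"

text \<open>\<open>t\<close> of type \<open>\<sigma>\<close> is an entry of \<open>s\<close> of type \<open>\<sigma>\<^sup>\<star>\<close>: for some \<open>i < |s|\<close>, \<open>t\<close> is the
  \<open>i\<close>-th entry.\<close>

definition mem :: "tm \<Rightarrow> tm \<Rightarrow> fm" (infix "\<^bold>\<in>" 60) where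
  "t \<^bold>\<in> s = (let i = fresh t s; \<sigma> = tyof t in
     Exists i (Su (Var i) \<^bold>\<le> lenT \<sigma> \<cdot> s \<^bold>\<and> t \<^bold>= nthT \<sigma> \<cdot> s \<cdot> Var i))"

section \<open>The system P\<close>

text \<open>Equality is primitive at every type, and extensionality says that it is pointwise at function
  types. In the induction axiom no capture can occur, as \<open>Su n\<close> is always free for \<open>n\<close>. The
  axioms for \<open>\<sigma>\<^sup>\<star>\<close> are the case distinction \<open>seq_cases\<close> and the equations of \<open>CFold\<close>; they
  give induction over sequences by induction on the length.\<close>

inductive_set axEPA :: "fm set" where
  refl: "wt t \<Longrightarrow> t \<^bold>= t \<in> axEPA"
| sym: "wff (s \<^bold>= t) \<Longrightarrow> s \<^bold>= t \<^bold>\<longrightarrow> t \<^bold>= s \<in> axEPA"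
| trans: "wff (s \<^bold>= t) \<Longrightarrow> wff (t \<^bold>= u) \<Longrightarrow> s \<^bold>= t \<^bold>\<longrightarrow> t \<^bold>= u \<^bold>\<longrightarrow> s \<^bold>= u \<in> axEPA"
| cong: "wff (f \<^bold>= g) \<Longrightarrow> wff (s \<^bold>= t) \<Longrightarrow> wt (f \<cdot> s) \<Longrightarrow>
    f \<^bold>= g \<^bold>\<longrightarrow> s \<^bold>= t \<^bold>\<longrightarrow> f \<cdot> s \<^bold>= g \<cdot> t \<in> axEPA"
| extensionality: "f \<triangleright> snd x \<rightarrow> \<tau> \<Longrightarrow> g \<triangleright> snd x \<rightarrow> \<tau> \<Longrightarrow> x \<notin> fvt f \<union> fvt g \<Longrightarrow>
    Forall x (f \<cdot> Var x \<^bold>= g \<cdot> Var x) \<^bold>\<longrightarrow> f \<^bold>= g \<in> axEPA"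
| K: "s \<triangleright> \<sigma> \<Longrightarrow> t \<triangleright> \<tau> \<Longrightarrow> Cst (CK \<sigma> \<tau>) \<cdot> s \<cdot> t \<^bold>= s \<in> axEPA"
| S: "s \<triangleright> \<rho> \<rightarrow> \<sigma> \<rightarrow> \<tau> \<Longrightarrow> t \<triangleright> \<rho> \<rightarrow> \<sigma> \<Longrightarrow> u \<triangleright> \<rho> \<Longrightarrow>
    Cst (CS \<rho> \<sigma> \<tau>) \<cdot> s \<cdot> t \<cdot> u \<^bold>= s \<cdot> u \<cdot> (t \<cdot> u) \<in> axEPA"
| rec_zero: "a \<triangleright> \<rho> \<Longrightarrow> f \<triangleright> NN \<rightarrow> \<rho> \<rightarrow> \<rho> \<Longrightarrow> Cst (CRec \<rho>) \<cdot> a \<cdot> f \<cdot> Ze \<^bold>= a \<in> axEPA"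
| rec_succ: "a \<triangleright> \<rho> \<Longrightarrow> f \<triangleright> NN \<rightarrow> \<rho> \<rightarrow> \<rho> \<Longrightarrow> n \<triangleright> NN \<Longrightarrow>
    Cst (CRec \<rho>) \<cdot> a \<cdot> f \<cdot> Su n \<^bold>= f \<cdot> n \<cdot> (Cst (CRec \<rho>) \<cdot> a \<cdot> f \<cdot> n) \<in> axEPA"
| fold_nil: "a \<triangleright> \<rho> \<Longrightarrow> f \<triangleright> \<sigma> \<rightarrow> \<rho> \<rightarrow> \<rho> \<Longrightarrow>
    Cst (CFold \<sigma> \<rho>) \<cdot> a \<cdot> f \<cdot> Cst (CNil \<sigma>) \<^bold>= a \<in> axEPA"
| fold_cons: "a \<triangleright> \<rho> \<Longrightarrow> f \<triangleright> \<sigma> \<rightarrow> \<rho> \<rightarrow> \<rho> \<Longrightarrow> b \<triangleright> \<sigma> \<Longrightarrow> s \<triangleright> \<sigma>\<^sup>\<star> \<Longrightarrow>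
    Cst (CFold \<sigma> \<rho>) \<cdot> a \<cdot> f \<cdot> cons \<sigma> b s \<^bold>= f \<cdot> b \<cdot> (Cst (CFold \<sigma> \<rho>) \<cdot> a \<cdot> f \<cdot> s) \<in> axEPA"
| seq_cases: "t \<triangleright> \<sigma>\<^sup>\<star> \<Longrightarrow> snd b = \<sigma> \<Longrightarrow> snd s = \<sigma>\<^sup>\<star> \<Longrightarrow> b \<notin> fvt t \<Longrightarrow> s \<notin> fvt t \<Longrightarrow>
    t \<^bold>= Cst (CNil \<sigma>) \<^bold>\<or> Exists b (Exists s (t \<^bold>= cons \<sigma> (Var b) (Var s))) \<in> axEPA"
| succ_nonzero: "t \<triangleright> NN \<Longrightarrow> \<^bold>\<not> (Su t \<^bold>= Ze) \<in> axEPA"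
| succ_inj: "s \<triangleright> NN \<Longrightarrow> t \<triangleright> NN \<Longrightarrow> Su s \<^bold>= Su t \<^bold>\<longrightarrow> s \<^bold>= t \<in> axEPA"
| induction: "wff \<phi> \<Longrightarrow> internal \<phi> \<Longrightarrow> snd n = NN \<Longrightarrow>
    subst n Ze \<phi> \<^bold>\<and> Forall n (\<phi> \<^bold>\<longrightarrow> subst n (Su (Var n)) \<phi>) \<^bold>\<longrightarrow> Forall n \<phi> \<in> axEPA"

text \<open>In \<open>idealisation\<close> and \<open>HAC_int\<close> the formula \<open>\<phi>\<close> may contain further free variables as
  parameters; since the two quantified variables keep their names, no substitution is needed.\<close>

inductive_set axP :: "fm set" where
  EPA: "\<phi> \<in> axEPA \<Longrightarrow> \<phi> \<in> axP"
| st_eq: "wff (s \<^bold>= t) \<Longrightarrow> St s \<^bold>\<and> s \<^bold>= t \<^bold>\<longrightarrow> St t \<in> axP"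
| st_closed: "wt t \<Longrightarrow> fvt t = {} \<Longrightarrow> St t \<in> axP"
| st_app: "wt (f \<cdot> s) \<Longrightarrow> St f \<^bold>\<and> St s \<^bold>\<longrightarrow> St (f \<cdot> s) \<in> axP"
| external_induction: "wff \<phi> \<Longrightarrow> snd n = NN \<Longrightarrow>
    subst n Ze \<phi> \<^bold>\<and> Forallst n (\<phi> \<^bold>\<longrightarrow> subst n (Su (Var n)) \<phi>) \<^bold>\<longrightarrow> Forallst n \<phi> \<in> axP"
| idealisation: "wff \<phi> \<Longrightarrow> internal \<phi> \<Longrightarrow> snd x = (snd z)\<^sup>\<star> \<Longrightarrow> x \<notin> fv \<phi> \<Longrightarrow> x \<noteq> y \<Longrightarrow> y \<noteq> z \<Longrightarrow>
    Forallst x (Exists y (Forall z (Var z \<^bold>\<in> Var x \<^bold>\<longrightarrow> \<phi>))) \<^bold>\<longrightarrow> Exists y (Forallst z \<phi>) \<in> axP"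
| HAC_int: "wff \<phi> \<Longrightarrow> internal \<phi> \<Longrightarrow> snd F = snd x \<rightarrow> (snd y)\<^sup>\<star> \<Longrightarrow> F \<notin> fv \<phi> \<Longrightarrow> x \<noteq> y \<Longrightarrow>
    Forallst x (Existsst y \<phi>) \<^bold>\<longrightarrow> Existsst F (Forallst x (Exists y (Var y \<^bold>\<in> Var F \<cdot> Var x \<^bold>\<and> \<phi>))) \<in> axP"

section \<open>The two principles\<close>

definition Pi11_TRANS :: fm where
  "Pi11_TRANS = (let f = (0, NN \<rightarrow> NN); g = (1, NN \<rightarrow> NN); n = (2, NN);
       zeros = Forall n (Var f \<cdot> initseg (Var g) (Var n) \<^bold>= Ze) in
     Forallst f (Exists g zeros \<^bold>\<longrightarrow> Existsst g zeros))"

text \<open>\<open>f \<le>\<^sub>1 1\<close>\<close>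

definition bounded_by_one :: "tm \<Rightarrow> fm" where
  "bounded_by_one f = (let n = fresh f f in Forall n (f \<cdot> Var n \<^bold>\<le> Su Ze))"

text \<open>The sequence \<open>s\<close> belongs to \<open>T\<close> iff \<open>T\<close> maps its code to \<open>1\<close>.\<close>

abbreviation in_tree :: "tm \<Rightarrow> tm \<Rightarrow> fm" where
  "in_tree c T \<equiv> T \<cdot> c \<^bold>= Su Ze"

definition binary_tree :: "var \<Rightarrow> fm" where
  "binary_tree T = (let s = (0, NN\<^sup>\<star>); t = (1, NN\<^sup>\<star>); a = (2, NN) in
     bounded_by_one (Var T)
     \<^bold>\<and> Forall s (in_tree (codeT \<cdot> Var s) (Var T) \<^bold>\<longrightarrow> Forall a (Var a \<^bold>\<in> Var s \<^bold>\<longrightarrow> Var a \<^bold>\<le> Su Ze))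
     \<^bold>\<and> Forall s (Forall t (in_tree (codeT \<cdot> (appendT NN \<cdot> Var s \<cdot> Var t)) (Var T)
          \<^bold>\<longrightarrow> in_tree (codeT \<cdot> Var s) (Var T))))"

text \<open>The inequality \<open>c / 2\<^sup>n \<ge> 1 / k\<close> is written as \<open>2\<^sup>n \<le> k * c\<close>, which forces \<open>k > 0\<close>.\<close>

definition positive_measure :: "var \<Rightarrow> fm" where
  "positive_measure T = (let k = (0, NN); n = (1, NN) in
     Existsst k (Forallst n (pow2T \<cdot> Var n \<^bold>\<le> Var k \<^bold>* (countT \<cdot> Var T \<cdot> Var n))))"

definition LMP :: fm where
  "LMP = (let T = (0, NN \<rightarrow> NN); \<beta> = (1, NN \<rightarrow> NN); m = (2, NN) in
     Forall T (binary_tree T \<^bold>\<longrightarrow> positive_measure T \<^bold>\<longrightarrow>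
       Existsst \<beta> (bounded_by_one (Var \<beta>) \<^bold>\<and> Forallst m (in_tree (initseg (Var \<beta>) (Var m)) (Var T)))))"

section \<open>Well-formedness of the defined notions\<close>

lemma tyof_lam: "wt t \<Longrightarrow> wt (lam x t) \<and> tyof (lam x t) = snd x \<rightarrow> tyof t"
  by (induction t) (auto simp: Let_def)

lemma fvt_lam [simp]: "fvt (lam x t) = fvt t - {x}"
  by (induction t) (auto simp: Let_def)

lemma addT_closed [simp]:
  "wt addT \<and> tyof addT = NN \<rightarrow> NN \<rightarrow> NN \<and> fvt addT = {}"
  by (auto simp: addT_def Let_def tyof_lam)

lemma mulT_closed [simp]:
  "wt mulT \<and> tyof mulT = NN \<rightarrow> NN \<rightarrow> NN \<and> fvt mulT = {}"
  by (auto simp: mulT_def Let_def tyof_lam)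

lemma pow2T_closed [simp]:
  "wt pow2T \<and> tyof pow2T = NN \<rightarrow> NN \<and> fvt pow2T = {}"
  by (auto simp: pow2T_def Let_def tyof_lam)

lemma triT_closed [simp]:
  "wt triT \<and> tyof triT = NN \<rightarrow> NN \<and> fvt triT = {}"
  by (auto simp: triT_def Let_def tyof_lam)

lemma pairT_closed [simp]:
  "wt pairT \<and> tyof pairT = NN \<rightarrow> NN \<rightarrow> NN \<and> fvt pairT = {}"
  by (auto simp: pairT_def Let_def tyof_lam)

lemma codeT_closed [simp]:
  "wt codeT \<and> tyof codeT = NN\<^sup>\<star> \<rightarrow> NN \<and> fvt codeT = {}"
  by (auto simp: codeT_def Let_def tyof_lam)

lemma appendT_closed [simp]:
  "wt (appendT \<sigma>) \<and> tyof (appendT \<sigma>) = \<sigma>\<^sup>\<star> \<rightarrow> \<sigma>\<^sup>\<star> \<rightarrow> \<sigma>\<^sup>\<star> \<and> fvt (appendT \<sigma>) = {}"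
  by (auto simp: appendT_def Let_def tyof_lam)

lemma lenT_closed [simp]:
  "wt (lenT \<sigma>) \<and> tyof (lenT \<sigma>) = \<sigma>\<^sup>\<star> \<rightarrow> NN \<and> fvt (lenT \<sigma>) = {}"
  by (auto simp: lenT_def Let_def tyof_lam)

lemma zeroT_closed [simp]:
  "wt (zeroT \<sigma>) \<and> tyof (zeroT \<sigma>) = \<sigma> \<and> fvt (zeroT \<sigma>) = {}"
  by (induction \<sigma>) auto

lemma nthT_closed [simp]:
  "wt (nthT \<sigma>) \<and> tyof (nthT \<sigma>) = \<sigma>\<^sup>\<star> \<rightarrow> NN \<rightarrow> \<sigma> \<and> fvt (nthT \<sigma>) = {}"
  by (auto simp: nthT_def Let_def tyof_lam)

lemma initT_closed [simp]:
  "wt initT \<and> tyof initT = (NN \<rightarrow> NN) \<rightarrow> NN \<rightarrow> NN\<^sup>\<star> \<and> fvt initT = {}"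
  by (auto simp: initT_def Let_def tyof_lam)

lemma wordsT_closed [simp]:
  "wt wordsT \<and> tyof wordsT = NN \<rightarrow> (NN\<^sup>\<star>)\<^sup>\<star> \<and> fvt wordsT = {}"
  by (auto simp: wordsT_def prefixT_def Let_def tyof_lam)

lemma countT_closed [simp]:
  "wt countT \<and> tyof countT = (NN \<rightarrow> NN) \<rightarrow> NN \<rightarrow> NN \<and> fvt countT = {}"
  by (auto simp: countT_def Let_def tyof_lam)

lemma Pi11_TRANS_sentence: "wff Pi11_TRANS \<and> fv Pi11_TRANS = {}"
  by (auto simp: Pi11_TRANS_def Let_def)

lemma LMP_sentence: "wff LMP \<and> fv LMP = {}"
  by (auto simp: LMP_def binary_tree_def positive_measure_def bounded_by_one_def
      le_def mem_def fresh_def Let_def)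

end

theory Submission
  imports Defs "HOL-Library.Countable" "HOL-Library.Nat_Bijection" "HOL-Library.Sublist"
begin

text \<open>Standard objects are interpreted in the extensional operations of finite type over a partial
  combinatory algebra, and a formula is read as a Diller-Nahm dialectica formula whose realizers are
  programs of this algebra. Programs are packaged into worlds, which force formulas as in a classical
  Kripke model: nonstandard objects are arbitrary functions on a world, standard ones are computed
  uniformly by a program. Idealisation and \<open>HAC_int\<close> hold because programs return finite lists of
  candidates.

  The algebra contains a functional choosing infinite branches of trees, which realizes the transfer
  principle, and a functional \<open>VId\<close> that is injective on the functions of the algebra. Every \<open>\<beta>\<close> can then be
  assigned a neighbourhood \<open>[\<beta>(0), \<dots>, \<beta>(m - 1)]\<close> with \<open>m = VId \<beta> + 2\<close>; these neighbourhoods have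
  pairwise different lengths, so any finitely many of them cover at most half of Cantor space. A generic
  tree avoiding all of them has measure at least \<open>1/2\<close> and no standard path, and so refutes \<open>LMP\<close>.\<close>

section \<open>A combinatory algebra with an injective index functional\<close>

text \<open>The transfer principle brings a very strong choice of branches into the standard part,
  so the standard functions cannot be kept weak. What can be made to fail is compactness: the
  standard sequences receive neighbourhoods of which no finite number covers more than half of the
  space. Weights 2^-(i+2), with i running over pairwise different indices, sum to at most 1/2, so an
  injection of the standard functions into the numbers is enough; it can exist because all of them
  have programs. The difficulty is circular: the injection has to be callable by the very programs
  whose codes are its values, and it has to respect extensional equality. It is therefore obtained
  as a maximal partial graph, and totality comes from the monotonicity of application in the graph.
  A second obstacle is classical logic. Realizers return lists because no program decides which of
  several candidates or challenges is the right one. Worlds make negation mean inconsistency of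
  every extension; stability under double negation is then proved for all formulas, so that no
  negative translation intervenes.\<close>

fun code :: "nat list \<Rightarrow> nat" where
  "code [] = 0"
| "code (a # s) = Suc (prod_encode (code s, a))"

lemma code_inj: "code s = code t \<Longrightarrow> s = t"
proof (induction s arbitrary: t)
  case Nil then show ?case by (cases t) auto
next
  case (Cons a s) then show ?case by (cases t) auto
qed

text \<open>The characteristic function of the tree of binary sequences that avoid finitely many neighbourhoods.
  These functions are primitives of the algebra, so that no program for them is needed.\<close>

definition orc :: "nat \<Rightarrow> nat \<Rightarrow> nat" where
  "orc k n = (if \<exists>s. n = code s \<and> set s \<subseteq> {0, 1} \<and> (\<forall>u\<in>set (from_nat k :: nat list list). \<not> prefix u s)
     then 1 else 0)"

text \<open>The choice depends on the function alone, neither on a program for it nor on a graph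
  \<open>X\<close>; this keeps \<open>VMu\<close> extensional and application monotone in
  \<open>X\<close>. It ranges over all functions of the metatheory, since whatever is chosen becomes
  computable through \<open>VMu1\<close>. Without a branch the value is arbitrary but total.\<close>

definition branch :: "(nat \<Rightarrow> nat) \<Rightarrow> nat \<Rightarrow> nat" where
  "branch f = (SOME g. \<forall>n. f (code (map g [0..<n])) = 0)"

section \<open>Programs and their application relation\<close>

datatype val = N nat | L "val list" | Pr val val | VInl val | VInr val
  | VSuc | VK | VK1 val | VS | VS1 val | VS2 val val
  | VRec | VRec1 val | VRec2 val val | VCons | VCons1 val | VFold | VFold1 val | VFold2 val val
  | VPr | VPr1 val | VFst | VSnd | VInlC | VInrC | VAppend | VAppend1 "val list" | VLefts | VRights
  | VOrc nat | VMu | VMu1 val | VId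

text \<open>Numbering the programs is what makes an injection from the total functions of the
  algebra into the numbers possible; the codes become the values of \<open>VId\<close>.\<close>

instance val :: countable by countable_datatype

fun lefts :: "val list \<Rightarrow> val list" where
  "lefts [] = []" | "lefts (VInl x # xs) = x # lefts xs" | "lefts (_ # xs) = lefts xs"
fun rights :: "val list \<Rightarrow> val list" where
  "rights [] = []" | "rights (VInr x # xs) = x # rights xs" | "rights (_ # xs) = rights xs"

text \<open>\<open>VMu\<close> and \<open>VId\<close> query a program as a total function, which is why their rules have infinitely many
  premises. \<open>VId\<close> answers according to the graph \<open>X\<close>, and diverges on functions outside its domain.\<close>

inductive appl :: "((nat \<Rightarrow> nat) \<times> nat) set \<Rightarrow> val \<Rightarrow> val \<Rightarrow> val \<Rightarrow> bool" for X where
  "appl X VSuc (N n) (N (Suc n))"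
| "appl X VK a (VK1 a)"
| "appl X (VK1 a) b a"
| "appl X VS a (VS1 a)"
| "appl X (VS1 a) b (VS2 a b)"
| "appl X a c u \<Longrightarrow> appl X b c v \<Longrightarrow> appl X u v r \<Longrightarrow> appl X (VS2 a b) c r"
| "appl X VRec a (VRec1 a)"
| "appl X (VRec1 a) f (VRec2 a f)"
| "appl X (VRec2 a f) (N 0) a"
| "appl X (VRec2 a f) (N n) u \<Longrightarrow> appl X f (N n) g \<Longrightarrow> appl X g u r \<Longrightarrow> appl X (VRec2 a f) (N (Suc n)) r"
| "appl X VCons a (VCons1 a)"
| "appl X (VCons1 a) (L s) (L (a # s))"
| "appl X VFold a (VFold1 a)"
| "appl X (VFold1 a) f (VFold2 a f)"
| "appl X (VFold2 a f) (L []) a"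
| "appl X (VFold2 a f) (L s) u \<Longrightarrow> appl X f x g \<Longrightarrow> appl X g u r \<Longrightarrow> appl X (VFold2 a f) (L (x # s)) r"
| "appl X VPr a (VPr1 a)"
| "appl X (VPr1 a) b (Pr a b)"
| "appl X VFst (Pr a b) a"
| "appl X VSnd (Pr a b) b"
| "appl X VInlC a (VInl a)"
| "appl X VInrC a (VInr a)"
| "appl X VAppend (L s) (VAppend1 s)"
| "appl X (VAppend1 s) (L t) (L (s @ t))"
| "appl X VLefts (L s) (L (lefts s))"
| "appl X VRights (L s) (L (rights s))"
| "appl X (VOrc k) (N n) (N (orc k n))"
| "appl X VMu a (VMu1 a)"
| "(\<And>n. appl X a (N n) (N (f n))) \<Longrightarrow> appl X (VMu1 a) (N k) (N (branch f k))"
| "(\<And>n. appl X a (N n) (N (f n))) \<Longrightarrow> (f, c) \<in> X \<Longrightarrow> appl X VId a (N c)"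

inductive_cases applE:
  "appl X (N i) a r" "appl X (L s) a r" "appl X (Pr i j) a r" "appl X (VInl i) a r" "appl X (VInr i) a r"
  "appl X VSuc a r" "appl X VK a r" "appl X (VK1 i) a r" "appl X VS a r" "appl X (VS1 i) a r"
  "appl X VRec a r" "appl X (VRec1 i) a r"
  "appl X VCons a r" "appl X (VCons1 i) a r" "appl X VFold a r" "appl X (VFold1 i) a r"
  "appl X VPr a r" "appl X (VPr1 i) a r" "appl X VFst a r" "appl X VSnd a r" "appl X VInlC a r"
  "appl X VInrC a r" "appl X VAppend a r" "appl X (VAppend1 s) a r" "appl X VLefts a r" "appl X VRights a r"
  "appl X (VOrc k) a r" "appl X VMu a r"
inductive_cases applE_S2: "appl X (VS2 i j) a r"
inductive_cases applE_Rec0: "appl X (VRec2 i j) (N 0) r"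
inductive_cases applE_RecS: "appl X (VRec2 i j) (N (Suc n)) r"
inductive_cases applE_Fold0: "appl X (VFold2 i j) (L []) r"
inductive_cases applE_FoldS: "appl X (VFold2 i j) (L (x # s)) r"
inductive_cases applE_Mu: "appl X (VMu1 i) a r"
inductive_cases applE_Id: "appl X VId a r"

text \<open>The graph matters only at \<open>VId\<close>, where it has to be single-valued. For
  \<open>VMu1\<close> and \<open>VId\<close> the infinitely many induction hypotheses identify the
  two queried functions pointwise, hence as functions.\<close>

lemma appl_det: "appl X f a r \<Longrightarrow> single_valued X \<Longrightarrow> appl X f a r' \<Longrightarrow> r = r'"
proof (induction arbitrary: r' rule: appl.induct)
  case (6 a c u b v r)
  from 6(8) obtain u' v' where "appl X a c u'" "appl X b c v'" "appl X u' v' r'" by (rule applE_S2)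
  with 6 show ?case by metis
next
  case (10 a f n u g r)
  from 10(8) obtain u' g' where "appl X (VRec2 a f) (N n) u'" "appl X f (N n) g'" "appl X g' u' r'"
    by (rule applE_RecS)
  with 10 show ?case by metis
next
  case (16 a f s u x g r)
  from 16(8) obtain u' g' where "appl X (VFold2 a f) (L s) u'" "appl X f x g'" "appl X g' u' r'"
    by (rule applE_FoldS)
  with 16 show ?case by metis
next
  case (29 a f k)
  from 29(4) obtain f' where f': "\<And>n. appl X a (N n) (N (f' n))" and r: "r' = N (branch f' k)"
    by (auto elim: applE_Mu)
  have "f n = f' n" for n using 29(2)[OF 29(3) f', of n] by simp
  then have "f = f'" by auto
  then show ?case using r by simp
next
  case (30 a f c)
  from 30(5) obtain f' c' where f': "\<And>n. appl X a (N n) (N (f' n))" and r: "r' = N c'" "(f', c') \<in> X"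
    by (rule applE_Id) blast
  have "f n = f' n" for n using "30.IH"[OF 30(4) f', of n] by simp
  then have "f = f'" by auto
  then show ?case using r 30 by (auto dest: single_valuedD)
qed (auto elim: applE applE_Rec0 applE_Fold0)

text \<open>Application and the graph occur only positively in the rules: even the queries of
  \<open>VMu1\<close> and \<open>VId\<close> ask for convergence, never for divergence. Enlarging
  the graph thus preserves every computation already made.\<close>

lemma appl_mono: "appl X f a r \<Longrightarrow> X \<subseteq> Y \<Longrightarrow> appl Y f a r"
proof (induction rule: appl.induct)
qed (blast intro: appl.intros)+

text \<open>The index assigned to a function is the code of a program for it, hence indices are injective. A
  maximal such graph is total on the computable functions: otherwise one more function could be added,
  since enlarging the graph only makes more programs converge.\<close>

definition good :: "((nat \<Rightarrow> nat) \<times> nat) set \<Rightarrow> bool" where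
  "good X \<longleftrightarrow> single_valued X \<and> (\<forall>f c. (f, c) \<in> X \<longrightarrow> (\<exists>e. c = to_nat e \<and> (\<forall>n. appl X e (N n) (N (f n)))))"

text \<open>Zorn's lemma replaces a recursive construction, since the programs coded by the indices
  may call \<open>VId\<close> and so depend on the graph being built. In the union of a chain two
  conflicting pairs already lie in one member, and \<open>appl_mono\<close> carries the coding
  programs over.\<close>

lemma good_maximal: "\<exists>X. good X \<and> (\<forall>Y. good Y \<longrightarrow> X \<subseteq> Y \<longrightarrow> Y = X)"
proof -
  have "\<exists>M\<in>Collect good. \<forall>X\<in>Collect good. M \<subseteq> X \<longrightarrow> X = M"
  proof (rule subset_Zorn_nonempty)
    show "Collect good \<noteq> {}" by (auto simp: good_def intro!: exI[of _ "{}"])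
  next
    fix C assume C: "C \<noteq> {}" "subset.chain (Collect good) C"
    then have g: "good X" if "X \<in> C" for X using that by (auto simp: subset.chain_def)
    have "single_valued (\<Union>C)"
    proof (rule single_valuedI)
      fix f c d assume "(f, c) \<in> \<Union>C" "(f, d) \<in> \<Union>C"
      then obtain X Y where XY: "X \<in> C" "Y \<in> C" "(f, c) \<in> X" "(f, d) \<in> Y" by auto
      then have "X \<subseteq> Y \<or> Y \<subseteq> X" using C by (auto simp: subset.chain_def)
      then show "c = d" using XY g[of X] g[of Y] by (auto simp: good_def dest: single_valuedD)
    qed
    moreover have "\<exists>e. c = to_nat e \<and> (\<forall>n. appl (\<Union>C) e (N n) (N (f n)))" if fc: "(f, c) \<in> \<Union>C" for f c
    proof -
      obtain X where X: "X \<in> C" "(f, c) \<in> X" using fc by blast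
      then obtain e where "c = to_nat e" "\<forall>n. appl X e (N n) (N (f n))" using g[of X] by (auto simp: good_def)
      moreover have "X \<subseteq> \<Union>C" using X by auto
      ultimately show ?thesis using appl_mono by blast
    qed
    ultimately show "\<Union>C \<in> Collect good" by (auto simp: good_def)
  qed
  then show ?thesis by auto
qed

definition index :: "((nat \<Rightarrow> nat) \<times> nat) set" where
  "index = (SOME X. good X \<and> (\<forall>Y. good Y \<longrightarrow> X \<subseteq> Y \<longrightarrow> Y = X))"

lemma index_good: "good index" and index_max: "good Y \<Longrightarrow> index \<subseteq> Y \<Longrightarrow> Y = index"
  using someI_ex[OF good_maximal] unfolding index_def by blast+

abbreviation app :: "val \<Rightarrow> val \<Rightarrow> val \<Rightarrow> bool" where "app \<equiv> appl index"

lemma app_det: "app f a r \<Longrightarrow> app f a r' \<Longrightarrow> r = r'"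
  using appl_det index_good by (auto simp: good_def)

lemma index_total:
  assumes e: "\<And>n. app e (N n) (N (f n))"
  shows "\<exists>c. (f, c) \<in> index"
proof (rule ccontr)
  assume n: "\<nexists>c. (f, c) \<in> index"
  \<comment> \<open>The code of \<open>e\<close> is an admissible index for \<open>f\<close>: by
    monotonicity \<open>e\<close> still computes \<open>f\<close> against the enlarged
    graph.\<close>
  let ?Y = "insert (f, to_nat e) index"
  have m: "appl ?Y a b r" if "app a b r" for a b r using appl_mono[OF that] by blast
  have "good ?Y" unfolding good_def
  proof (intro conjI allI impI)
    show "single_valued ?Y" using index_good n by (auto simp: good_def single_valued_def)
    fix g c assume "(g, c) \<in> ?Y"
    then show "\<exists>e. c = to_nat e \<and> (\<forall>n. appl ?Y e (N n) (N (g n)))"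
    proof
      assume "(g, c) = (f, to_nat e)" then show ?thesis using m[OF e] by auto
    next
      assume "(g, c) \<in> index"
      then obtain e' where "c = to_nat e'" "\<forall>n. app e' (N n) (N (g n))" using index_good by (auto simp: good_def)
      then show ?thesis using m by blast
    qed
  qed
  then have "?Y = index" using index_max by blast
  then show False using n by auto
qed

text \<open>An index codes a program for its function, so the function can be read back from it;
  determinism makes this unambiguous.\<close>

lemma index_inj: "(f, c) \<in> index \<Longrightarrow> (g, c) \<in> index \<Longrightarrow> f = g"
proof -
  assume "(f, c) \<in> index" "(g, c) \<in> index"
  then obtain e e' where e: "c = to_nat e" "\<forall>n. app e (N n) (N (f n))" "c = to_nat e'" "\<forall>n. app e' (N n) (N (g n))"
    using index_good unfolding good_def by metis
  then have "e = e'" by simp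
  then have "N (f n) = N (g n)" for n using e app_det by blast
  then show "f = g" by auto
qed

text \<open>Only a notation for the value of a converging application; convergence is carried
  separately, by \<open>app\<close> or by membership in \<open>fn\<close>.\<close>

definition ap :: "val \<Rightarrow> val \<Rightarrow> val" where "ap f a = (THE r. app f a r)"

lemma ap_eq: "app f a r \<Longrightarrow> ap f a = r"
  unfolding ap_def using app_det by blast

section \<open>Extensional operations of finite type\<close>

type_synonym vrel = "(val \<times> val) set"

definition unitr :: vrel where "unitr = {(N 0, N 0)}"
definition natr :: vrel where "natr = range (\<lambda>n. (N n, N n))"
definition prodr :: "vrel \<Rightarrow> vrel \<Rightarrow> vrel" where
  "prodr A B = {(Pr a b, Pr a' b') | a b a' b'. (a, a') \<in> A \<and> (b, b') \<in> B}"
definition sumr :: "vrel \<Rightarrow> vrel \<Rightarrow> vrel" where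
  "sumr A B = {(VInl a, VInl a') | a a'. (a, a') \<in> A} \<union> {(VInr b, VInr b') | b b'. (b, b') \<in> B}"
definition listr :: "vrel \<Rightarrow> vrel" where
  "listr A = {(L s, L t) | s t. list_all2 (\<lambda>x y. (x, y) \<in> A) s t}"
definition fn :: "vrel \<Rightarrow> vrel \<Rightarrow> vrel" where
  "fn A B = {(f, g). \<forall>a b. (a, b) \<in> A \<longrightarrow> (\<exists>r s. app f a r \<and> app g b s \<and> (r, s) \<in> B)}"

text \<open>Exactly the rules without premises; as rewrite rules they evaluate \<open>ap\<close>
  without any convergence side condition.\<close>

lemmas app_intros = appl.intros(1-5,7-9,11-15,17-28)
lemmas ap_simps [simp] = app_intros[THEN ap_eq]

lemma fnI: "(\<And>a b. (a, b) \<in> A \<Longrightarrow> app f a (F a) \<and> app g b (G b) \<and> (F a, G b) \<in> B) \<Longrightarrow> (f, g) \<in> fn A B"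
  unfolding fn_def by blast

lemma fnD: "(f, g) \<in> fn A B \<Longrightarrow> (a, b) \<in> A \<Longrightarrow> app f a (ap f a) \<and> app g b (ap g b) \<and> (ap f a, ap g b) \<in> B"
  unfolding fn_def using ap_eq by (clarsimp, metis)

lemma fnD2: "(f, g) \<in> fn A B \<Longrightarrow> (a, b) \<in> A \<Longrightarrow> (ap f a, ap g b) \<in> B"
  using fnD by blast

lemma natr_iff [simp]: "(x, y) \<in> natr \<longleftrightarrow> (\<exists>n. x = N n \<and> y = N n)" by (auto simp: natr_def)
lemma unitr_iff [simp]: "(x, y) \<in> unitr \<longleftrightarrow> x = N 0 \<and> y = N 0" by (auto simp: unitr_def)
lemma prodr_iff: "(x, y) \<in> prodr A B \<longleftrightarrow> (\<exists>a b a' b'. x = Pr a b \<and> y = Pr a' b' \<and> (a, a') \<in> A \<and> (b, b') \<in> B)"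
  by (auto simp: prodr_def)
lemma prodr_Pr [simp]: "(Pr a b, Pr c d) \<in> prodr A B \<longleftrightarrow> (a, c) \<in> A \<and> (b, d) \<in> B" by (auto simp: prodr_def)
lemma sumr_simps [simp]: "(VInl a, VInl b) \<in> sumr A B \<longleftrightarrow> (a, b) \<in> A" "(VInr a, VInr b) \<in> sumr A B \<longleftrightarrow> (a, b) \<in> B"
  by (auto simp: sumr_def)
lemma listr_iff: "(x, y) \<in> listr A \<longleftrightarrow> (\<exists>s t. x = L s \<and> y = L t \<and> list_all2 (\<lambda>x y. (x, y) \<in> A) s t)"
  by (auto simp: listr_def)
lemma listr_L [simp]: "(L s, L t) \<in> listr A \<longleftrightarrow> list_all2 (\<lambda>x y. (x, y) \<in> A) s t"
  by (auto simp: listr_def)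

fun els :: "val \<Rightarrow> val set" where "els (L s) = set s" | "els _ = {}"

lemma els_dom: "(l, l) \<in> listr A \<Longrightarrow> x \<in> els l \<Longrightarrow> (x, x) \<in> A"
  by (auto simp: listr_iff list_all2_same)

lemma app_S2: "app a c (ap a c) \<Longrightarrow> app b c (ap b c) \<Longrightarrow> app (ap a c) (ap b c) (ap (ap a c) (ap b c)) \<Longrightarrow>
   app (VS2 a b) c (ap (ap a c) (ap b c))"
  by (rule appl.intros(6))

lemma ap_S2: "app a c (ap a c) \<Longrightarrow> app b c (ap b c) \<Longrightarrow> app (ap a c) (ap b c) (ap (ap a c) (ap b c)) \<Longrightarrow>
   ap (VS2 a b) c = (ap (ap a c) (ap b c))"
  by (rule ap_eq[OF app_S2])

lemma fn2I:
  assumes "\<And>a. app f a (f1 a)" "\<And>a b. app (f1 a) b (f2 a b)"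
    "\<And>a a' b b'. (a, a') \<in> A \<Longrightarrow> (b, b') \<in> B \<Longrightarrow> (f2 a b, f2 a' b') \<in> C"
  shows "(f, f) \<in> fn A (fn B C)"
proof (rule fnI)
  fix a a' assume a: "(a, a') \<in> A"
  have "(f1 a, f1 a') \<in> fn B C"
    by (rule fnI[where F = "f2 a" and G = "f2 a'"]) (use assms a in auto)
  then show "app f a (f1 a) \<and> app f a' (f1 a') \<and> (f1 a, f1 a') \<in> fn B C" using assms by blast
qed

section \<open>Totality and extensionality of the primitive operations\<close>

lemma VK_rel: "(VK, VK) \<in> fn A (fn B A)"
  by (rule fn2I[where ?f1.0 = VK1 and ?f2.0 = "\<lambda>a b. a"]) (auto intro: appl.intros)

lemma VS2_rel:
  assumes "(a, a') \<in> fn A (fn B C)" "(b, b') \<in> fn A B"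
  shows "(VS2 a b, VS2 a' b') \<in> fn A C"
proof (rule fnI)
  fix c c' assume c: "(c, c') \<in> A"
  note 1 = fnD[OF assms(1) c] and 2 = fnD[OF assms(2) c]
  then have 3: "(ap a c, ap a' c') \<in> fn B C" "(ap b c, ap b' c') \<in> B" by auto
  note 4 = fnD[OF 3]
  show "app (VS2 a b) c (ap (ap a c) (ap b c)) \<and> app (VS2 a' b') c' (ap (ap a' c') (ap b' c')) \<and>
       (ap (ap a c) (ap b c), ap (ap a' c') (ap b' c')) \<in> C"
    using 1 2 4 by (auto intro: app_S2)
qed

lemma VS_rel: "(VS, VS) \<in> fn (fn A (fn B C)) (fn (fn A B) (fn A C))"
  by (rule fn2I[OF appl.intros(4,5) VS2_rel])

lemma Rec_app:
  assumes "app f (N n) (ap f (N n))" "app (VRec2 a f) (N n) (ap (VRec2 a f) (N n))"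
    "app (ap f (N n)) (ap (VRec2 a f) (N n)) r"
  shows "app (VRec2 a f) (N (Suc n)) r"
  using assms by (blast intro: appl.intros(10))

lemma VRec2_rel:
  assumes "(a, a') \<in> A" "(f, f') \<in> fn natr (fn A A)"
  shows "(VRec2 a f, VRec2 a' f') \<in> fn natr A"
proof -
  have "\<exists>r s. app (VRec2 a f) (N n) r \<and> app (VRec2 a' f') (N n) s \<and> (r, s) \<in> A" for n
  proof (induction n)
    case 0 show ?case using assms appl.intros(9) by blast
  next
    case (Suc n)
    then obtain r s where rs: "app (VRec2 a f) (N n) r" "app (VRec2 a' f') (N n) s" "(r, s) \<in> A" by blast
    note 1 = fnD[OF assms(2), of "N n" "N n", simplified]
    then have 2: "app (ap f (N n)) r (ap (ap f (N n)) r) \<and> app (ap f' (N n)) s (ap (ap f' (N n)) s) \<and>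
      (ap (ap f (N n)) r, ap (ap f' (N n)) s) \<in> A" using fnD rs by blast
    show ?case
      by (intro exI conjI, rule appl.intros(10)[OF rs(1)], (use 1 2 in blast)+,
          rule appl.intros(10)[OF rs(2)], (use 1 2 in blast)+)
  qed
  then show ?thesis by (auto simp: fn_def)
qed

lemma VRec_rel: "(VRec, VRec) \<in> fn A (fn (fn natr (fn A A)) (fn natr A))"
  by (rule fn2I[OF appl.intros(7,8) VRec2_rel])

lemma ap_Rec_Suc:
  assumes "(a, a) \<in> A" "(f, f) \<in> fn natr (fn A A)"
  shows "ap (VRec2 a f) (N (Suc n)) = ap (ap f (N n)) (ap (VRec2 a f) (N n))"
proof -
  have 1: "app (VRec2 a f) (N n) (ap (VRec2 a f) (N n)) \<and> (ap (VRec2 a f) (N n), ap (VRec2 a f) (N n)) \<in> A"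
    using fnD[OF VRec2_rel[OF assms], of "N n" "N n"] by simp
  have 2: "app f (N n) (ap f (N n)) \<and> (ap f (N n), ap f (N n)) \<in> fn A A"
    using fnD[OF assms(2), of "N n" "N n"] by simp
  have "app (ap f (N n)) (ap (VRec2 a f) (N n)) (ap (ap f (N n)) (ap (VRec2 a f) (N n)))"
    using 1 2 fnD by blast
  then show ?thesis using 1 2 Rec_app ap_eq by blast
qed

lemma VFold2_rel:
  assumes "(a, a') \<in> A" "(f, f') \<in> fn B (fn A A)"
  shows "(VFold2 a f, VFold2 a' f') \<in> fn (listr B) A"
proof -
  have "\<exists>r u. app (VFold2 a f) (L s) r \<and> app (VFold2 a' f') (L t) u \<and> (r, u) \<in> A"
    if "list_all2 (\<lambda>x y. (x, y) \<in> B) s t" for s t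
    using that
  proof (induction rule: list_all2_induct)
    case Nil show ?case using assms appl.intros(15) by blast
  next
    case (Cons x xs y ys)
    then obtain r s where rs: "app (VFold2 a f) (L xs) r" "app (VFold2 a' f') (L ys) s" "(r, s) \<in> A" by blast
    note 1 = fnD[OF assms(2) Cons(1)]
    then have 2: "app (ap f x) r (ap (ap f x) r) \<and> app (ap f' y) s (ap (ap f' y) s) \<and>
      (ap (ap f x) r, ap (ap f' y) s) \<in> A" using fnD rs by blast
    show ?case
      by (intro exI conjI, rule appl.intros(16)[OF rs(1)], (use 1 2 in blast)+,
          rule appl.intros(16)[OF rs(2)], (use 1 2 in blast)+)
  qed
  then show ?thesis unfolding fn_def listr_def by blast
qed

lemma VFold_rel: "(VFold, VFold) \<in> fn A (fn (fn B (fn A A)) (fn (listr B) A))"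
  by (rule fn2I[OF appl.intros(13,14) VFold2_rel])

lemma ap_Fold_Cons:
  assumes "(a, a) \<in> A" "(f, f) \<in> fn B (fn A A)" "(x, x) \<in> B" "(L s, L s) \<in> listr B"
  shows "ap (VFold2 a f) (L (x # s)) = ap (ap f x) (ap (VFold2 a f) (L s))"
proof -
  have 1: "app (VFold2 a f) (L s) (ap (VFold2 a f) (L s)) \<and> (ap (VFold2 a f) (L s), ap (VFold2 a f) (L s)) \<in> A"
    using fnD[OF VFold2_rel[OF assms(1,2)] assms(4)] by simp
  have 2: "app f x (ap f x) \<and> (ap f x, ap f x) \<in> fn A A"
    using fnD[OF assms(2,3)] by simp
  have "app (ap f x) (ap (VFold2 a f) (L s)) (ap (ap f x) (ap (VFold2 a f) (L s)))"
    using 1 2 fnD by blast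
  then show ?thesis by (intro ap_eq appl.intros(16)[OF conjunct1[OF 1] conjunct1[OF 2]])
qed

lemma fn_listI:
  assumes "\<And>s. app f (L s) (F s)" "\<And>s. app g (L s) (G s)"
    "\<And>s t. list_all2 (\<lambda>x y. (x, y) \<in> A) s t \<Longrightarrow> (F s, G t) \<in> B"
  shows "(f, g) \<in> fn (listr A) B"
  using assms unfolding fn_def listr_def by blast

lemma VCons_rel: "(VCons, VCons) \<in> fn A (fn (listr A) (listr A))"
proof (rule fnI[where F = VCons1 and G = VCons1])
  fix a b assume ab: "(a, b) \<in> A"
  have "(VCons1 a, VCons1 b) \<in> fn (listr A) (listr A)"
    by (rule fn_listI[OF appl.intros(12,12)]) (simp add: ab)
  then show "app VCons a (VCons1 a) \<and> app VCons b (VCons1 b) \<and> (VCons1 a, VCons1 b) \<in> fn (listr A) (listr A)"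
    by (intro conjI appl.intros(11))
qed

lemma VAppend_rel: "(VAppend, VAppend) \<in> fn (listr A) (fn (listr A) (listr A))"
proof (rule fn_listI)
  fix s t assume st: "list_all2 (\<lambda>x y. (x, y) \<in> A) s t"
  show "(VAppend1 s, VAppend1 t) \<in> fn (listr A) (listr A)"
    by (rule fn_listI, rule appl.intros, rule appl.intros) (use st in \<open>auto intro: list_all2_appendI\<close>)
qed (rule appl.intros)+

lemma fn_natI:
  assumes "\<And>n. app f (N n) (F n)" "\<And>n. app g (N n) (G n)" "\<And>n. (F n, G n) \<in> B"
  shows "(f, g) \<in> fn natr B"
  using assms unfolding fn_def natr_def by blast

lemma VSuc_rel: "(VSuc, VSuc) \<in> fn natr natr"
  by (rule fn_natI[OF appl.intros(1,1)]) simp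
lemma VPr_rel: "(VPr, VPr) \<in> fn A (fn B (prodr A B))"
  by (rule fn2I[OF appl.intros(17,18)]) simp
lemma VFst_rel: "(VFst, VFst) \<in> fn (prodr A B) A"
  unfolding fn_def prodr_def using appl.intros(19) by blast
lemma VSnd_rel: "(VSnd, VSnd) \<in> fn (prodr A B) B"
  unfolding fn_def prodr_def using appl.intros(20) by blast
lemma VInlC_rel: "(VInlC, VInlC) \<in> fn A (sumr A B)"
  by (rule fnI[where F = VInl and G = VInl]) (auto intro: appl.intros)
lemma VInrC_rel: "(VInrC, VInrC) \<in> fn B (sumr A B)"
  by (rule fnI[where F = VInr and G = VInr]) (auto intro: appl.intros)

lemma lefts_rel: "list_all2 (\<lambda>x y. (x, y) \<in> sumr A B) s t \<Longrightarrow>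
   list_all2 (\<lambda>x y. (x, y) \<in> A) (lefts s) (lefts t) \<and> list_all2 (\<lambda>x y. (x, y) \<in> B) (rights s) (rights t)"
  by (induction rule: list_all2_induct) (auto simp: sumr_def)

lemma set_lefts: "x \<in> set (lefts s) \<longleftrightarrow> VInl x \<in> set s"
  by (induction s rule: lefts.induct) auto
lemma set_rights: "x \<in> set (rights s) \<longleftrightarrow> VInr x \<in> set s"
  by (induction s rule: rights.induct) auto

lemma VLefts_rel: "(VLefts, VLefts) \<in> fn (listr (sumr A B)) (listr A)"
  by (rule fn_listI[OF appl.intros(25,25)]) (use lefts_rel in auto)
lemma VRights_rel: "(VRights, VRights) \<in> fn (listr (sumr A B)) (listr B)"
  by (rule fn_listI[OF appl.intros(26,26)]) (use lefts_rel in auto)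

lemma VOrc_rel: "(VOrc k, VOrc k) \<in> fn natr natr"
  by (rule fn_natI[OF appl.intros(27,27)]) simp

lemma fn_nat_nat:
  assumes "(f, g) \<in> fn natr natr"
  obtains h where "\<And>n. app f (N n) (N (h n))" "\<And>n. app g (N n) (N (h n))"
proof -
  have "\<exists>m. app f (N n) (N m) \<and> app g (N n) (N m)" for n
    using fnD[OF assms, of "N n" "N n"] by auto
  then show ?thesis using that by metis
qed

text \<open>Two programs for the same function query \<open>branch\<close> at the same argument, so
  extensional equality is respected although the branch is chosen nonconstructively.\<close>

lemma VMu_rel: "(VMu, VMu) \<in> fn (fn natr natr) (fn natr natr)"
proof (rule fnI)
  fix a b assume "(a, b) \<in> fn natr natr"
  then obtain h where h: "\<And>n. app a (N n) (N (h n))" "\<And>n. app b (N n) (N (h n))" by (rule fn_nat_nat) blast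
  have "app (VMu1 a) (N k) (N (branch h k))" "app (VMu1 b) (N k) (N (branch h k))" for k
    by (rule appl.intros(29), rule h)+
  then show "app VMu a (VMu1 a) \<and> app VMu b (VMu1 b) \<and> (VMu1 a, VMu1 b) \<in> fn natr natr"
    by (intro conjI appl.intros(28) fn_natI) auto
qed

text \<open>Maximality of the graph enters here as totality: the function of every total program is
  in the graph. Since the value depends on the function and not on the program, \<open>VId\<close>
  is a genuine object of type 2.\<close>

lemma VId_rel: "(VId, VId) \<in> fn (fn natr natr) natr"
proof -
  { fix a b assume "(a, b) \<in> fn natr natr"
    then obtain h where h: "\<And>n. app a (N n) (N (h n))" "\<And>n. app b (N n) (N (h n))" by (rule fn_nat_nat) blast
    obtain c where "(h, c) \<in> index" using index_total[OF h(1)] by blast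
    then have "app VId a (N c)" "app VId b (N c)" by (auto intro!: appl.intros(30) h)
    then have "\<exists>r s. app VId a r \<and> app VId b s \<and> (r, s) \<in> natr" by auto }
  then show ?thesis unfolding fn_def by blast
qed

section \<open>The type structure and the evaluation of terms\<close>

fun per :: "ty \<Rightarrow> vrel" where
  "per NN = natr"
| "per (\<sigma> \<rightarrow> \<tau>) = fn (per \<sigma>) (per \<tau>)"
| "per (\<sigma>\<^sup>\<star>) = listr (per \<sigma>)"

lemma fn_sym:
  assumes "\<And>a b. (a, b) \<in> A \<Longrightarrow> (b, a) \<in> A" "\<And>a b. (a, b) \<in> B \<Longrightarrow> (b, a) \<in> B" "(f, g) \<in> fn A B"
  shows "(g, f) \<in> fn A B"
proof (rule fnI)
  fix a b assume "(a, b) \<in> A"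
  from fnD[OF assms(3) assms(1)[OF this]] show "app g a (ap g a) \<and> app f b (ap f b) \<and> (ap g a, ap f b) \<in> B"
    using assms(2)[of "ap f b" "ap g a"] by simp
qed

lemma fn_trans:
  assumes "\<And>a b. (a, b) \<in> A \<Longrightarrow> (b, b) \<in> A" "\<And>a b c. (a, b) \<in> B \<Longrightarrow> (b, c) \<in> B \<Longrightarrow> (a, c) \<in> B"
    "(f, g) \<in> fn A B" "(g, h) \<in> fn A B"
  shows "(f, h) \<in> fn A B"
proof (rule fnI)
  fix a b assume ab: "(a, b) \<in> A"
  note 1 = fnD[OF assms(3) ab] and 2 = fnD[OF assms(4) assms(1)[OF ab]]
  show "app f a (ap f a) \<and> app h b (ap h b) \<and> (ap f a, ap h b) \<in> B"
    using 1 2 assms(2)[of "ap f a" "ap g b" "ap h b"] by simp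
qed

lemma listr_sym: "(\<And>a b. (a, b) \<in> A \<Longrightarrow> (b, a) \<in> A) \<Longrightarrow> (f, g) \<in> listr A \<Longrightarrow> (g, f) \<in> listr A"
proof -
  assume sy: "\<And>a b. (a, b) \<in> A \<Longrightarrow> (b, a) \<in> A" and "(f, g) \<in> listr A"
  then obtain s t where e: "f = L s" "g = L t" and st: "list_all2 (\<lambda>x y. (x, y) \<in> A) s t"
    unfolding listr_iff by blast
  have "list_all2 (\<lambda>x y. (x, y) \<in> A) t s"
    using st by (induction rule: list_all2_induct) (simp_all add: sy)
  then show "(g, f) \<in> listr A" by (simp add: e)
qed

lemma listr_trans:
  "(\<And>a b c. (a, b) \<in> A \<Longrightarrow> (b, c) \<in> A \<Longrightarrow> (a, c) \<in> A) \<Longrightarrow> (f, g) \<in> listr A \<Longrightarrow> (g, h) \<in> listr A \<Longrightarrow>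
   (f, h) \<in> listr A"
proof -
  assume tr: "\<And>a b c. (a, b) \<in> A \<Longrightarrow> (b, c) \<in> A \<Longrightarrow> (a, c) \<in> A" and "(f, g) \<in> listr A" "(g, h) \<in> listr A"
  then obtain s t u where e: "f = L s" "h = L u" and
    st: "list_all2 (\<lambda>x y. (x, y) \<in> A) s t" "list_all2 (\<lambda>x y. (x, y) \<in> A) t u"
    unfolding listr_iff by blast
  have "list_all2 (\<lambda>x y. (x, y) \<in> A) s u" by (rule list_all2_trans[OF _ st]) (rule tr)
  then show "(f, h) \<in> listr A" by (simp add: e)
qed

text \<open>The two properties are proved together: composing related functions needs self-related
  arguments, and these come from symmetry and transitivity at the argument type.\<close>

lemma per_sym_trans: "(\<forall>a b. (a, b) \<in> per \<sigma> \<longrightarrow> (b, a) \<in> per \<sigma>) \<and>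
  (\<forall>a b c. (a, b) \<in> per \<sigma> \<longrightarrow> (b, c) \<in> per \<sigma> \<longrightarrow> (a, c) \<in> per \<sigma>)"
proof (induction \<sigma>)
  case NN show ?case unfolding per.simps natr_iff by blast
next
  case (Arr \<sigma> \<tau>)
  then have d: "(a, b) \<in> per \<sigma> \<Longrightarrow> (b, b) \<in> per \<sigma>" for a b by blast
  have "(g, f) \<in> fn (per \<sigma>) (per \<tau>)" if "(f, g) \<in> fn (per \<sigma>) (per \<tau>)" for f g
    by (rule fn_sym[OF _ _ that]) (use Arr in blast)+
  moreover have "(f, h) \<in> fn (per \<sigma>) (per \<tau>)"
    if "(f, g) \<in> fn (per \<sigma>) (per \<tau>)" "(g, h) \<in> fn (per \<sigma>) (per \<tau>)" for f g h
    by (rule fn_trans[OF d _ that]) (use Arr in blast)+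
  ultimately show ?case unfolding per.simps by blast
next
  case (Seq \<sigma>)
  have "(g, f) \<in> listr (per \<sigma>)" if "(f, g) \<in> listr (per \<sigma>)" for f g
    by (rule listr_sym[OF _ that]) (use Seq in blast)
  moreover have "(f, h) \<in> listr (per \<sigma>)"
    if "(f, g) \<in> listr (per \<sigma>)" "(g, h) \<in> listr (per \<sigma>)" for f g h
    by (rule listr_trans[OF _ that]) (use Seq in blast)
  ultimately show ?case unfolding per.simps by blast
qed

lemma per_sym: "(a, b) \<in> per \<sigma> \<Longrightarrow> (b, a) \<in> per \<sigma>" using per_sym_trans by blast
lemma per_trans: "(a, b) \<in> per \<sigma> \<Longrightarrow> (b, c) \<in> per \<sigma> \<Longrightarrow> (a, c) \<in> per \<sigma>" using per_sym_trans by blast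
lemma per_dom: "(a, b) \<in> per \<sigma> \<Longrightarrow> (a, a) \<in> per \<sigma>" "(a, b) \<in> per \<sigma> \<Longrightarrow> (b, b) \<in> per \<sigma>"
  using per_sym_trans by blast+

fun cval :: "cst \<Rightarrow> val" where
  "cval CZero = N 0" | "cval CSucc = VSuc" | "cval (CK \<sigma> \<tau>) = VK" | "cval (CS \<rho> \<sigma> \<tau>) = VS"
| "cval (CRec \<rho>) = VRec" | "cval (CNil \<sigma>) = L []" | "cval (CCons \<sigma>) = VCons" | "cval (CFold \<sigma> \<rho>) = VFold"

lemma cval_rel: "(cval c, cval c) \<in> per (cty c)"
  by (cases c) (auto intro: VSuc_rel VK_rel VS_rel VRec_rel VCons_rel VFold_rel)

fun ev :: "(var \<Rightarrow> val) \<Rightarrow> tm \<Rightarrow> val" where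
  "ev v (Var x) = v x" | "ev v (Cst c) = cval c" | "ev v (t \<cdot> s) = ap (ev v t) (ev v s)"

lemma ev_rel: "wt t \<Longrightarrow> (\<And>x. x \<in> fvt t \<Longrightarrow> (v x, v' x) \<in> per (snd x)) \<Longrightarrow> (ev v t, ev v' t) \<in> per (tyof t)"
proof (induction t)
  case (App t s)
  then obtain \<tau> where \<tau>: "tyof t = tyof s \<rightarrow> \<tau>" by auto
  have "(ev v t, ev v' t) \<in> per (tyof t)" "(ev v s, ev v' s) \<in> per (tyof s)" using App by auto
  then show ?case using \<tau> by (auto intro: fnD2)
qed (auto intro: cval_rel)

lemma ev_cong: "(\<And>x. x \<in> fvt t \<Longrightarrow> v x = v' x) \<Longrightarrow> ev v t = ev v' t"
  by (induction t) auto

lemma ev_subst: "ev v (substt x u t) = ev (v(x := ev v u)) t"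
  by (induction t) auto

lemma tyof_substt: "tyof u = snd x \<Longrightarrow> tyof (substt x u t) = tyof t"
  by (induction t) auto

lemma ev_app: "wt (t \<cdot> s) \<Longrightarrow> (\<And>x. x \<in> fvt (t \<cdot> s) \<Longrightarrow> (v x, v x) \<in> per (snd x)) \<Longrightarrow>
    app (ev v t) (ev v s) (ap (ev v t) (ev v s))"
proof -
  assume a: "wt (t \<cdot> s)" "(\<And>x. x \<in> fvt (t \<cdot> s) \<Longrightarrow> (v x, v x) \<in> per (snd x))"
  then obtain \<tau> where "tyof t = tyof s \<rightarrow> \<tau>" by auto
  then show ?thesis using ev_rel[of t v v] ev_rel[of s v v] a by (auto dest: fnD)
qed

text \<open>Convergence is part of the claim: \<open>VS2\<close> has a value only if both halves and
  their application converge, which the typing of the environment supplies. Nothing is asked of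
  \<open>v x\<close>, since the argument replaces it.\<close>

lemma ev_lam_app: "wt t \<Longrightarrow> (\<And>y. y \<in> fvt t \<Longrightarrow> y \<noteq> x \<Longrightarrow> (v y, v y) \<in> per (snd y)) \<Longrightarrow> (a, a) \<in> per (snd x) \<Longrightarrow>
   app (ev v (lam x t)) a (ev (v(x := a)) t)"
proof (induction t)
  case (Var y)
  show ?case
  proof (cases "x = y")
    case True
    have "app (VS2 VK VK) a a" by (rule appl.intros(6)[of _ VK a "VK1 a" VK "VK1 a"]) (rule appl.intros(2,3))+
    then show ?thesis using True by (simp add: Let_def)
  qed (auto simp: Let_def intro: appl.intros(3))
next
  case (Cst c) then show ?case by (auto intro: appl.intros(3))
next
  case (App t s)
  have w: "wt t" "wt s" using App.prems(1) by simp_all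
  have 1: "app (ev v (lam x t)) a (ev (v(x := a)) t)"
    by (rule App.IH(1)[OF w(1) App.prems(2,3)]) simp
  have 2: "app (ev v (lam x s)) a (ev (v(x := a)) s)"
    by (rule App.IH(2)[OF w(2) App.prems(2,3)]) simp
  have "((v(x := a)) y, (v(x := a)) y) \<in> per (snd y)" if "y \<in> fvt (t \<cdot> s)" for y
    using App.prems(2)[OF that] App.prems(3) by (cases "y = x") simp_all
  then have "app (ev (v(x := a)) t) (ev (v(x := a)) s) (ev (v(x := a)) (t \<cdot> s))"
    using ev_app[OF App.prems(1), of "v(x := a)"] by simp
  then have "app (VS2 (ev v (lam x t)) (ev v (lam x s))) a (ev (v(x := a)) (t \<cdot> s))"
    by (rule appl.intros(6)[OF 1 2])
  then show ?case by (simp del: fun_upd_apply)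
qed

lemmas ev_lam = ev_lam_app[THEN ap_eq]

section \<open>Worlds and realizers\<close>

text \<open>Truth in the standard structure, meaningful for internal formulas only.\<close>

fun sat :: "(var \<Rightarrow> val) \<Rightarrow> fm \<Rightarrow> bool" where
  "sat v Bot \<longleftrightarrow> False"
| "sat v (s \<^bold>= t) \<longleftrightarrow> (ev v s, ev v t) \<in> per (tyof s)"
| "sat v (St t) \<longleftrightarrow> False"
| "sat v (\<phi> \<^bold>\<longrightarrow> \<psi>) \<longleftrightarrow> (sat v \<phi> \<longrightarrow> sat v \<psi>)"
| "sat v (Forall x \<phi>) \<longleftrightarrow> (\<forall>d. (d, d) \<in> per (snd x) \<longrightarrow> sat (v(x := d)) \<phi>)"

fun vfst :: "val \<Rightarrow> val" where "vfst (Pr a b) = a" | "vfst _ = N 0"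
fun vsnd :: "val \<Rightarrow> val" where "vsnd (Pr a b) = b" | "vsnd _ = N 0"

text \<open>A world is a set of states \<open>wcar\<close>. At each state the program data available is \<open>wpt\<close>, an element of the
  type \<open>wrel\<close>, and the state is subject to the conditions \<open>wcon\<close> indexed by the type \<open>widx\<close>. Only finitely
  many conditions, listed by a program from the data, may be used at a time.\<close>

record world =
  wcar :: "val set"
  wrel :: vrel
  wpt :: "val \<Rightarrow> val"
  widx :: vrel
  wcon :: "val \<Rightarrow> val \<Rightarrow> bool"

definition ok :: "world \<Rightarrow> bool" where
  "ok p \<longleftrightarrow> (\<forall>w\<in>wcar p. (wpt p w, wpt p w) \<in> wrel p)"

text \<open>One program has to serve all states, and it sees a state only through
  \<open>wpt\<close>. Arbitrary functions of the state, by contrast, play the nonstandard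
  objects.\<close>

definition computed :: "world \<Rightarrow> vrel \<Rightarrow> (val \<Rightarrow> val) \<Rightarrow> bool" where
  "computed p A g \<longleftrightarrow> (\<exists>F. (F, F) \<in> fn (wrel p) A \<and> (\<forall>w\<in>wcar p. app F (wpt p w) (g w)))"

abbreviation conds :: "world \<Rightarrow> vrel" where "conds p \<equiv> listr (widx p)"
abbreviation meets :: "world \<Rightarrow> val \<Rightarrow> val \<Rightarrow> bool" where "meets p w l \<equiv> \<forall>z\<in>els l. wcon p w z"

text \<open>Along \<open>\<pi>\<close>, the data of \<open>p\<close> are computed from those of \<open>q\<close>, and each condition of \<open>p\<close> follows from finitely
  many conditions of \<open>q\<close> found by a program.\<close>

definition wle :: "world \<Rightarrow> (val \<Rightarrow> val) \<Rightarrow> world \<Rightarrow> bool" where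
  "wle q \<pi> p \<longleftrightarrow> ok q \<and> (\<forall>w\<in>wcar q. \<pi> w \<in> wcar p) \<and> computed q (wrel p) (\<lambda>w. wpt p (\<pi> w)) \<and>
     (\<exists>Y. computed q (fn (widx p) (conds q)) Y \<and>
       (\<forall>w\<in>wcar q. \<forall>z. (z, z) \<in> widx p \<longrightarrow> (meets q w (ap (Y w) z)) \<longrightarrow> wcon p (\<pi> w) z))"

lemma wle_ok: "wle q \<pi> p \<Longrightarrow> ok q" by (simp add: wle_def)
lemma wle_car: "wle q \<pi> p \<Longrightarrow> w \<in> wcar q \<Longrightarrow> \<pi> w \<in> wcar p" by (simp add: wle_def)

section \<open>Uniform computations and passage between worlds\<close>

lemma computed_typed: assumes "ok p" "computed p A g" "w \<in> wcar p" shows "(g w, g w) \<in> A"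
proof -
  obtain F where F: "(F, F) \<in> fn (wrel p) A" "app F (wpt p w) (g w)" using assms by (auto simp: computed_def)
  have "(wpt p w, wpt p w) \<in> wrel p" using assms by (auto simp: ok_def)
  from fnD[OF F(1) this] ap_eq[OF F(2)] show ?thesis by simp
qed

lemma computed_cong: "computed p A g \<Longrightarrow> (\<And>w. w \<in> wcar p \<Longrightarrow> g w = g' w) \<Longrightarrow> computed p A g'"
  unfolding computed_def by force

lemma computed_const: assumes "(c, c) \<in> A" shows "computed p A (\<lambda>w. c)"
  unfolding computed_def
  by (intro exI[of _ "VK1 c"] conjI ballI appl.intros(3) fnI[where F = "\<lambda>_. c" and G = "\<lambda>_. c"] assms)

lemma computed_app: assumes ok: "ok p" and "computed p (fn A B) f" "computed p A g" shows "computed p B (\<lambda>w. ap (f w) (g w))"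
proof -
  obtain F G where F: "(F, F) \<in> fn (wrel p) (fn A B)" "\<And>w. w \<in> wcar p \<Longrightarrow> app F (wpt p w) (f w)"
    and G: "(G, G) \<in> fn (wrel p) A" "\<And>w. w \<in> wcar p \<Longrightarrow> app G (wpt p w) (g w)"
    using assms by (auto simp: computed_def)
  have "app (VS2 F G) (wpt p w) (ap (f w) (g w))" if w: "w \<in> wcar p" for w
    by (rule appl.intros(6)[OF F(2)[OF w] G(2)[OF w]])
      (use fnD[OF computed_typed[OF ok assms(2) w] computed_typed[OF ok assms(3) w]] in blast)
  then show ?thesis unfolding computed_def using VS2_rel[OF F(1) G(1)] by blast
qed

lemma computed_pt: "computed p (wrel p) (wpt p)"
proof -
  have i: "app (VS2 VK VK) a a" for a by (rule appl.intros(6)[OF appl.intros(2,2,3)])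
  have "(VS2 VK VK, VS2 VK VK) \<in> fn (wrel p) (wrel p)"
    by (rule fnI[where F = "\<lambda>a. a" and G = "\<lambda>a. a"]) (use i in blast)
  then show ?thesis unfolding computed_def using i by blast
qed

lemma computed_wle: assumes le: "wle q \<pi> p" and "computed p A g" shows "computed q A (\<lambda>w. g (\<pi> w))"
proof -
  obtain F where F: "(F, F) \<in> fn (wrel p) A" "\<And>w. w \<in> wcar p \<Longrightarrow> app F (wpt p w) (g w)"
    using assms by (auto simp: computed_def)
  have "computed q A (\<lambda>w. ap F (wpt p (\<pi> w)))"
    by (rule computed_app[OF wle_ok[OF le] computed_const[OF F(1)]]) (use le in \<open>simp add: wle_def\<close>)
  then show ?thesis by (rule computed_cong) (use F(2) ap_eq wle_car[OF le] in blast)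
qed

lemma wle_refl: assumes "ok p" shows "wle p (\<lambda>w. w) p"
proof -
  define c where "c = VS2 VCons (VK1 (L []))"
  have c: "app c z (L [z])" for z unfolding c_def
    by (rule appl.intros(6)[OF appl.intros(11) appl.intros(3) appl.intros(12)])
  have "(c, c) \<in> fn A (listr A)" for A
    by (rule fnI[where F = "\<lambda>z. L [z]" and G = "\<lambda>z. L [z]"]) (simp add: c)
  then have "computed p (fn (widx p) (conds p)) (\<lambda>w. c)" by (rule computed_const)
  then show ?thesis unfolding wle_def using assms computed_pt[of p]
    by (auto simp: ap_eq[OF c])
qed

text \<open>The states acquire a new component \<open>a \<in> C w\<close>, of which the data see only \<open>k a\<close>, and new conditions
  \<open>Q\<close> indexed by \<open>S\<close>. With \<open>k\<close> the identity the new component is standard, with \<open>k\<close> constant it is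
  nonstandard.\<close>

definition ext :: "world \<Rightarrow> (val \<Rightarrow> val set) \<Rightarrow> vrel \<Rightarrow> (val \<Rightarrow> val) \<Rightarrow> vrel \<Rightarrow> (val \<Rightarrow> val \<Rightarrow> val \<Rightarrow> bool) \<Rightarrow> world" where
  "ext p C A k S Q = \<lparr>wcar = {Pr w a | w a. w \<in> wcar p \<and> a \<in> C w}, wrel = prodr (wrel p) A,
     wpt = \<lambda>u. Pr (wpt p (vfst u)) (k (vsnd u)), widx = sumr (widx p) S,
     wcon = \<lambda>u z. case z of VInl z' \<Rightarrow> wcon p (vfst u) z' | VInr x \<Rightarrow> Q (vfst u) (vsnd u) x | _ \<Rightarrow> True\<rparr>"

definition typed_by :: "world \<Rightarrow> (val \<Rightarrow> val set) \<Rightarrow> vrel \<Rightarrow> (val \<Rightarrow> val) \<Rightarrow> bool" where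
  "typed_by p C A k \<longleftrightarrow> (\<forall>w\<in>wcar p. \<forall>a\<in>C w. (k a, k a) \<in> A)"

lemma ext_simps [simp]:
  "u \<in> wcar (ext p C A k S Q) \<longleftrightarrow> (\<exists>w a. u = Pr w a \<and> w \<in> wcar p \<and> a \<in> C w)"
  "wrel (ext p C A k S Q) = prodr (wrel p) A"
  "wpt (ext p C A k S Q) u = Pr (wpt p (vfst u)) (k (vsnd u))"
  "widx (ext p C A k S Q) = sumr (widx p) S"
  "wcon (ext p C A k S Q) u (VInl z) = wcon p (vfst u) z"
  "wcon (ext p C A k S Q) u (VInr x) = Q (vfst u) (vsnd u) x"
  by (auto simp: ext_def)

lemma ok_ext: "ok p \<Longrightarrow> typed_by p C A k \<Longrightarrow> ok (ext p C A k S Q)"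
  by (auto simp: ok_def typed_by_def)

lemma singleton_code:
  assumes h: "\<And>a. app h a (H a)" "\<And>a b. (a, b) \<in> A \<Longrightarrow> (H a, H b) \<in> B"
  obtains c where "(c, c) \<in> fn A (listr B)" "\<And>a. ap c a = L [H a]"
proof -
  define c where "c = VS2 (VS2 (VK1 VCons) h) (VK1 (L []))"
  have c: "app c a (L [H a])" for a
    unfolding c_def
    by (rule appl.intros(6)[OF appl.intros(6)[OF appl.intros(3) h(1) appl.intros(11)] appl.intros(3) appl.intros(12)])
  have "(c, c) \<in> fn A (listr B)"
    by (rule fnI[where F = "\<lambda>a. L [H a]" and G = "\<lambda>a. L [H a]"]) (simp add: c h)
  then show ?thesis using that ap_eq[OF c] by blast
qed

lemma wle_ext: assumes "ok p" "typed_by p C A k" shows "wle (ext p C A k S Q) vfst p"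
proof -
  let ?q = "ext p C A k S Q"
  have 1: "computed ?q (wrel p) (\<lambda>u. wpt p (vfst u))"
    unfolding computed_def by (intro exI[of _ VFst] conjI) (auto intro: VFst_rel appl.intros(19))
  obtain c where c: "(c, c) \<in> fn (widx p) (conds ?q)" "\<And>a. ap c a = L [VInl a]"
    by (rule singleton_code[OF appl.intros(21), where A = "widx p" and B = "widx ?q"]) auto
  show ?thesis unfolding wle_def
    using ok_ext[OF assms] 1 computed_const[OF c(1), of ?q] c(2) by auto
qed

lemma computed_var: "computed (ext p C A k S Q) A (\<lambda>u. k (vsnd u))"
  unfolding computed_def by (intro exI[of _ VSnd] conjI) (auto intro: VSnd_rel appl.intros(20))

text \<open>The program for \<open>h\<close> receives the old data paired with \<open>k a\<close>,
  so currying it yields a function of \<open>k a\<close> alone. If \<open>k\<close> hides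
  \<open>a\<close>, the values of \<open>h\<close> at different \<open>a\<close> must already
  agree.\<close>

lemma computed_curry:
  assumes ok: "ok p" "typed_by p C A k" and h: "computed (ext p C A k S Q) B h"
  obtains g where "computed p (fn A B) g" "\<And>w a. w \<in> wcar p \<Longrightarrow> a \<in> C w \<Longrightarrow> ap (g w) (k a) = h (Pr w a)"
proof -
  obtain F where F: "(F, F) \<in> fn (prodr (wrel p) A) B"
    "\<And>w a. w \<in> wcar p \<Longrightarrow> a \<in> C w \<Longrightarrow> app F (Pr (wpt p w) (k a)) (h (Pr w a))"
  proof -
    obtain F where F: "(F, F) \<in> fn (prodr (wrel p) A) B"
      "\<And>u. u \<in> wcar (ext p C A k S Q) \<Longrightarrow> app F (wpt (ext p C A k S Q) u) (h u)"
      using h by (auto simp: computed_def)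
    have "app F (Pr (wpt p w) (k a)) (h (Pr w a))" if "w \<in> wcar p" "a \<in> C w" for w a
      using F(2)[of "Pr w a"] that by simp
    then show ?thesis using that F(1) by blast
  qed
  \<comment> \<open>\<open>?d b\<close> is the program sending \<open>a\<close> to the value of
    \<open>F\<close> at the pair of \<open>b\<close> and \<open>a\<close>, and \<open>?c\<close>
    produces \<open>?d b\<close> from \<open>b\<close>.\<close>
  let ?c = "VS2 (VK1 (VS1 (VK1 F))) VPr"
  let ?d = "\<lambda>b. VS2 (VK1 F) (VPr1 b)"
  have c: "app ?c b (?d b)" for b
    by (rule appl.intros(6)[OF appl.intros(3) appl.intros(17) appl.intros(5)])
  have d: "app (?d b) a r" if "app F (Pr b a) r" for b a r
    by (rule appl.intros(6)[OF appl.intros(3) appl.intros(18) that])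
  have "(?d b, ?d b') \<in> fn A B" if "(b, b') \<in> wrel p" for b b'
  proof (rule fnI)
    fix a a' assume "(a, a') \<in> A"
    then have "(Pr b a, Pr b' a') \<in> prodr (wrel p) A" using that by simp
    from fnD[OF F(1) this] show "app (?d b) a (ap F (Pr b a)) \<and> app (?d b') a' (ap F (Pr b' a')) \<and> (ap F (Pr b a), ap F (Pr b' a')) \<in> B"
      using d by blast
  qed
  then have "(?c, ?c) \<in> fn (wrel p) (fn A B)"
    using c by (intro fnI[where F = ?d and G = ?d]) blast
  then have "computed p (fn A B) (\<lambda>w. ?d (wpt p w))" unfolding computed_def using c by blast
  moreover have "ap (?d (wpt p w)) (k a) = h (Pr w a)" if "w \<in> wcar p" "a \<in> C w" for w a
    by (rule ap_eq[OF d[OF F(2)[OF that]]])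
  ultimately show ?thesis using that by blast
qed

text \<open>A generic standard element without conditions is a variable of type \<open>A\<close> in
  the context. With \<open>computed_lam\<close> as abstraction over it, later programs need not be
  written out in combinators.\<close>

abbreviation gen :: "world \<Rightarrow> vrel \<Rightarrow> world" where
  "gen p A \<equiv> ext p (\<lambda>_. {a. (a, a) \<in> A}) A (\<lambda>a. a) {} (\<lambda>_ _ _. True)"

lemma gen_typed: "typed_by p (\<lambda>_. {a. (a, a) \<in> A}) A (\<lambda>a. a)" by (simp add: typed_by_def)

lemma ok_gen: "ok p \<Longrightarrow> ok (gen p A)" by (rule ok_ext[OF _ gen_typed])

lemma computed_weak: "ok p \<Longrightarrow> computed p B g \<Longrightarrow> computed (gen p A) B (\<lambda>u. g (vfst u))"
  by (rule computed_wle[OF wle_ext[OF _ gen_typed]])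

lemma computed_gen_var: "computed (gen p A) A vsnd"
  using computed_var[of p _ A "\<lambda>a. a"] by simp

lemma computed_lam:
  assumes "ok p" "computed (gen p A) B h"
  obtains g where "computed p (fn A B) g" "\<And>w a. w \<in> wcar p \<Longrightarrow> (a, a) \<in> A \<Longrightarrow> ap (g w) a = h (Pr w a)"
  using computed_curry[OF assms(1) gen_typed assms(2)] by auto

section \<open>Finite lists computed from the data\<close>

lemma els_append: "(l, l) \<in> listr A \<Longrightarrow> (m, m) \<in> listr A \<Longrightarrow> els (ap (ap VAppend l) m) = els l \<union> els m"
  by (auto simp: listr_iff)
lemma els_lefts: "(l, l) \<in> listr A \<Longrightarrow> els (ap VLefts l) = {x. VInl x \<in> els l}"
  by (auto simp: listr_iff set_lefts)
lemma els_rights: "(l, l) \<in> listr A \<Longrightarrow> els (ap VRights l) = {x. VInr x \<in> els l}"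
  by (auto simp: listr_iff set_rights)

text \<open>Closure of finite lists under dependent unions is what lets conditions and challenges
  pass through compositions of realizers.\<close>

lemma computed_bind:
  assumes ok: "ok p" and l: "computed p (listr A) l" and f: "computed p (fn A (listr B)) f"
  obtains m where "computed p (listr B) m" "\<And>w. w \<in> wcar p \<Longrightarrow> els (m w) = (\<Union>x\<in>els (l w). els (ap (f w) x))"
proof -
  \<comment> \<open>\<open>?g w\<close> sends \<open>x\<close> to the operation that puts the list
    \<open>ap (f w) x\<close> in front; folding it over \<open>l w\<close> concatenates all these
    lists.\<close>
  let ?g = "\<lambda>w. ap (ap VS (ap VK VAppend)) (f w)"
  let ?m = "\<lambda>w. ap (ap (ap VFold (L [])) (?g w)) (l w)"
  have nil: "(L [], L []) \<in> listr B" by simp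
  have g: "computed p (fn A (fn (listr B) (listr B))) ?g"
    by (rule computed_app[OF ok computed_app[OF ok computed_const[OF VS_rel] computed_app[OF ok computed_const[OF VK_rel] computed_const[OF VAppend_rel]]] f])
  have m: "computed p (listr B) ?m"
    by (rule computed_app[OF ok computed_app[OF ok computed_app[OF ok computed_const[OF VFold_rel] computed_const[OF nil]] g] l])
  have "els (?m w) = (\<Union>x\<in>els (l w). els (ap (f w) x))" if w: "w \<in> wcar p" for w
  proof -
    note tf = computed_typed[OF ok f w] and tg = computed_typed[OF ok g w]
    have "els (ap (VFold2 (L []) (?g w)) (L s)) = (\<Union>x\<in>set s. els (ap (f w) x))" if "(L s, L s) \<in> listr A" for s
      using that
    proof (induction s)
      case (Cons x s)
      then have x: "(x, x) \<in> A" "(L s, L s) \<in> listr A" by auto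
      have fx: "(ap (f w) x, ap (f w) x) \<in> listr B" by (rule fnD2[OF tf x(1)])
      have "(ap (f w) x, ap (f w) x) \<in> listr B \<and> app (f w) x (ap (f w) x)" using fnD[OF tf x(1)] by simp
      then have gx: "ap (?g w) x = ap VAppend (ap (f w) x)"
        by (auto simp: listr_iff intro!: ap_eq appl.intros(6)[OF appl.intros(3)] appl.intros(23))
      have r: "(ap (VFold2 (L []) (?g w)) (L s), ap (VFold2 (L []) (?g w)) (L s)) \<in> listr B"
        by (rule fnD2[OF VFold2_rel[OF nil tg] x(2)])
      show ?case
        unfolding ap_Fold_Cons[OF nil tg x] gx els_append[OF fx r] Cons.IH[OF x(2)] by simp
    qed simp
    moreover obtain s where "l w = L s" "(L s, L s) \<in> listr A" using computed_typed[OF ok l w] by (auto simp: listr_iff)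
    ultimately show ?thesis by simp
  qed
  then show ?thesis using that m by blast
qed

lemma computed_lam_bind:
  assumes ok: "ok p" and Z: "computed p (fn A (listr B)) Z" and f: "computed p (fn A (fn B (listr C))) f"
  obtains Z' where "computed p (fn A (listr C)) Z'"
    "\<And>w x. w \<in> wcar p \<Longrightarrow> (x, x) \<in> A \<Longrightarrow> els (ap (Z' w) x) = (\<Union>y\<in>els (ap (Z w) x). els (ap (ap (f w) x) y))"
proof -
  note okg = ok_gen[OF ok, of A]
  have 1: "computed (gen p A) (listr B) (\<lambda>u. ap (Z (vfst u)) (vsnd u))"
    by (rule computed_app[OF okg computed_weak[OF ok Z] computed_gen_var])
  have 2: "computed (gen p A) (fn B (listr C)) (\<lambda>u. ap (f (vfst u)) (vsnd u))"
    by (rule computed_app[OF okg computed_weak[OF ok f] computed_gen_var])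
  obtain m where m: "computed (gen p A) (listr C) m" "\<And>u. u \<in> wcar (gen p A) \<Longrightarrow> els (m u) =
      (\<Union>x\<in>els (ap (Z (vfst u)) (vsnd u)). els (ap (ap (f (vfst u)) (vsnd u)) x))"
    by (rule computed_bind[OF okg 1 2]) blast
  obtain g where g: "computed p (fn A (listr C)) g" "\<And>w a. w \<in> wcar p \<Longrightarrow> (a, a) \<in> A \<Longrightarrow> ap (g w) a = m (Pr w a)"
    by (rule computed_lam[OF ok m(1)]) blast
  show ?thesis by (rule that[OF g(1)]) (simp add: g(2) m(2))
qed

lemma computed_lam_append:
  assumes ok: "ok p" and Z: "computed p (fn A (listr B)) Z" and f: "computed p (fn A (listr B)) f"
  obtains Z' where "computed p (fn A (listr B)) Z'"
    "\<And>w x. w \<in> wcar p \<Longrightarrow> (x, x) \<in> A \<Longrightarrow> els (ap (Z' w) x) = els (ap (Z w) x) \<union> els (ap (f w) x)"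
proof -
  note okg = ok_gen[OF ok, of A]
  have 1: "computed (gen p A) (listr B) (\<lambda>u. ap (Z (vfst u)) (vsnd u))"
    by (rule computed_app[OF okg computed_weak[OF ok Z] computed_gen_var])
  have 2: "computed (gen p A) (listr B) (\<lambda>u. ap (f (vfst u)) (vsnd u))"
    by (rule computed_app[OF okg computed_weak[OF ok f] computed_gen_var])
  obtain g where g: "computed p (fn A (listr B)) g" "\<And>w a. w \<in> wcar p \<Longrightarrow> (a, a) \<in> A \<Longrightarrow>
      ap (g w) a = ap (ap VAppend (ap (Z w) a)) (ap (f w) a)"
    using computed_lam[OF ok computed_app[OF okg computed_app[OF okg computed_const[OF VAppend_rel] 1] 2]] by auto
  show ?thesis
  proof (rule that[OF g(1)])
    fix w x assume w: "w \<in> wcar p" "(x, x) \<in> A"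
    show "els (ap (g w) x) = els (ap (Z w) x) \<union> els (ap (f w) x)"
      unfolding g(2)[OF w]
      by (rule els_append) (rule fnD2[OF computed_typed[OF ok Z w(1)] w(2)] fnD2[OF computed_typed[OF ok f w(1)] w(2)])+
  qed
qed

lemma computed_pair: "ok p \<Longrightarrow> computed p A f \<Longrightarrow> computed p B g \<Longrightarrow> computed p (prodr A B) (\<lambda>w. Pr (f w) (g w))"
  using computed_app[OF _ computed_app[OF _ computed_const[OF VPr_rel, where A1=A and B1=B]], of p f g] by simp

lemma computed_fst: assumes "ok p" "computed p (prodr A B) f" shows "computed p A (\<lambda>w. vfst (f w))"
proof (rule computed_cong[OF computed_app[OF assms(1) computed_const[OF VFst_rel] assms(2)]])
  fix w assume "w \<in> wcar p"
  from computed_typed[OF assms this] show "ap VFst (f w) = vfst (f w)" by (auto simp: prodr_iff)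
qed

lemma computed_snd: assumes "ok p" "computed p (prodr A B) f" shows "computed p B (\<lambda>w. vsnd (f w))"
proof (rule computed_cong[OF computed_app[OF assms(1) computed_const[OF VSnd_rel] assms(2)]])
  fix w assume "w \<in> wcar p"
  from computed_typed[OF assms this] show "ap VSnd (f w) = vsnd (f w)" by (auto simp: prodr_iff)
qed

text \<open>Each condition of \<open>p\<close> requested by \<open>Z\<close> is traded for the
  finitely many conditions of \<open>q\<close> that ensure it, and the resulting lists are
  concatenated.\<close>

lemma computed_transport:
  assumes le: "wle q \<pi> p" and Z: "computed q (fn A (conds p)) Z"
  obtains Z' where "computed q (fn A (conds q)) Z'"
    "\<And>w x z. w \<in> wcar q \<Longrightarrow> (x, x) \<in> A \<Longrightarrow> (meets q w (ap (Z' w) x)) \<Longrightarrow> z \<in> els (ap (Z w) x) \<Longrightarrow>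
       wcon p (\<pi> w) z"
proof -
  note ok = wle_ok[OF le]
  obtain Y where Y: "computed q (fn (widx p) (conds q)) Y"
    "\<And>w z. w \<in> wcar q \<Longrightarrow> (z, z) \<in> widx p \<Longrightarrow> (meets q w (ap (Y w) z)) \<Longrightarrow> wcon p (\<pi> w) z"
    using le by (auto simp: wle_def)
  obtain f where f: "computed q (fn A (fn (widx p) (conds q))) f"
     "\<And>w a. w \<in> wcar q \<Longrightarrow> (a, a) \<in> A \<Longrightarrow> ap (f w) a = Y w"
    using computed_lam[OF ok computed_weak[OF ok Y(1)]] by auto
  obtain Z' where Z': "computed q (fn A (conds q)) Z'"
    "\<And>w x. w \<in> wcar q \<Longrightarrow> (x, x) \<in> A \<Longrightarrow> els (ap (Z' w) x) = (\<Union>y\<in>els (ap (Z w) x). els (ap (ap (f w) x) y))"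
    by (rule computed_lam_bind[OF ok Z f(1)]) blast
  show ?thesis
  proof (rule that[OF Z'(1)])
    fix w x z assume w: "w \<in> wcar q" "(x, x) \<in> A" and c: "meets q w (ap (Z' w) x)" and z: "z \<in> els (ap (Z w) x)"
    have "(z, z) \<in> widx p" by (rule els_dom[OF fnD2[OF computed_typed[OF ok Z w(1)] w(2)] z])
    then show "wcon p (\<pi> w) z" by (rule Y(2)[OF w(1)]) (use c z Z'(2)[OF w] f(2)[OF w] in auto)
  qed
qed

text \<open>The Diller-Nahm interpretation: \<open>\<phi>\<close> becomes \<open>\<exists>Y. \<forall>k. realizes \<phi> v Y k\<close> with \<open>Y\<close> of type \<open>witness \<phi>\<close> and
  \<open>k\<close> of type \<open>challenge \<phi>\<close>. A witness for \<open>St t\<close> is a finite list of candidates for \<open>t\<close>, and the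
  quantifier \<open>Forall\<close> is uniform in the object quantified over.\<close>

fun witness :: "fm \<Rightarrow> vrel" and challenge :: "fm \<Rightarrow> vrel" where
  "witness Bot = unitr" | "witness (s \<^bold>= t) = unitr" | "witness (St t) = listr (per (tyof t))"
| "witness (\<phi> \<^bold>\<longrightarrow> \<psi>) = prodr (fn (witness \<phi>) (witness \<psi>)) (fn (witness \<phi>) (fn (challenge \<psi>) (listr (challenge \<phi>))))"
| "witness (Forall x \<phi>) = witness \<phi>"
| "challenge Bot = unitr" | "challenge (s \<^bold>= t) = unitr" | "challenge (St t) = unitr"
| "challenge (\<phi> \<^bold>\<longrightarrow> \<psi>) = prodr (witness \<phi>) (challenge \<psi>)"
| "challenge (Forall x \<phi>) = challenge \<phi>"

fun realizes :: "fm \<Rightarrow> (var \<Rightarrow> val) \<Rightarrow> val \<Rightarrow> val \<Rightarrow> bool" where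
  "realizes Bot v Y k \<longleftrightarrow> False"
| "realizes (s \<^bold>= t) v Y k \<longleftrightarrow> (ev v s, ev v t) \<in> per (tyof s)"
| "realizes (St t) v Y k \<longleftrightarrow> (\<exists>c\<in>els Y. (c, ev v t) \<in> per (tyof t))"
| "realizes (\<phi> \<^bold>\<longrightarrow> \<psi>) v Y k \<longleftrightarrow>
    ((\<forall>j\<in>els (ap (ap (vsnd Y) (vfst k)) (vsnd k)). realizes \<phi> v (vfst k) j) \<longrightarrow> realizes \<psi> v (ap (vfst Y) (vfst k)) (vsnd k))"
| "realizes (Forall x \<phi>) v Y k \<longleftrightarrow> (\<forall>d. (d, d) \<in> per (snd x) \<longrightarrow> realizes \<phi> (v(x := d)) Y k)"

text \<open>The realizer \<open>Y\<close> is bound only conditionally: for each challenge,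
  \<open>Z\<close> lists the conditions that a state must meet before the answer of \<open>Y\<close>
  has to be correct.\<close>

definition force :: "world \<Rightarrow> (val \<Rightarrow> var \<Rightarrow> val) \<Rightarrow> fm \<Rightarrow> bool" where
  "force p E \<phi> \<longleftrightarrow> (\<exists>Y Z. computed p (witness \<phi>) Y \<and> computed p (fn (challenge \<phi>) (conds p)) Z \<and>
     (\<forall>w\<in>wcar p. \<forall>x. (x, x) \<in> challenge \<phi> \<longrightarrow> (meets p w (ap (Z w) x)) \<longrightarrow> realizes \<phi> (E w) (Y w) x))"

lemma forceI:
  assumes "computed p (witness \<phi>) Y" "computed p (fn (challenge \<phi>) (conds p)) Z"
    "\<And>w x. w \<in> wcar p \<Longrightarrow> (x, x) \<in> challenge \<phi> \<Longrightarrow> (meets p w (ap (Z w) x)) \<Longrightarrow> realizes \<phi> (E w) (Y w) x"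
  shows "force p E \<phi>"
  unfolding force_def using assms by blast

lemma forceE:
  assumes "force p E \<phi>"
  obtains Y Z where "computed p (witness \<phi>) Y" "computed p (fn (challenge \<phi>) (conds p)) Z"
    "\<And>w x. w \<in> wcar p \<Longrightarrow> (x, x) \<in> challenge \<phi> \<Longrightarrow> (meets p w (ap (Z w) x)) \<Longrightarrow> realizes \<phi> (E w) (Y w) x"
  using assms unfolding force_def by blast

lemma force_mono:
  assumes "force p E \<phi>" and le: "wle q \<pi> p"
  shows "force q (\<lambda>w. E (\<pi> w)) \<phi>"
proof -
  obtain Y Z where Y: "computed p (witness \<phi>) Y" and Z: "computed p (fn (challenge \<phi>) (conds p)) Z"
    and h: "\<And>w x. w \<in> wcar p \<Longrightarrow> (x, x) \<in> challenge \<phi> \<Longrightarrow> (meets p w (ap (Z w) x)) \<Longrightarrow> realizes \<phi> (E w) (Y w) x"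
    by (rule forceE[OF assms(1)]) blast
  obtain Z' where Z': "computed q (fn (challenge \<phi>) (conds q)) Z'"
    "\<And>w x z. w \<in> wcar q \<Longrightarrow> (x, x) \<in> challenge \<phi> \<Longrightarrow> (meets q w (ap (Z' w) x)) \<Longrightarrow> z \<in> els (ap (Z (\<pi> w)) x) \<Longrightarrow>
       wcon p (\<pi> w) z"
    by (rule computed_transport[OF le computed_wle[OF le Z]]) blast
  show ?thesis
    by (rule forceI[OF computed_wle[OF le Y] Z'(1)]) (use h Z'(2) wle_car[OF le] in blast)
qed

section \<open>Forcing\<close>

lemma computed_post:
  assumes ok: "ok p" and g: "computed p (fn A C) g" and h: "(h, h) \<in> fn C D"
  obtains g' where "computed p (fn A D) g'" "\<And>w a. w \<in> wcar p \<Longrightarrow> (a, a) \<in> A \<Longrightarrow> ap (g' w) a = ap h (ap (g w) a)"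
proof -
  note okg = ok_gen[OF ok, of A]
  show ?thesis
    by (rule computed_lam[OF ok computed_app[OF okg computed_const[OF h] computed_app[OF okg computed_weak[OF ok g] computed_gen_var]]])
      (rule that, auto)
qed

lemma computed_post2:
  assumes ok: "ok p" and g: "computed p (fn A (fn B C)) g" and h: "(h, h) \<in> fn C D"
  obtains g' where "computed p (fn A (fn B D)) g'"
    "\<And>w a b. w \<in> wcar p \<Longrightarrow> (a, a) \<in> A \<Longrightarrow> (b, b) \<in> B \<Longrightarrow> ap (ap (g' w) a) b = ap h (ap (ap (g w) a) b)"
proof -
  note okg = ok_gen[OF ok, of A]
  obtain g1 where g1: "computed (gen p A) (fn B D) g1"
    "\<And>w a. w \<in> wcar (gen p A) \<Longrightarrow> (a, a) \<in> B \<Longrightarrow> ap (g1 w) a = ap h (ap (ap (g (vfst w)) (vsnd w)) a)"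
    by (rule computed_post[OF okg computed_app[OF okg computed_weak[OF ok g] computed_gen_var] h]) blast
  obtain g' where "computed p (fn A (fn B D)) g'" "\<And>w a. w \<in> wcar p \<Longrightarrow> (a, a) \<in> A \<Longrightarrow> ap (g' w) a = g1 (Pr w a)"
    by (rule computed_lam[OF ok g1(1)]) blast
  then show ?thesis using that g1(2) by simp
qed

lemma computed_uncurry:
  assumes ok: "ok p" and g: "computed p (fn A (fn B C)) g"
  obtains g' where "computed p (fn (prodr A B) C) g'"
    "\<And>w a b. w \<in> wcar p \<Longrightarrow> (a, a) \<in> A \<Longrightarrow> (b, b) \<in> B \<Longrightarrow> ap (g' w) (Pr a b) = ap (ap (g w) a) b"
proof -
  note okg = ok_gen[OF ok, of "prodr A B"]
  show ?thesis
    by (rule computed_lam[OF ok computed_app[OF okg computed_app[OF okg computed_weak[OF ok g] computed_fst[OF okg computed_gen_var]] computed_snd[OF okg computed_gen_var]]])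
      (rule that, auto)
qed

lemma computed_drop:
  assumes ok: "ok p" and g: "computed p B g"
  obtains g' where "computed p (fn A B) g'" "\<And>w a. w \<in> wcar p \<Longrightarrow> (a, a) \<in> A \<Longrightarrow> ap (g' w) a = g w"
  by (rule computed_lam[OF ok computed_weak[OF ok g]]) (rule that, auto)

lemma wle_trans: assumes rq: "wle r \<rho> q" and qp: "wle q \<pi> p" shows "wle r (\<lambda>w. \<pi> (\<rho> w)) p"
proof -
  obtain Y where Y: "computed q (fn (widx p) (conds q)) Y"
    "\<And>w z. w \<in> wcar q \<Longrightarrow> (z, z) \<in> widx p \<Longrightarrow> (meets q w (ap (Y w) z)) \<Longrightarrow> wcon p (\<pi> w) z"
    using qp by (auto simp: wle_def)
  obtain Z where Z: "computed r (fn (widx p) (conds r)) Z"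
    "\<And>w x z. w \<in> wcar r \<Longrightarrow> (x, x) \<in> widx p \<Longrightarrow> (meets r w (ap (Z w) x)) \<Longrightarrow> z \<in> els (ap (Y (\<rho> w)) x) \<Longrightarrow>
       wcon q (\<rho> w) z"
    by (rule computed_transport[OF rq computed_wle[OF rq Y(1)]]) blast
  have "computed q (wrel p) (\<lambda>w. wpt p (\<pi> w))" using qp by (simp add: wle_def)
  then have "computed r (wrel p) (\<lambda>w. wpt p (\<pi> (\<rho> w)))" by (rule computed_wle[OF rq])
  then show ?thesis unfolding wle_def
    using wle_ok[OF rq] wle_car[OF rq] wle_car[OF qp] Z Y(2) by (intro conjI ballI exI[of _ Z]) blast+
qed

text \<open>Large properties are closed under finite intersection and weakening, like a filter, but
  may include falsity; a world where falsity is large is inconsistent.\<close>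

definition large :: "world \<Rightarrow> (val \<Rightarrow> bool) \<Rightarrow> bool" where
  "large p Q \<longleftrightarrow> (\<exists>Z. computed p (conds p) Z \<and> (\<forall>w\<in>wcar p. (meets p w (Z w)) \<longrightarrow> Q w))"

lemma largeI: "computed p (conds p) Z \<Longrightarrow> (\<And>w. w \<in> wcar p \<Longrightarrow> (meets p w (Z w)) \<Longrightarrow> Q w) \<Longrightarrow> large p Q"
  unfolding large_def by blast

lemma largeE:
  assumes "large p Q"
  obtains Z where "computed p (conds p) Z" "\<And>w. w \<in> wcar p \<Longrightarrow> (meets p w (Z w)) \<Longrightarrow> Q w"
  using assms unfolding large_def by blast

lemma large_mono: "large p Q \<Longrightarrow> (\<And>w. w \<in> wcar p \<Longrightarrow> Q w \<Longrightarrow> Q' w) \<Longrightarrow> large p Q'"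
  unfolding large_def by blast

lemma large_all: "(\<And>w. w \<in> wcar p \<Longrightarrow> Q w) \<Longrightarrow> large p Q"
  by (rule largeI[OF computed_const[of "L []"]]) auto

lemma large_conj: assumes ok: "ok p" and "large p Q" "large p R" shows "large p (\<lambda>w. Q w \<and> R w)"
proof -
  obtain Z1 where Z1: "computed p (conds p) Z1" "\<And>w. w \<in> wcar p \<Longrightarrow> (meets p w (Z1 w)) \<Longrightarrow> Q w"
    using assms(2) by (rule largeE) blast
  obtain Z2 where Z2: "computed p (conds p) Z2" "\<And>w. w \<in> wcar p \<Longrightarrow> (meets p w (Z2 w)) \<Longrightarrow> R w"
    using assms(3) by (rule largeE) blast
  show ?thesis
  proof (rule largeI[OF computed_app[OF ok computed_app[OF ok computed_const[OF VAppend_rel] Z1(1)] Z2(1)]])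
    fix w assume w: "w \<in> wcar p" and "meets p w (ap (ap VAppend (Z1 w)) (Z2 w))"
    then show "Q w \<and> R w"
      using els_append[OF computed_typed[OF ok Z1(1) w] computed_typed[OF ok Z2(1) w]] Z1(2) Z2(2) by simp
  qed
qed

lemma large_mp: "ok p \<Longrightarrow> large p Q \<Longrightarrow> large p R \<Longrightarrow> (\<And>w. w \<in> wcar p \<Longrightarrow> Q w \<Longrightarrow> R w \<Longrightarrow> T w) \<Longrightarrow> large p T"
  by (rule large_mono[OF large_conj[of p Q R]]) auto

lemma large_fn:
  assumes ok: "ok p" and "computed p (fn unitr (conds p)) Z"
    "\<And>w. w \<in> wcar p \<Longrightarrow> (meets p w (ap (Z w) (N 0))) \<Longrightarrow> Q w"
  shows "large p Q"
proof (rule largeI[OF computed_app[OF ok assms(2) computed_const]])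
  show "(N 0, N 0) \<in> unitr" by simp
qed (rule assms(3))

lemma large_wle: assumes le: "wle q \<pi> p" and "large p Q" shows "large q (\<lambda>w. Q (\<pi> w))"
proof -
  note ok = wle_ok[OF le]
  obtain Z where Z: "computed p (conds p) Z" "\<And>w. w \<in> wcar p \<Longrightarrow> (meets p w (Z w)) \<Longrightarrow> Q w"
    using assms(2) by (rule largeE) blast
  obtain Y where Y: "computed q (fn unitr (conds p)) Y"
    "\<And>w a. w \<in> wcar q \<Longrightarrow> (a, a) \<in> unitr \<Longrightarrow> ap (Y w) a = Z (\<pi> w)"
    by (rule computed_drop[OF ok computed_wle[OF le Z(1)]]) blast
  obtain Z' where Z': "computed q (fn unitr (conds q)) Z'"
    "\<And>w x z. w \<in> wcar q \<Longrightarrow> (x, x) \<in> unitr \<Longrightarrow> (meets q w (ap (Z' w) x)) \<Longrightarrow> z \<in> els (ap (Y w) x) \<Longrightarrow>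
       wcon p (\<pi> w) z"
    by (rule computed_transport[OF le Y(1)]) blast
  show ?thesis
    by (rule large_fn[OF ok Z'(1)]) (use Z(2) Z'(2) Y(2) wle_car[OF le] in simp)
qed

text \<open>The conditions used in the extension are sorted by origin: \<open>Z1\<close> lists those
  of \<open>p\<close>, \<open>Z2\<close> the newly imposed ones. Both see the new component only
  through \<open>k\<close>; later \<open>Z2\<close> becomes a list of candidate witnesses.\<close>

lemma large_ext:
  assumes ok: "ok p" and ty: "typed_by p C A k" and "large (ext p C A k S Q) R"
  obtains Z1 Z2 where "computed p (fn A (conds p)) Z1" "computed p (fn A (listr S)) Z2"
    "\<And>w a. w \<in> wcar p \<Longrightarrow> a \<in> C w \<Longrightarrow> (meets p w (ap (Z1 w) (k a))) \<Longrightarrow>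
      (\<forall>x\<in>els (ap (Z2 w) (k a)). Q w a x) \<Longrightarrow> R (Pr w a)"
proof -
  let ?q = "ext p C A k S Q"
  obtain Z where Z: "computed ?q (conds ?q) Z" "\<And>w. w \<in> wcar ?q \<Longrightarrow> (meets ?q w (Z w)) \<Longrightarrow> R w"
    using assms(3) by (rule largeE) blast
  obtain g where g: "computed p (fn A (listr (sumr (widx p) S))) g" "\<And>w a. w \<in> wcar p \<Longrightarrow> a \<in> C w \<Longrightarrow> ap (g w) (k a) = Z (Pr w a)"
    by (rule computed_curry[OF ok ty Z(1)]) simp
  obtain Z1 where Z1: "computed p (fn A (conds p)) Z1"
    "\<And>w a. w \<in> wcar p \<Longrightarrow> (a, a) \<in> A \<Longrightarrow> ap (Z1 w) a = ap VLefts (ap (g w) a)"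
    by (rule computed_post[OF ok g(1) VLefts_rel]) blast
  obtain Z2 where Z2: "computed p (fn A (listr S)) Z2"
    "\<And>w a. w \<in> wcar p \<Longrightarrow> (a, a) \<in> A \<Longrightarrow> ap (Z2 w) a = ap VRights (ap (g w) a)"
    by (rule computed_post[OF ok g(1) VRights_rel]) blast
  show ?thesis
  proof (rule that[OF Z1(1) Z2(1)])
    fix w a assume w: "w \<in> wcar p" "a \<in> C w" and h: "meets p w (ap (Z1 w) (k a))" "\<forall>x\<in>els (ap (Z2 w) (k a)). Q w a x"
    have ka: "(k a, k a) \<in> A" using ty w by (auto simp: typed_by_def)
    have t: "(ap (g w) (k a), ap (g w) (k a)) \<in> listr (sumr (widx p) S)" by (rule fnD2[OF computed_typed[OF ok g(1) w(1)] ka])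
    have "wcon ?q (Pr w a) z" if z: "z \<in> els (ap (g w) (k a))" for z
    proof -
      have "(z, z) \<in> sumr (widx p) S" by (rule els_dom[OF t z])
      then consider x where "z = VInl x" | x where "z = VInr x" by (auto simp: sumr_def)
      then show ?thesis
        using h z Z1(2)[OF w(1) ka] Z2(2)[OF w(1) ka] els_lefts[OF t] els_rights[OF t] by cases auto
    qed
    then show "R (Pr w a)" using Z(2)[of "Pr w a"] w g(2)[OF w] by simp
  qed
qed

text \<open>With the new component hidden, the two lists are the same for every \<open>a\<close>.
  This uniformity lets one finite list defeat all nonstandard candidates at once.\<close>

lemma large_ext0:
  assumes ok: "ok p" and "large (ext p C unitr (\<lambda>_. N 0) S Q) R"
  obtains Z1 Z2 where "computed p (conds p) Z1" "computed p (listr S) Z2"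
    "\<And>w a. w \<in> wcar p \<Longrightarrow> a \<in> C w \<Longrightarrow> (meets p w (Z1 w)) \<Longrightarrow>
      (\<forall>x\<in>els (Z2 w). Q w a x) \<Longrightarrow> R (Pr w a)"
proof -
  have ty: "typed_by p C unitr (\<lambda>_. N 0)" by (simp add: typed_by_def)
  have n: "(N 0, N 0) \<in> unitr" by simp
  obtain Z1 Z2 where Z: "computed p (fn unitr (conds p)) Z1" "computed p (fn unitr (listr S)) Z2"
    "\<And>w a. w \<in> wcar p \<Longrightarrow> a \<in> C w \<Longrightarrow> (meets p w (ap (Z1 w) (N 0))) \<Longrightarrow>
      (\<forall>x\<in>els (ap (Z2 w) (N 0)). Q w a x) \<Longrightarrow> R (Pr w a)"
    by (rule large_ext[OF ok ty assms(2)]) blast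
  show ?thesis
    by (rule that[OF computed_app[OF ok Z(1) computed_const[OF n]] computed_app[OF ok Z(2) computed_const[OF n]]]) (rule Z(3))
qed

lemma typed_unit: "typed_by p C unitr (\<lambda>_. N 0)" by (simp add: typed_by_def)

lemma ext_constraints:
  assumes le: "wle r \<rho> (ext p C A k S Q)" and l: "computed r (listr S) l"
  shows "large r (\<lambda>w. \<forall>x\<in>els (l w). Q (vfst (\<rho> w)) (vsnd (\<rho> w)) x)"
proof -
  let ?q = "ext p C A k S Q"
  note ok = wle_ok[OF le]
  obtain c where c: "(c, c) \<in> fn S (conds ?q)" "\<And>a. ap c a = L [VInr a]"
    by (rule singleton_code[OF appl.intros(22), where A = S and B = "widx ?q"]) auto
  obtain m where m: "computed r (conds ?q) m" "\<And>w. w \<in> wcar r \<Longrightarrow> els (m w) = (\<Union>x\<in>els (l w). els (ap c x))"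
    by (rule computed_bind[OF ok l computed_const[OF c(1)]]) blast
  obtain Y where Y: "computed r (fn unitr (conds ?q)) Y" "\<And>w a. w \<in> wcar r \<Longrightarrow> (a, a) \<in> unitr \<Longrightarrow> ap (Y w) a = m w"
    by (rule computed_drop[OF ok m(1)]) blast
  obtain Z' where Z': "computed r (fn unitr (conds r)) Z'"
    "\<And>w x z. w \<in> wcar r \<Longrightarrow> (x, x) \<in> unitr \<Longrightarrow> (meets r w (ap (Z' w) x)) \<Longrightarrow> z \<in> els (ap (Y w) x) \<Longrightarrow>
       wcon ?q (\<rho> w) z"
    by (rule computed_transport[OF le Y(1)]) blast
  show ?thesis
  proof (rule large_fn[OF ok Z'(1)], intro ballI)
    fix w x assume w: "w \<in> wcar r" and h: "meets r w (ap (Z' w) (N 0))" and x: "x \<in> els (l w)"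
    have "VInr x \<in> els (ap (Y w) (N 0))" using x m(2)[OF w] Y(2)[OF w] c(2) by auto
    then have "wcon ?q (\<rho> w) (VInr x)" by (intro Z'(2)[OF w _ h]) auto
    then show "Q (vfst (\<rho> w)) (vsnd (\<rho> w)) x" by simp
  qed
qed

lemma ext_constraint:
  assumes le: "wle r \<rho> (ext p C A k S Q)" and x: "computed r S x"
  shows "large r (\<lambda>w. Q (vfst (\<rho> w)) (vsnd (\<rho> w)) (x w))"
proof -
  have "(L [], L []) \<in> listr S" by simp
  then have "computed r (listr S) (\<lambda>w. ap (ap VCons (x w)) (L []))"
    by (rule computed_app[OF wle_ok[OF le] computed_app[OF wle_ok[OF le] computed_const[OF VCons_rel] x] computed_const])
  from ext_constraints[OF le this] show ?thesis by simp
qed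

section \<open>Clauses of forcing for the formula constructors\<close>

lemma force_unitE:
  assumes ok: "ok p" and "force p E \<phi>" and S: "challenge \<phi> = unitr"
  obtains Y where "computed p (witness \<phi>) Y" "large p (\<lambda>w. realizes \<phi> (E w) (Y w) (N 0))"
proof -
  obtain Y Z where Y: "computed p (witness \<phi>) Y" and Z: "computed p (fn (challenge \<phi>) (conds p)) Z"
    and h: "\<And>w x. w \<in> wcar p \<Longrightarrow> (x, x) \<in> challenge \<phi> \<Longrightarrow> (meets p w (ap (Z w) x)) \<Longrightarrow> realizes \<phi> (E w) (Y w) x"
    by (rule forceE[OF assms(2)]) blast
  have "large p (\<lambda>w. realizes \<phi> (E w) (Y w) (N 0))" by (rule large_fn[OF ok Z[unfolded S]]) (use h S in auto)
  then show ?thesis using that Y by blast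
qed

lemma force_unitI:
  assumes ok: "ok p" and S: "challenge \<phi> = unitr" and Y: "computed p (witness \<phi>) Y" and l: "large p (\<lambda>w. realizes \<phi> (E w) (Y w) (N 0))"
  shows "force p E \<phi>"
proof -
  obtain Z where Z: "computed p (conds p) Z" "\<And>w. w \<in> wcar p \<Longrightarrow> (meets p w (Z w)) \<Longrightarrow> realizes \<phi> (E w) (Y w) (N 0)"
    by (rule largeE[OF l]) blast
  obtain Z' where "computed p (fn unitr (conds p)) Z'" "\<And>w a. w \<in> wcar p \<Longrightarrow> (a, a) \<in> unitr \<Longrightarrow> ap (Z' w) a = Z w"
    by (rule computed_drop[OF ok Z(1)]) blast
  then show ?thesis using S Z(2) by (intro forceI[OF Y, of Z']) auto
qed

lemma computed_unit: "computed p unitr (\<lambda>w. N 0)" by (rule computed_const) simp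

lemma force_Bot: assumes "ok p" shows "force p E Bot \<longleftrightarrow> large p (\<lambda>_. False)"
proof
  assume "force p E Bot" then show "large p (\<lambda>_. False)" using force_unitE[OF assms, of E Bot] by auto
qed (rule force_unitI[OF assms, of _ "\<lambda>w. N 0"], auto intro: computed_unit)

lemma force_Eq: assumes "ok p" shows "force p E (s \<^bold>= t) \<longleftrightarrow> large p (\<lambda>w. (ev (E w) s, ev (E w) t) \<in> per (tyof s))"
proof
  assume "force p E (s \<^bold>= t)"
  then show "large p (\<lambda>w. (ev (E w) s, ev (E w) t) \<in> per (tyof s))" using force_unitE[OF assms, of E "s \<^bold>= t"] by auto
qed (rule force_unitI[OF assms, of _ "\<lambda>w. N 0"], auto intro: computed_unit)

lemma force_St: assumes "ok p" shows "force p E (St t) \<longleftrightarrow>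
   (\<exists>l. computed p (listr (per (tyof t))) l \<and> large p (\<lambda>w. \<exists>c\<in>els (l w). (c, ev (E w) t) \<in> per (tyof t)))"
proof
  assume "force p E (St t)"
  from force_unitE[OF assms this] obtain Y where "computed p (witness (St t)) Y" "large p (\<lambda>w. realizes (St t) (E w) (Y w) (N 0))" by auto
  then show "\<exists>l. computed p (listr (per (tyof t))) l \<and> large p (\<lambda>w. \<exists>c\<in>els (l w). (c, ev (E w) t) \<in> per (tyof t))" by auto
next
  assume "\<exists>l. computed p (listr (per (tyof t))) l \<and> large p (\<lambda>w. \<exists>c\<in>els (l w). (c, ev (E w) t) \<in> per (tyof t))"
  then obtain l where l: "computed p (listr (per (tyof t))) l" "large p (\<lambda>w. \<exists>c\<in>els (l w). (c, ev (E w) t) \<in> per (tyof t))" by blast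
  show "force p E (St t)" by (rule force_unitI[OF assms]) (use l in auto)
qed

lemma force_ImpD:
  assumes "force p E (\<phi> \<^bold>\<longrightarrow> \<psi>)" and le: "wle q \<pi> p" and "force q (\<lambda>w. E (\<pi> w)) \<phi>"
  shows "force q (\<lambda>w. E (\<pi> w)) \<psi>"
proof -
  note ok = wle_ok[OF le]
  obtain Y Z where Y: "computed q (witness (\<phi> \<^bold>\<longrightarrow> \<psi>)) Y" and Z: "computed q (fn (challenge (\<phi> \<^bold>\<longrightarrow> \<psi>)) (conds q)) Z"
    and h: "\<And>w x. w \<in> wcar q \<Longrightarrow> (x, x) \<in> challenge (\<phi> \<^bold>\<longrightarrow> \<psi>) \<Longrightarrow> (meets q w (ap (Z w) x)) \<Longrightarrow>
       realizes (\<phi> \<^bold>\<longrightarrow> \<psi>) (E (\<pi> w)) (Y w) x"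
    by (rule forceE[OF force_mono[OF assms(1) le]]) blast
  obtain Y1 Z1 where Y1: "computed q (witness \<phi>) Y1" and Z1: "computed q (fn (challenge \<phi>) (conds q)) Z1"
    and h1: "\<And>w x. w \<in> wcar q \<Longrightarrow> (x, x) \<in> challenge \<phi> \<Longrightarrow> (meets q w (ap (Z1 w) x)) \<Longrightarrow>
       realizes \<phi> (E (\<pi> w)) (Y1 w) x"
    by (rule forceE[OF assms(3)]) blast
  have F: "computed q (fn (witness \<phi>) (witness \<psi>)) (\<lambda>w. vfst (Y w))" and G: "computed q (fn (witness \<phi>) (fn (challenge \<psi>) (listr (challenge \<phi>)))) (\<lambda>w. vsnd (Y w))"
    using computed_fst[OF ok Y[unfolded witness.simps]] computed_snd[OF ok Y[unfolded witness.simps]] by auto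
  note FY = computed_app[OF ok F Y1] and GY = computed_app[OF ok G Y1]
  \<comment> \<open>At a challenge the conditions come from two sources: \<open>Z2\<close> collects
    those validating the implication at this realizer and challenge, \<open>Z3\<close> those
    validating \<open>\<phi>\<close> at every challenge passed back.\<close>
  obtain Z2 where Z2: "computed q (fn (challenge \<psi>) (conds q)) Z2"
    "\<And>w x. w \<in> wcar q \<Longrightarrow> (x, x) \<in> challenge \<psi> \<Longrightarrow> ap (Z2 w) x = ap (Z w) (Pr (Y1 w) x)"
  proof -
    note okg = ok_gen[OF ok, of "challenge \<psi>"]
    have "computed (gen q (challenge \<psi>)) (conds q) (\<lambda>u. ap (Z (vfst u)) (Pr (Y1 (vfst u)) (vsnd u)))"
      by (rule computed_app[OF okg computed_weak[OF ok Z[unfolded challenge.simps]] computed_pair[OF okg computed_weak[OF ok Y1] computed_gen_var]])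
    from computed_lam[OF ok this] that show ?thesis by auto
  qed
  obtain f where f: "computed q (fn (challenge \<psi>) (fn (challenge \<phi>) (conds q))) f" "\<And>w a. w \<in> wcar q \<Longrightarrow> (a, a) \<in> challenge \<psi> \<Longrightarrow> ap (f w) a = Z1 w"
    by (rule computed_drop[OF ok Z1]) blast
  obtain Z3 where Z3: "computed q (fn (challenge \<psi>) (conds q)) Z3"
    "\<And>w x. w \<in> wcar q \<Longrightarrow> (x, x) \<in> challenge \<psi> \<Longrightarrow>
      els (ap (Z3 w) x) = (\<Union>y\<in>els (ap (ap (vsnd (Y w)) (Y1 w)) x). els (ap (ap (f w) x) y))"
    by (rule computed_lam_bind[OF ok GY f(1)]) blast
  obtain Z' where Z': "computed q (fn (challenge \<psi>) (conds q)) Z'"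
    "\<And>w x. w \<in> wcar q \<Longrightarrow> (x, x) \<in> challenge \<psi> \<Longrightarrow> els (ap (Z' w) x) = els (ap (Z2 w) x) \<union> els (ap (Z3 w) x)"
    by (rule computed_lam_append[OF ok Z2(1) Z3(1)]) blast
  show ?thesis
  proof (rule forceI[OF FY Z'(1)])
    fix w x assume w: "w \<in> wcar q" and x: "(x, x) \<in> challenge \<psi>" and c: "meets q w (ap (Z' w) x)"
    have y: "(Y1 w, Y1 w) \<in> witness \<phi>" by (rule computed_typed[OF ok Y1 w])
    have "(Pr (Y1 w) x, Pr (Y1 w) x) \<in> challenge (\<phi> \<^bold>\<longrightarrow> \<psi>)" using y x by simp
    moreover have "meets q w (ap (Z w) (Pr (Y1 w) x))"
      using c Z'(2)[OF w x] Z2(2)[OF w x] by auto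
    ultimately have "realizes (\<phi> \<^bold>\<longrightarrow> \<psi>) (E (\<pi> w)) (Y w) (Pr (Y1 w) x)" by (rule h[OF w])
    moreover have "realizes \<phi> (E (\<pi> w)) (Y1 w) j" if j: "j \<in> els (ap (ap (vsnd (Y w)) (Y1 w)) x)" for j
    proof (rule h1[OF w])
      show "(j, j) \<in> challenge \<phi>" by (rule els_dom[OF fnD2[OF computed_typed[OF ok GY w] x] j])
      show "meets q w (ap (Z1 w) j)"
        using c j unfolding Z'(2)[OF w x] Z3(2)[OF w x] f(2)[OF w x] by blast
    qed
    ultimately show "realizes \<psi> (E (\<pi> w)) (ap (vfst (Y w)) (Y1 w)) x" by simp
  qed
qed

text \<open>The extension by a generic realizer of \<open>\<phi>\<close> is the weakest world below \<open>p\<close> forcing \<open>\<phi>\<close>, so it alone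
  yields a realizer of the implication.\<close>

lemma force_ImpI:
  assumes ok: "ok p" and h: "\<And>q \<pi>. wle q \<pi> p \<Longrightarrow> force q (\<lambda>w. E (\<pi> w)) \<phi> \<Longrightarrow> force q (\<lambda>w. E (\<pi> w)) \<psi>"
  shows "force p E (\<phi> \<^bold>\<longrightarrow> \<psi>)"
proof -
  let ?C = "\<lambda>_::val. {a. (a, a) \<in> witness \<phi>}"
  let ?u = "ext p ?C (witness \<phi>) (\<lambda>a. a) (challenge \<phi>) (\<lambda>w Y x. realizes \<phi> (E w) Y x)"
  have ty: "typed_by p ?C (witness \<phi>) (\<lambda>a. a)" by (simp add: typed_by_def)
  have "force ?u (\<lambda>w. E (vfst w)) \<phi>"
  proof -
    obtain c where c: "(c, c) \<in> fn (challenge \<phi>) (conds ?u)" "\<And>a. ap c a = L [VInr a]"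
      by (rule singleton_code[OF appl.intros(22), where A = "challenge \<phi>" and B = "widx ?u"]) auto
    show ?thesis
      by (rule forceI[OF computed_var computed_const[OF c(1)]]) (auto simp: c(2))
  qed
  from h[OF wle_ext[OF ok ty] this]
  obtain Y Z where Y: "computed ?u (witness \<psi>) Y" and Z: "computed ?u (fn (challenge \<psi>) (conds ?u)) Z"
    and hh: "\<And>w x. w \<in> wcar ?u \<Longrightarrow> (x, x) \<in> challenge \<psi> \<Longrightarrow> (meets ?u w (ap (Z w) x)) \<Longrightarrow> realizes \<psi> (E (vfst w)) (Y w) x"
    by (rule forceE) blast
  obtain F where F: "computed p (fn (witness \<phi>) (witness \<psi>)) F" "\<And>w a. w \<in> wcar p \<Longrightarrow> (a, a) \<in> witness \<phi> \<Longrightarrow> ap (F w) a = Y (Pr w a)"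
    using computed_curry[OF ok ty Y] by auto
  obtain g where g: "computed p (fn (witness \<phi>) (fn (challenge \<psi>) (listr (sumr (widx p) (challenge \<phi>))))) g"
    "\<And>w a. w \<in> wcar p \<Longrightarrow> (a, a) \<in> witness \<phi> \<Longrightarrow> ap (g w) a = Z (Pr w a)"
    using computed_curry[OF ok ty Z] by auto
  obtain G where G: "computed p (fn (witness \<phi>) (fn (challenge \<psi>) (listr (challenge \<phi>)))) G"
    "\<And>w a b. w \<in> wcar p \<Longrightarrow> (a, a) \<in> witness \<phi> \<Longrightarrow> (b, b) \<in> challenge \<psi> \<Longrightarrow> ap (ap (G w) a) b = ap VRights (ap (ap (g w) a) b)"
    by (rule computed_post2[OF ok g(1) VRights_rel]) blast
  obtain H where H: "computed p (fn (witness \<phi>) (fn (challenge \<psi>) (conds p))) H"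
    "\<And>w a b. w \<in> wcar p \<Longrightarrow> (a, a) \<in> witness \<phi> \<Longrightarrow> (b, b) \<in> challenge \<psi> \<Longrightarrow> ap (ap (H w) a) b = ap VLefts (ap (ap (g w) a) b)"
    by (rule computed_post2[OF ok g(1) VLefts_rel]) blast
  obtain K where K: "computed p (fn (prodr (witness \<phi>) (challenge \<psi>)) (conds p)) K"
    "\<And>w a b. w \<in> wcar p \<Longrightarrow> (a, a) \<in> witness \<phi> \<Longrightarrow> (b, b) \<in> challenge \<psi> \<Longrightarrow> ap (K w) (Pr a b) = ap (ap (H w) a) b"
    by (rule computed_uncurry[OF ok H(1)]) blast
  show ?thesis
  proof (rule forceI)
    show "computed p (witness (\<phi> \<^bold>\<longrightarrow> \<psi>)) (\<lambda>w. Pr (F w) (G w))" using computed_pair[OF ok F(1) G(1)] by simp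
    show "computed p (fn (challenge (\<phi> \<^bold>\<longrightarrow> \<psi>)) (conds p)) K" using K(1) by simp
    fix w x assume w: "w \<in> wcar p" and "(x, x) \<in> challenge (\<phi> \<^bold>\<longrightarrow> \<psi>)" and c: "meets p w (ap (K w) x)"
    then obtain a b where x: "x = Pr a b" and a: "(a, a) \<in> witness \<phi>" and b: "(b, b) \<in> challenge \<psi>" by (auto simp: prodr_iff)
    have t: "(ap (ap (g w) a) b, ap (ap (g w) a) b) \<in> listr (sumr (widx p) (challenge \<phi>))"
      by (rule fnD2[OF fnD2[OF computed_typed[OF ok g(1) w] a] b])
    have "realizes \<psi> (E w) (ap (F w) a) b" if s: "\<forall>j\<in>els (ap (ap (G w) a) b). realizes \<phi> (E w) a j"
    proof -
      have "wcon ?u (Pr w a) z" if z: "z \<in> els (ap (Z (Pr w a)) b)" for z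
      proof -
        have z': "z \<in> els (ap (ap (g w) a) b)" using z g(2)[OF w a] by simp
        have "(z, z) \<in> sumr (widx p) (challenge \<phi>)" by (rule els_dom[OF t z'])
        then consider y where "z = VInl y" | y where "z = VInr y" by (auto simp: sumr_def)
        then show ?thesis
        proof cases
          case 1 then show ?thesis using c z' unfolding x K(2)[OF w a b] H(2)[OF w a b] els_lefts[OF t] by simp
        next
          case 2 then show ?thesis using s z' unfolding G(2)[OF w a b] els_rights[OF t] by simp
        qed
      qed
      then show ?thesis using hh[of "Pr w a" b] w a b F(2)[OF w a] by simp
    qed
    then show "realizes (\<phi> \<^bold>\<longrightarrow> \<psi>) (E w) (Pr (F w) (G w)) x" by (simp add: x)
  qed
qed

fun zval :: "ty \<Rightarrow> val" where
  "zval NN = N 0" | "zval (\<sigma> \<rightarrow> \<tau>) = VK1 (zval \<tau>)" | "zval (\<sigma>\<^sup>\<star>) = L []"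

text \<open>No program for the instance \<open>c\<close> is required, any typed function of the
  state will do; hence the unrestricted quantifier ranges over nonstandard objects.\<close>

lemma force_ForallD:
  assumes "force p E (Forall x \<phi>)" and le: "wle q \<pi> p" and c: "\<And>w. w \<in> wcar q \<Longrightarrow> (c w, c w) \<in> per (snd x)"
  shows "force q (\<lambda>w. (E (\<pi> w))(x := c w)) \<phi>"
proof -
  obtain Y Z where Y: "computed q (witness (Forall x \<phi>)) Y" and Z: "computed q (fn (challenge (Forall x \<phi>)) (conds q)) Z"
    and h: "\<And>w k. w \<in> wcar q \<Longrightarrow> (k, k) \<in> challenge (Forall x \<phi>) \<Longrightarrow> (meets q w (ap (Z w) k)) \<Longrightarrow>
       realizes (Forall x \<phi>) (E (\<pi> w)) (Y w) k"
    by (rule forceE[OF force_mono[OF assms(1) le]]) blast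
  show ?thesis by (rule forceI[of _ _ Y Z]) (use Y Z h c in auto)
qed

text \<open>One hidden generic element suffices: its contribution to the data is constant, so the
  realizer found in that extension cannot depend on it and is uniform in the quantified
  object.\<close>

lemma force_ForallI:
  assumes ok: "ok p" and h: "\<And>q \<pi> c. wle q \<pi> p \<Longrightarrow> (\<And>w. w \<in> wcar q \<Longrightarrow> (c w, c w) \<in> per (snd x)) \<Longrightarrow>
     force q (\<lambda>w. (E (\<pi> w))(x := c w)) \<phi>"
  shows "force p E (Forall x \<phi>)"
proof -
  let ?C = "\<lambda>_::val. {a. (a, a) \<in> per (snd x)}"
  let ?u = "ext p ?C unitr (\<lambda>_. N 0) {} (\<lambda>_ _ _. True)"
  have "force ?u (\<lambda>w. (E (vfst w))(x := vsnd w)) \<phi>" by (rule h[OF wle_ext[OF ok typed_unit]]) auto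
  then obtain Y Z where Y: "computed ?u (witness \<phi>) Y" and Z: "computed ?u (fn (challenge \<phi>) (conds ?u)) Z"
    and hh: "\<And>w k. w \<in> wcar ?u \<Longrightarrow> (k, k) \<in> challenge \<phi> \<Longrightarrow> (meets ?u w (ap (Z w) k)) \<Longrightarrow>
       realizes \<phi> ((E (vfst w))(x := vsnd w)) (Y w) k"
    by (rule forceE) blast
  have n: "(N 0, N 0) \<in> unitr" by simp
  obtain F where F: "computed p (fn unitr (witness \<phi>)) F" "\<And>w a. w \<in> wcar p \<Longrightarrow> (a, a) \<in> per (snd x) \<Longrightarrow> ap (F w) (N 0) = Y (Pr w a)"
    using computed_curry[OF ok typed_unit Y] by auto
  obtain g where g: "computed p (fn unitr (fn (challenge \<phi>) (listr (sumr (widx p) {})))) g"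
    "\<And>w a. w \<in> wcar p \<Longrightarrow> (a, a) \<in> per (snd x) \<Longrightarrow> ap (g w) (N 0) = Z (Pr w a)"
    using computed_curry[OF ok typed_unit Z] by auto
  note g0 = computed_app[OF ok g(1) computed_const[OF n]]
  obtain Z' where Z': "computed p (fn (challenge \<phi>) (conds p)) Z'"
    "\<And>w k. w \<in> wcar p \<Longrightarrow> (k, k) \<in> challenge \<phi> \<Longrightarrow> ap (Z' w) k = ap VLefts (ap (ap (g w) (N 0)) k)"
    by (rule computed_post[OF ok g0 VLefts_rel]) blast
  show ?thesis
  proof (rule forceI)
    show "computed p (witness (Forall x \<phi>)) (\<lambda>w. ap (F w) (N 0))" using computed_app[OF ok F(1) computed_const[OF n]] by simp
    show "computed p (fn (challenge (Forall x \<phi>)) (conds p)) Z'" using Z'(1) by simp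
    fix w k assume w: "w \<in> wcar p" and k: "(k, k) \<in> challenge (Forall x \<phi>)" and c: "meets p w (ap (Z' w) k)"
    have k': "(k, k) \<in> challenge \<phi>" using k by simp
    have t: "(ap (ap (g w) (N 0)) k, ap (ap (g w) (N 0)) k) \<in> listr (sumr (widx p) {})"
      by (rule fnD2[OF computed_typed[OF ok g0 w] k'])
    have "realizes \<phi> ((E w)(x := d)) (ap (F w) (N 0)) k" if d: "(d, d) \<in> per (snd x)" for d
    proof -
      have "wcon ?u (Pr w d) z" if z: "z \<in> els (ap (Z (Pr w d)) k)" for z
      proof -
        have z': "z \<in> els (ap (ap (g w) (N 0)) k)" using z g(2)[OF w d] by simp
        have "(z, z) \<in> sumr (widx p) {}" by (rule els_dom[OF t z'])
        then obtain y where "z = VInl y" by (auto simp: sumr_def)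
        then show ?thesis using c z' unfolding Z'(2)[OF w k'] els_lefts[OF t] by simp
      qed
      then show ?thesis using hh[of "Pr w d" k] w d k' F(2)[OF w d] by simp
    qed
    then show "realizes (Forall x \<phi>) (E w) (ap (F w) (N 0)) k" by simp
  qed
qed

text \<open>A set of states cut out as an extension: the fibre has one point where \<open>Q\<close>
  holds and none elsewhere. No program has to decide \<open>Q\<close>, and no condition is
  added.\<close>

abbreviation restrict :: "world \<Rightarrow> (val \<Rightarrow> bool) \<Rightarrow> world" where
  "restrict p Q \<equiv> ext p (\<lambda>w. {a. a = N 0 \<and> Q w}) unitr (\<lambda>_. N 0) {} (\<lambda>_ _ _. True)"

lemma wle_restrict: "ok p \<Longrightarrow> wle (restrict p Q) vfst p" by (rule wle_ext[OF _ typed_unit])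

lemma large_restrict: assumes "ok p" "large (restrict p Q) (\<lambda>u. R (vfst u))" shows "large p (\<lambda>w. Q w \<longrightarrow> R w)"
  by (rule large_ext0[OF assms], rule largeI, assumption) force

text \<open>Consider the states where \<open>Q\<close> fails: below them \<open>Q\<close> can only
  become large in an inconsistent world, so that part is itself inconsistent and \<open>Q\<close> is
  large.\<close>

lemma large_stable:
  assumes ok: "ok p" and h: "\<And>q \<pi>. wle q \<pi> p \<Longrightarrow> (\<And>r \<rho>. wle r \<rho> q \<Longrightarrow> large r (\<lambda>w. Q (\<pi> (\<rho> w))) \<Longrightarrow> large r (\<lambda>_. False)) \<Longrightarrow>
    large q (\<lambda>_. False)"
  shows "large p Q"
proof -
  have "large (restrict p (\<lambda>w. \<not> Q w)) (\<lambda>_. False)"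
  proof (rule h[OF wle_restrict[OF ok]])
    fix r \<rho> assume le: "wle r \<rho> (restrict p (\<lambda>w. \<not> Q w))" and "large r (\<lambda>w. Q (vfst (\<rho> w)))"
    then show "large r (\<lambda>_. False)" by (elim large_mono) (use wle_car[OF le] in force)
  qed
  from large_restrict[OF ok this] show ?thesis by (rule large_mono) simp
qed

text \<open>The source of classical logic. Implications and quantifiers inherit stability; the case
  with content is \<open>St\<close>, where a finite list of candidates has to be recovered from a
  double negation.\<close>

lemma force_stable:
  assumes "ok p" "\<And>q \<pi>. wle q \<pi> p \<Longrightarrow>
     (\<And>r \<rho>. wle r \<rho> q \<Longrightarrow> force r (\<lambda>w. E (\<pi> (\<rho> w))) \<phi> \<Longrightarrow> large r (\<lambda>_. False)) \<Longrightarrow> large q (\<lambda>_. False)"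
  shows "force p E \<phi>"
  using assms
proof (induction \<phi> arbitrary: p E)
  case Bot
  note ok = Bot(1)
  have "large p (\<lambda>_. False)"
    by (rule Bot(2)[OF wle_refl[OF ok]]) (use force_Bot wle_ok in blast)
  then show ?case using force_Bot[OF ok] by blast
next
  case (Eq s t)
  show ?case unfolding force_Eq[OF Eq(1)]
  proof (rule large_stable[OF Eq(1)], rule Eq(2), assumption)
    fix q \<pi> r \<rho> assume "\<And>r \<rho>. wle r \<rho> q \<Longrightarrow> large r (\<lambda>w. (ev (E (\<pi> (\<rho> w))) s, ev (E (\<pi> (\<rho> w))) t) \<in> per (tyof s)) \<Longrightarrow>
        large r (\<lambda>_. False)"
      and r: "wle r \<rho> q" and f: "force r (\<lambda>w. E (\<pi> (\<rho> w))) (s \<^bold>= t)"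
    then show "large r (\<lambda>_. False)" using f[unfolded force_Eq[OF wle_ok[OF r]]] by blast
  qed
next
  case (St t)
  note ok = St(1)
  let ?\<sigma> = "per (tyof t)"
  \<comment> \<open>Impose generically that no standard object equals \<open>t\<close>. The
    inconsistency of this extension uses only finitely many of these conditions, and their indices
    are the desired candidates.\<close>
  let ?q = "ext p (\<lambda>_. {N 0}) unitr (\<lambda>_. N 0) ?\<sigma> (\<lambda>w _ x. (x, ev (E w) t) \<notin> ?\<sigma>)"
  have "large ?q (\<lambda>_. False)"
  proof (rule St(2)[OF wle_ext[OF ok typed_unit]])
    fix r \<rho> assume le: "wle r \<rho> ?q" and "force r (\<lambda>w. E (vfst (\<rho> w))) (St t)"
    then obtain l where l: "computed r (listr ?\<sigma>) l" and 1: "large r (\<lambda>w. \<exists>c\<in>els (l w). (c, ev (E (vfst (\<rho> w))) t) \<in> ?\<sigma>)"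
      using force_St[OF wle_ok[OF le]] by auto
    show "large r (\<lambda>_. False)"
      by (rule large_mp[OF wle_ok[OF le] 1 ext_constraints[OF le l]]) auto
  qed
  then obtain Z1 Z2 where Z: "computed p (conds p) Z1" "computed p (listr ?\<sigma>) Z2"
    "\<And>w a. w \<in> wcar p \<Longrightarrow> a \<in> {N 0} \<Longrightarrow> (meets p w (Z1 w)) \<Longrightarrow> (\<forall>x\<in>els (Z2 w). (x, ev (E w) t) \<notin> ?\<sigma>) \<Longrightarrow> False"
    by (rule large_ext0[OF ok]) blast
  have "large p (\<lambda>w. \<exists>c\<in>els (Z2 w). (c, ev (E w) t) \<in> ?\<sigma>)"
    by (rule largeI[OF Z(1)]) (use Z(3) in blast)
  then show ?case unfolding force_St[OF ok] using Z(2) by blast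
next
  case (Imp \<phi> \<psi>)
  show ?case
  proof (rule force_ImpI[OF Imp.prems(1)])
    fix q \<pi> assume q: "wle q \<pi> p" and f: "force q (\<lambda>w. E (\<pi> w)) \<phi>"
    show "force q (\<lambda>w. E (\<pi> w)) \<psi>"
    proof (rule Imp.IH(2)[OF wle_ok[OF q]])
      fix q' \<pi>' assume q': "wle q' \<pi>' q"
        and h: "\<And>r \<rho>. wle r \<rho> q' \<Longrightarrow> force r (\<lambda>w. E (\<pi> (\<pi>' (\<rho> w)))) \<psi> \<Longrightarrow> large r (\<lambda>_. False)"
      show "large q' (\<lambda>_. False)"
      proof (rule Imp.prems(2)[OF wle_trans[OF q' q]])
        fix r \<rho> assume r: "wle r \<rho> q'" and i: "force r (\<lambda>w. E (\<pi> (\<pi>' (\<rho> w)))) (\<phi> \<^bold>\<longrightarrow> \<psi>)"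
        have "force r (\<lambda>w. E (\<pi> (\<pi>' (\<rho> w)))) \<phi>"
          using force_mono[OF f wle_trans[OF r q']] .
        then have "force r (\<lambda>w. E (\<pi> (\<pi>' (\<rho> w)))) \<psi>"
          by (rule force_ImpD[OF i wle_refl[OF wle_ok[OF r]]])
        then show "large r (\<lambda>_. False)" by (rule h[OF r])
      qed
    qed
  qed
next
  case (Forall x \<phi>)
  show ?case
  proof (rule force_ForallI[OF Forall.prems(1)])
    fix q \<pi> c assume q: "wle q \<pi> p" and c: "\<And>w. w \<in> wcar q \<Longrightarrow> (c w, c w) \<in> per (snd x)"
    show "force q (\<lambda>w. (E (\<pi> w))(x := c w)) \<phi>"
    proof (rule Forall.IH[OF wle_ok[OF q]])
      fix q' \<pi>' assume q': "wle q' \<pi>' q"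
        and h: "\<And>r \<rho>. wle r \<rho> q' \<Longrightarrow> force r (\<lambda>w. (E (\<pi> (\<pi>' (\<rho> w))))(x := c (\<pi>' (\<rho> w)))) \<phi> \<Longrightarrow> large r (\<lambda>_. False)"
      show "large q' (\<lambda>_. False)"
      proof (rule Forall.prems(2)[OF wle_trans[OF q' q]])
        fix r \<rho> assume r: "wle r \<rho> q'" and i: "force r (\<lambda>w. E (\<pi> (\<pi>' (\<rho> w)))) (Forall x \<phi>)"
        have "force r (\<lambda>w. (E (\<pi> (\<pi>' (\<rho> w))))(x := c (\<pi>' (\<rho> w)))) \<phi>"
          by (rule force_ForallD[OF i wle_refl[OF wle_ok[OF r]]]) (use c wle_car[OF q'] wle_car[OF r] in blast)
        then show "large r (\<lambda>_. False)" by (rule h[OF r])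
      qed
    qed
  qed
qed

text \<open>The counterpart of Los's theorem for large properties. Restriction to the states
  satisfying the premise handles implication, and a hidden generic element handles the
  quantifier.\<close>

lemma force_internal: "ok p \<Longrightarrow> internal \<phi> \<Longrightarrow> force p E \<phi> \<longleftrightarrow> large p (\<lambda>w. sat (E w) \<phi>)"
proof (induction \<phi> arbitrary: p E)
  case Bot then show ?case by (simp add: force_Bot)
next
  case (Eq s t) then show ?case by (simp add: force_Eq)
next
  case (Imp \<phi> \<psi>)
  note ok = Imp.prems(1)
  show ?case
  proof
    assume f: "force p E (\<phi> \<^bold>\<longrightarrow> \<psi>)"
    let ?q = "restrict p (\<lambda>w. sat (E w) \<phi>)"
    note le = wle_restrict[OF ok, of "\<lambda>w. sat (E w) \<phi>"]
    have "force ?q (\<lambda>w. E (vfst w)) \<phi>"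
      using Imp.IH(1)[OF wle_ok[OF le], of "\<lambda>w. E (vfst w)"] Imp.prems(2) by (auto intro!: large_all)
    then have "force ?q (\<lambda>w. E (vfst w)) \<psi>" by (rule force_ImpD[OF f le])
    then have "large ?q (\<lambda>w. sat (E (vfst w)) \<psi>)"
      using Imp.IH(2)[OF wle_ok[OF le], of "\<lambda>w. E (vfst w)"] Imp.prems(2) by auto
    from large_restrict[OF ok this] show "large p (\<lambda>w. sat (E w) (\<phi> \<^bold>\<longrightarrow> \<psi>))" by simp
  next
    assume l: "large p (\<lambda>w. sat (E w) (\<phi> \<^bold>\<longrightarrow> \<psi>))"
    show "force p E (\<phi> \<^bold>\<longrightarrow> \<psi>)"
    proof (rule force_ImpI[OF ok])
      fix q \<pi> assume le: "wle q \<pi> p" and f: "force q (\<lambda>w. E (\<pi> w)) \<phi>"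
      then have "large q (\<lambda>w. sat (E (\<pi> w)) \<phi>)"
        using Imp.IH(1)[OF wle_ok[OF le], of "\<lambda>w. E (\<pi> w)"] Imp.prems(2) by auto
      then have "large q (\<lambda>w. sat (E (\<pi> w)) \<psi>)"
        by (rule large_mp[OF wle_ok[OF le] _ large_wle[OF le l]]) simp
      then show "force q (\<lambda>w. E (\<pi> w)) \<psi>"
        using Imp.IH(2)[OF wle_ok[OF le], of "\<lambda>w. E (\<pi> w)"] Imp.prems(2) by auto
    qed
  qed
next
  case (Forall x \<phi>)
  note ok = Forall.prems(1)
  have i: "internal \<phi>" using Forall.prems(2) by simp
  show ?case
  proof
    assume f: "force p E (Forall x \<phi>)"
    let ?q = "ext p (\<lambda>_. {a. (a, a) \<in> per (snd x)}) unitr (\<lambda>_. N 0) {} (\<lambda>_ _ _. True)"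
    have le: "wle ?q vfst p" by (rule wle_ext[OF ok typed_unit])
    have "force ?q (\<lambda>w. (E (vfst w))(x := vsnd w)) \<phi>" by (rule force_ForallD[OF f le]) auto
    then have "large ?q (\<lambda>w. sat ((E (vfst w))(x := vsnd w)) \<phi>)"
      by (rule Forall.IH[OF wle_ok[OF le] i, THEN iffD1])
    then obtain Z1 where Z1: "computed p (conds p) Z1"
      "\<And>w a. w \<in> wcar p \<Longrightarrow> (a, a) \<in> per (snd x) \<Longrightarrow> (meets p w (Z1 w)) \<Longrightarrow> sat ((E w)(x := a)) \<phi>"
      by (rule large_ext0[OF ok]) (simp del: fun_upd_apply)
    show "large p (\<lambda>w. sat (E w) (Forall x \<phi>))"
      by (rule largeI[OF Z1(1)]) (use Z1(2) in \<open>simp del: fun_upd_apply\<close>)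
  next
    assume l: "large p (\<lambda>w. sat (E w) (Forall x \<phi>))"
    show "force p E (Forall x \<phi>)"
    proof (rule force_ForallI[OF ok])
      fix q \<pi> c assume le: "wle q \<pi> p" and c: "\<And>w. w \<in> wcar q \<Longrightarrow> (c w, c w) \<in> per (snd x)"
      have "large q (\<lambda>w. sat ((E (\<pi> w))(x := c w)) \<phi>)" by (rule large_mono[OF large_wle[OF le l]]) (use c in auto)
      then show "force q (\<lambda>w. (E (\<pi> w))(x := c w)) \<phi>"
        by (rule Forall.IH[OF wle_ok[OF le] i, THEN iffD2])
    qed
  qed
qed simp

section \<open>Extensionally equal environments and substitution\<close>

lemma realizes_cong: "wff \<phi> \<Longrightarrow> (\<And>x. x \<in> fv \<phi> \<Longrightarrow> (v x, v' x) \<in> per (snd x)) \<Longrightarrow> realizes \<phi> v Y k \<longleftrightarrow> realizes \<phi> v' Y k"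
proof (induction \<phi> arbitrary: v v' Y k)
  case (Eq s t)
  have 1: "(ev v s, ev v' s) \<in> per (tyof s)" by (rule ev_rel) (use Eq in auto)
  have 2: "(ev v t, ev v' t) \<in> per (tyof s)" using ev_rel[of t v v'] Eq by auto
  show ?case unfolding realizes.simps
    using per_trans[OF per_trans[OF per_sym[OF 1]] 2] per_trans[OF per_trans[OF 1] per_sym[OF 2]] by blast
next
  case (St t)
  have 1: "(ev v t, ev v' t) \<in> per (tyof t)" by (rule ev_rel) (use St in auto)
  show ?case unfolding realizes.simps using per_trans[OF _ 1] per_trans[OF _ per_sym[OF 1]] by blast
next
  case (Imp \<phi> \<psi>)
  have "realizes \<phi> v Y k = realizes \<phi> v' Y k" "realizes \<psi> v Y k = realizes \<psi> v' Y k" for Y k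
    by (rule Imp.IH; use Imp.prems in simp)+
  then show ?case by simp
next
  case (Forall x \<phi>)
  have "realizes \<phi> (v(x := d)) Y k = realizes \<phi> (v'(x := d)) Y k" if "(d, d) \<in> per (snd x)" for d
    using Forall.prems that by (intro Forall.IH) auto
  then show ?case by simp
qed simp

lemma force_cong:
  assumes "wff \<phi>" "\<And>w x. w \<in> wcar p \<Longrightarrow> x \<in> fv \<phi> \<Longrightarrow> (E w x, E' w x) \<in> per (snd x)" "force p E \<phi>"
  shows "force p E' \<phi>"
proof (rule forceE[OF assms(3)], rule forceI, assumption, assumption)
  fix Y Z w x assume "\<And>w x. w \<in> wcar p \<Longrightarrow> (x, x) \<in> challenge \<phi> \<Longrightarrow> meets p w (ap (Z w) x) \<Longrightarrow> realizes \<phi> (E w) (Y w) x"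
    "w \<in> wcar p" "(x, x) \<in> challenge \<phi>" "meets p w (ap (Z w) x)"
  then have "realizes \<phi> (E w) (Y w) x" by blast
  then show "realizes \<phi> (E' w) (Y w) x" using realizes_cong[OF assms(1) assms(2)[OF \<open>w \<in> wcar p\<close>]] by blast
qed

lemma subst_witness_challenge: "tyof u = snd x \<Longrightarrow> witness (subst x u \<phi>) = witness \<phi> \<and> challenge (subst x u \<phi>) = challenge \<phi>"
  by (induction \<phi>) (auto simp: tyof_substt)

lemma substt_id: "x \<notin> fvt t \<Longrightarrow> substt x u t = t"
  by (induction t) auto

lemma subst_id: "x \<notin> fv \<phi> \<Longrightarrow> subst x u \<phi> = \<phi>"
  by (induction \<phi>) (auto simp: substt_id)

lemma realizes_subst:
  assumes "wff \<phi>" "u \<triangleright> snd x" "free_for u x \<phi>" "\<And>y. (v y, v y) \<in> per (snd y)"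
  shows "realizes (subst x u \<phi>) v Y k \<longleftrightarrow> realizes \<phi> (v(x := ev v u)) Y k"
  using assms
proof (induction \<phi> arbitrary: v Y k)
  case (Imp \<phi> \<psi>) then show ?case by simp
next
  case (Forall y \<phi>)
  have u: "(ev v u, ev v u) \<in> per (snd x)" using Forall.prems ev_rel[of u v v] by (auto simp: has_ty_def)
  show ?case
  proof (cases "x \<in> fv (Forall y \<phi>)")
    case False
    then show ?thesis unfolding subst_id[OF False]
      by (intro realizes_cong) (use Forall.prems in auto)
  next
    case True
    then have y: "y \<noteq> x" "y \<notin> fvt u" "free_for u x \<phi>" using Forall.prems(3) by auto
    have "realizes (subst x u \<phi>) (v(y := d)) Y k \<longleftrightarrow> realizes \<phi> ((v(x := ev v u))(y := d)) Y k"
      if d: "(d, d) \<in> per (snd y)" for d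
    proof -
      have e: "ev (v(y := d)) u = ev v u" using y by (intro ev_cong) auto
      have "realizes (subst x u \<phi>) (v(y := d)) Y k \<longleftrightarrow> realizes \<phi> ((v(y := d))(x := ev (v(y := d)) u)) Y k"
        using Forall.prems y d by (intro Forall.IH) auto
      then show ?thesis unfolding e using y by (simp add: fun_upd_twist)
    qed
    then show ?thesis using y by (simp del: fun_upd_apply)
  qed
qed (auto simp: ev_subst tyof_substt has_ty_def)

definition typed_env :: "world \<Rightarrow> (val \<Rightarrow> var \<Rightarrow> val) \<Rightarrow> bool" where
  "typed_env p E \<longleftrightarrow> (\<forall>w\<in>wcar p. \<forall>y. (E w y, E w y) \<in> per (snd y))"

lemma typed_env_wle: "typed_env p E \<Longrightarrow> wle q \<pi> p \<Longrightarrow> typed_env q (\<lambda>w. E (\<pi> w))"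
  unfolding typed_env_def using wle_car by blast

lemma typed_env_upd: "typed_env p E \<Longrightarrow> (\<And>w. w \<in> wcar p \<Longrightarrow> (c w, c w) \<in> per (snd x)) \<Longrightarrow> typed_env p (\<lambda>w. (E w)(x := c w))"
  unfolding typed_env_def by auto

lemma force_subst:
  assumes "wff \<phi>" "u \<triangleright> snd x" "free_for u x \<phi>" "typed_env p E"
  shows "force p E (subst x u \<phi>) \<longleftrightarrow> force p (\<lambda>w. (E w)(x := ev (E w) u)) \<phi>"
proof -
  have u: "tyof u = snd x" using assms by (simp add: has_ty_def)
  have "realizes (subst x u \<phi>) (E w) Y k \<longleftrightarrow> realizes \<phi> ((E w)(x := ev (E w) u)) Y k" if "w \<in> wcar p" for w Y k
    using assms that by (intro realizes_subst) (auto simp: typed_env_def)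
  then show ?thesis unfolding force_def subst_witness_challenge[OF u, THEN conjunct1] subst_witness_challenge[OF u, THEN conjunct2]
    by (simp cong: conj_cong)
qed

section \<open>Evaluation of the defined terms\<close>

definition tv :: "(var \<Rightarrow> val) \<Rightarrow> bool" where "tv v \<longleftrightarrow> (\<forall>y. (v y, v y) \<in> per (snd y))"

lemma zval_rel: "(zval \<sigma>, zval \<sigma>) \<in> per \<sigma>"
proof (induction \<sigma>)
  case (Arr \<sigma> \<tau>)
  then show ?case
    by (auto intro!: fnI[where F = "\<lambda>_. zval \<tau>" and G = "\<lambda>_. zval \<tau>"] appl.intros(3))
qed auto

lemma tv_zval: "tv (\<lambda>x. zval (snd x))" by (simp add: tv_def zval_rel)
lemma tv_upd: "tv v \<Longrightarrow> (a, a) \<in> per (snd x) \<Longrightarrow> tv (v(x := a))" by (auto simp: tv_def fun_upd_apply)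
lemma tv_D: "tv v \<Longrightarrow> (v y, v y) \<in> per (snd y)" unfolding tv_def by blast

lemma ev_typed: "tv v \<Longrightarrow> wt t \<Longrightarrow> (ev v t, ev v t) \<in> per (tyof t)"
  by (rule ev_rel) (auto simp: tv_def)

lemma ev_lam_tv: "tv v \<Longrightarrow> wt t \<Longrightarrow> (a, a) \<in> per (snd x) \<Longrightarrow> ap (ev v (lam x t)) a = ev (v(x := a)) t"
  by (rule ev_lam) (auto simp: tv_def)

lemma closed_rel: "wt t \<Longrightarrow> fvt t = {} \<Longrightarrow> (ev v t, ev v t) \<in> per (tyof t)"
  by (rule ev_rel) auto

definition closed_value :: "tm \<Rightarrow> val" where "closed_value t = ev (\<lambda>x. zval (snd x)) t"

lemma ev_closed_value: "fvt t = {} \<Longrightarrow> ev v t = closed_value t"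
  unfolding closed_value_def by (rule ev_cong) auto

lemma closed_value_rel: "wt t \<Longrightarrow> fvt t = {} \<Longrightarrow> (closed_value t, closed_value t) \<in> per (tyof t)"
  unfolding closed_value_def by (rule closed_rel)

lemma rec_Suc: "(a, a) \<in> per \<rho> \<Longrightarrow> (f, f) \<in> per (NN \<rightarrow> \<rho> \<rightarrow> \<rho>) \<Longrightarrow>
   ap (VRec2 a f) (N (Suc n)) = ap (ap f (N n)) (ap (VRec2 a f) (N n))"
  by (rule ap_Rec_Suc) auto

lemma fold_Cons: "(a, a) \<in> per \<rho> \<Longrightarrow> (f, f) \<in> per (\<sigma> \<rightarrow> \<rho> \<rightarrow> \<rho>) \<Longrightarrow> (x, x) \<in> per \<sigma> \<Longrightarrow> (L s, L s) \<in> per (\<sigma>\<^sup>\<star>) \<Longrightarrow>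
   ap (VFold2 a f) (L (x # s)) = ap (ap f x) (ap (VFold2 a f) (L s))"
  by (rule ap_Fold_Cons) auto

declare lam.simps [simp del] fun_upd_apply [simp del] fun_upd_same [simp] fun_upd_other [simp]

lemmas tvs = tv_zval tv_upd ev_lam_tv tyof_lam

lemma ev_addT: "ap (ap (ev v addT) (N a)) (N b) = N (a + b)"
proof -
  let ?b = "lam (2, NN) (lam (1, NN) (Su (Var (1, NN))))"
  let ?v = "(\<lambda>x. zval (snd x))((0, NN) := N a)"
  let ?f = "ev ?v ?b"
  have tv: "tv ?v" by (simp add: tvs)
  have f: "ap (ap ?f (N n)) (N m) = N (Suc m)" for n m by (simp add: tvs)
  have t: "(?f, ?f) \<in> per (NN \<rightarrow> NN \<rightarrow> NN)" using ev_typed[OF tv, of ?b] by (simp add: tvs)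
  have "ap (VRec2 (N a) ?f) (N b) = N (a + b)"
  proof (induction b)
    case (Suc b) then show ?case using rec_Suc[OF _ t, of "N a" b] f by simp
  qed simp
  moreover have "ap (ev v addT) (N a) = VRec2 (N a) ?f"
    unfolding ev_closed_value[of addT v, OF addT_closed[THEN conjunct2, THEN conjunct2]] closed_value_def by (simp add: addT_def Let_def tvs)
  ultimately show ?thesis by simp
qed

lemma ev_mulT: "ap (ap (ev v mulT) (N a)) (N b) = N (b * a)"
proof -
  let ?b = "lam (2, NN) (lam (1, NN) (Var (1, NN) \<^bold>+ Var (0, NN)))"
  let ?v = "(\<lambda>x. zval (snd x))((0, NN) := N a)"
  let ?f = "ev ?v ?b"
  have tv: "tv ?v" by (simp add: tvs)
  have f: "ap (ap ?f (N n)) (N m) = N (m + a)" for n m by (simp add: tvs ev_addT)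
  have t: "(?f, ?f) \<in> per (NN \<rightarrow> NN \<rightarrow> NN)" using ev_typed[OF tv, of ?b] by (simp add: tvs)
  have "ap (VRec2 (N 0) ?f) (N b) = N (b * a)"
  proof (induction b)
    case (Suc b) then show ?case using rec_Suc[OF _ t, of "N 0" b] f by (simp add: add.commute)
  qed simp
  moreover have "ap (ev v mulT) (N a) = VRec2 (N 0) ?f"
    unfolding ev_closed_value[of mulT v, OF mulT_closed[THEN conjunct2, THEN conjunct2]] closed_value_def by (simp add: mulT_def Let_def tvs)
  ultimately show ?thesis by simp
qed

lemma ev_pow2T: "ap (ev v pow2T) (N b) = N (2 ^ b)"
proof -
  let ?b = "lam (2, NN) (lam (1, NN) (Var (1, NN) \<^bold>+ Var (1, NN)))"
  let ?v = "(\<lambda>x. zval (snd x))"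
  let ?f = "ev ?v ?b"
  have tv: "tv ?v" by (simp add: tvs)
  have f: "ap (ap ?f (N n)) (N m) = N (m + m)" for n m by (simp add: tvs ev_addT)
  have t: "(?f, ?f) \<in> per (NN \<rightarrow> NN \<rightarrow> NN)" using ev_typed[OF tv, of ?b] by (simp add: tvs)
  have "ap (VRec2 (N 1) ?f) (N b) = N (2 ^ b)"
  proof (induction b)
    case (Suc b) then show ?case using rec_Suc[OF _ t, of "N 1" b] f by simp
  qed simp
  moreover have "ev v pow2T = VRec2 (N 1) ?f"
    unfolding ev_closed_value[of pow2T v, OF pow2T_closed[THEN conjunct2, THEN conjunct2]] closed_value_def by (simp add: pow2T_def Let_def tvs)
  ultimately show ?thesis by simp
qed

lemma ev_triT: "ap (ev v triT) (N b) = N (triangle b)"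
proof -
  let ?b = "lam (2, NN) (lam (1, NN) (Var (1, NN) \<^bold>+ Su (Var (2, NN))))"
  let ?v = "(\<lambda>x. zval (snd x))"
  let ?f = "ev ?v ?b"
  have tv: "tv ?v" by (simp add: tvs)
  have f: "ap (ap ?f (N n)) (N m) = N (m + Suc n)" for n m by (simp add: tvs ev_addT)
  have t: "(?f, ?f) \<in> per (NN \<rightarrow> NN \<rightarrow> NN)" using ev_typed[OF tv, of ?b] by (simp add: tvs)
  have "ap (VRec2 (N 0) ?f) (N b) = N (triangle b)"
  proof (induction b)
    case (Suc b) then show ?case using rec_Suc[OF _ t, of "N 0" b] f by simp
  qed simp
  moreover have "ev v triT = VRec2 (N 0) ?f"
    unfolding ev_closed_value[of triT v, OF triT_closed[THEN conjunct2, THEN conjunct2]] closed_value_def by (simp add: triT_def Let_def tvs)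
  ultimately show ?thesis by simp
qed

text \<open>\<open>prod_encode\<close> adds its first component to the triangular number, the
  pairing term its second. Hence the swap, which the definition of \<open>code\<close>
  anticipates.\<close>

lemma ev_pairT: "ap (ap (ev v pairT) (N a)) (N b) = N (prod_encode (b, a))"
  unfolding ev_closed_value[of pairT v, OF pairT_closed[THEN conjunct2, THEN conjunct2]] closed_value_def
  by (simp add: pairT_def Let_def tvs ev_addT ev_triT prod_encode_def add.commute)

lemma list_N: "(L (map N s), L (map N s)) \<in> listr natr"
  by (simp add: list_all2_same)

lemma ev_codeT: "ap (ev v codeT) (L (map N s)) = N (code s)"
proof -
  let ?b = "lam (0, NN) (lam (1, NN) (Su (pairT \<cdot> Var (0, NN) \<cdot> Var (1, NN))))"
  let ?v = "(\<lambda>x. zval (snd x))"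
  let ?f = "ev ?v ?b"
  have tv: "tv ?v" by (simp add: tvs)
  have f: "ap (ap ?f (N n)) (N m) = N (Suc (prod_encode (m, n)))" for n m by (simp add: tvs ev_pairT)
  have t: "(?f, ?f) \<in> per (NN \<rightarrow> NN \<rightarrow> NN)" using ev_typed[OF tv, of ?b] by (simp add: tvs)
  have "ap (VFold2 (N 0) ?f) (L (map N s)) = N (code s)"
  proof (induction s)
    case (Cons a s)
    then show ?case using fold_Cons[OF _ t, of "N 0" "N a" "map N s"] f list_N[of s] by simp
  qed simp
  moreover have "ev v codeT = VFold2 (N 0) ?f"
    unfolding ev_closed_value[of codeT v, OF codeT_closed[THEN conjunct2, THEN conjunct2]] closed_value_def by (simp add: codeT_def Let_def tvs)
  ultimately show ?thesis by simp
qed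

lemma ev_appendT:
  assumes s: "(L s, L s) \<in> per (\<sigma>\<^sup>\<star>)" and t: "(L t, L t) \<in> per (\<sigma>\<^sup>\<star>)"
  shows "ap (ap (ev v (appendT \<sigma>)) (L s)) (L t) = L (s @ t)"
proof -
  have c: "(VCons, VCons) \<in> per (\<sigma> \<rightarrow> \<sigma>\<^sup>\<star> \<rightarrow> \<sigma>\<^sup>\<star>)" by (simp add: VCons_rel)
  have "ap (VFold2 (L t) VCons) (L s) = L (s @ t)"
    using s
  proof (induction s)
    case (Cons a s)
    then show ?case using fold_Cons[OF t c, of a s] by simp
  qed simp
  moreover have "ap (ap (ev v (appendT \<sigma>)) (L s)) (L t) = ap (VFold2 (L t) VCons) (L s)"
    unfolding ev_closed_value[of "appendT \<sigma>" v, OF appendT_closed[THEN conjunct2, THEN conjunct2]] closed_value_def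
    using s t by (simp add: appendT_def Let_def tvs)
  ultimately show ?thesis by simp
qed

lemma ev_lenT:
  assumes s: "(L s, L s) \<in> per (\<sigma>\<^sup>\<star>)"
  shows "ap (ev v (lenT \<sigma>)) (L s) = N (length s)"
proof -
  let ?b = "lam (0, \<sigma>) (lam (1, NN) (Su (Var (1, NN))))"
  let ?v = "(\<lambda>x. zval (snd x))"
  let ?f = "ev ?v ?b"
  have tv: "tv ?v" by (simp add: tvs)
  have f: "(a, a) \<in> per \<sigma> \<Longrightarrow> ap (ap ?f a) (N m) = N (Suc m)" for a m by (simp add: tvs)
  have t: "(?f, ?f) \<in> per (\<sigma> \<rightarrow> NN \<rightarrow> NN)" using ev_typed[OF tv, of ?b] by (simp add: tvs)
  have "ap (VFold2 (N 0) ?f) (L s) = N (length s)"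
    using s
  proof (induction s)
    case (Cons a s)
    then show ?case using fold_Cons[OF _ t, of "N 0" a s] f[of a] by simp
  qed simp
  moreover have "ev v (lenT \<sigma>) = VFold2 (N 0) ?f"
    unfolding ev_closed_value[of "lenT \<sigma>" v, OF lenT_closed[THEN conjunct2, THEN conjunct2]] closed_value_def by (simp add: lenT_def Let_def tvs)
  ultimately show ?thesis by simp
qed

lemma ev_nthT:
  assumes s: "(L s, L s) \<in> per (\<sigma>\<^sup>\<star>)" and i: "i < length s"
  shows "ap (ap (ev v (nthT \<sigma>)) (L s)) (N i) = s ! i"
proof -
  let ?d = "lam (3, NN) (lam (4, \<sigma>) (Var (1, NN \<rightarrow> \<sigma>) \<cdot> Var (3, NN)))"
  let ?c = "lam (2, NN) (Cst (CRec \<sigma>) \<cdot> Var (0, \<sigma>) \<cdot> ?d \<cdot> Var (2, NN))"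
  let ?b = "lam (0, \<sigma>) (lam (1, NN \<rightarrow> \<sigma>) ?c)"
  let ?v = "(\<lambda>x. zval (snd x))"
  let ?f = "ev ?v ?b"
  let ?z = "ev ?v (zeroT (NN \<rightarrow> \<sigma>))"
  have tv: "tv ?v" by (simp add: tvs)
  have z: "(?z, ?z) \<in> per (NN \<rightarrow> \<sigma>)" using ev_typed[OF tv, of "zeroT (NN \<rightarrow> \<sigma>)"] by simp
  have t: "(?f, ?f) \<in> per (\<sigma> \<rightarrow> (NN \<rightarrow> \<sigma>) \<rightarrow> (NN \<rightarrow> \<sigma>))" using ev_typed[OF tv, of ?b] by (simp add: tvs)
  have f: "ap (ap (ap ?f a) r) (N j) = (case j of 0 \<Rightarrow> a | Suc k \<Rightarrow> ap r (N k))"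
    if a: "(a, a) \<in> per \<sigma>" and r: "(r, r) \<in> per (NN \<rightarrow> \<sigma>)" for a r j
  proof -
    let ?w = "?v((0, \<sigma>) := a, (1, NN \<rightarrow> \<sigma>) := r, (2, NN) := N j)"
    have tw: "tv ?w" using a r by (simp add: tvs)
    have td: "(ev ?w ?d, ev ?w ?d) \<in> per (NN \<rightarrow> \<sigma> \<rightarrow> \<sigma>)" using ev_typed[OF tw, of ?d] by (simp add: tvs)
    have d: "ap (ap (ev ?w ?d) (N k)) u = ap r (N k)" if "(u, u) \<in> per \<sigma>" for k u
      using tw that by (simp add: tvs)
    have "ap (ap (ap ?f a) r) (N j) = ap (VRec2 a (ev ?w ?d)) (N j)"
      using a r by (simp add: tvs)
    also have "\<dots> = (case j of 0 \<Rightarrow> a | Suc k \<Rightarrow> ap r (N k))"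
    proof (cases j)
      case (Suc k)
      have "(ap (VRec2 a (ev ?w ?d)) (N k), ap (VRec2 a (ev ?w ?d)) (N k)) \<in> per \<sigma>"
        using fnD2[OF VRec2_rel[OF a], of "ev ?w ?d" "ev ?w ?d" "N k" "N k"] td by simp
      then show ?thesis using Suc rec_Suc[OF a td, of k] d by simp
    qed simp
    finally show ?thesis .
  qed
  have "i < length s \<Longrightarrow> ap (ap (VFold2 ?z ?f) (L s)) (N i) = s ! i"
    using s
  proof (induction s arbitrary: i)
    case (Cons a s)
    then have as: "(a, a) \<in> per \<sigma>" "(L s, L s) \<in> per (\<sigma>\<^sup>\<star>)" by auto
    have r: "(ap (VFold2 ?z ?f) (L s), ap (VFold2 ?z ?f) (L s)) \<in> per (NN \<rightarrow> \<sigma>)"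
      using fnD2[OF VFold2_rel[OF z], of ?f ?f "per \<sigma>" "L s" "L s"] t as by simp
    show ?case
      using fold_Cons[OF z t as] f[OF as(1) r, of i] Cons by (cases i) (simp_all add: fold_Cons[OF z t as])
  qed simp
  moreover have "ev v (nthT \<sigma>) = VFold2 ?z ?f"
    unfolding ev_closed_value[of "nthT \<sigma>" v, OF nthT_closed[THEN conjunct2, THEN conjunct2]] closed_value_def by (simp add: nthT_def Let_def tvs)
  ultimately show ?thesis using i by simp
qed

lemma ev_initT:
  assumes g: "\<And>i. app g (N i) (N (h i))"
  shows "ap (ap (ev v initT) g) (N n) = L (map N (map h [0..<n]))"
proof -
  let ?b = "lam (1, NN) (lam (2, NN\<^sup>\<star>) (appendT NN \<cdot> Var (2, NN\<^sup>\<star>) \<cdot> cons NN (Var (0, NN \<rightarrow> NN) \<cdot> Var (1, NN)) (Cst (CNil NN))))"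
  let ?v = "(\<lambda>x. zval (snd x))((0, NN \<rightarrow> NN) := g)"
  let ?f = "ev ?v ?b"
  have gt: "(g, g) \<in> fn natr natr" by (rule fn_natI[OF g g]) simp
  have tv: "tv ?v" using gt by (simp add: tvs)
  have f: "ap (ap ?f (N i)) (L (map N s)) = L (map N (s @ [h i]))" for i s
    using tv gt list_N[of s] ap_eq[OF g[of i]] by (simp add: tvs ev_appendT)
  have t: "(?f, ?f) \<in> per (NN \<rightarrow> NN\<^sup>\<star> \<rightarrow> NN\<^sup>\<star>)" using ev_typed[OF tv, of ?b] by (simp add: tvs)
  have "ap (VRec2 (L []) ?f) (N n) = L (map N (map h [0..<n]))"
  proof (induction n)
    case (Suc n) then show ?case using rec_Suc[OF _ t, of "L []" n] f[of n "map h [0..<n]"] by simp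
  qed simp
  moreover have "ap (ev v initT) g = VRec2 (L []) ?f"
    unfolding ev_closed_value[of initT v, OF initT_closed[THEN conjunct2, THEN conjunct2]] closed_value_def using gt by (simp add: initT_def Let_def tvs)
  ultimately show ?thesis by simp
qed

fun words :: "nat \<Rightarrow> nat list list" where
  "words 0 = [[]]"
| "words (Suc n) = map ((#) 0) (words n) @ map ((#) 1) (words n)"

abbreviation LL :: "nat list list \<Rightarrow> val" where "LL ss \<equiv> L (map (\<lambda>s. L (map N s)) ss)"

lemma LL_rel: "(LL ss, LL ss) \<in> listr (listr natr)"
  by (simp add: list_all2_same)

lemma ev_prefixT:
  assumes b: "\<And>v. ev v b = N k" "b \<triangleright> NN"  "fvt b = {}"
  shows "ap (ev v (prefixT b)) (LL ss) = LL (map ((#) k) ss)"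
proof -
  let ?b = "lam (0, NN\<^sup>\<star>) (lam (1, (NN\<^sup>\<star>)\<^sup>\<star>) (cons (NN\<^sup>\<star>) (cons NN b (Var (0, NN\<^sup>\<star>))) (Var (1, (NN\<^sup>\<star>)\<^sup>\<star>))))"
  let ?v = "(\<lambda>x. zval (snd x))"
  let ?f = "ev ?v ?b"
  have tv: "tv ?v" by (simp add: tvs)
  have b': "wt b" "tyof b = NN" using b by (auto simp: has_ty_def)
  have f: "ap (ap ?f (L (map N s))) (LL ss) = LL ((k # s) # ss)" for s ss
    using list_N[of s] LL_rel[of ss] by (simp add: tvs b')(simp add: b)
  have t: "(?f, ?f) \<in> per (NN\<^sup>\<star> \<rightarrow> (NN\<^sup>\<star>)\<^sup>\<star> \<rightarrow> (NN\<^sup>\<star>)\<^sup>\<star>)" using ev_typed[OF tv, of ?b] by (simp add: tvs b')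
  have "ap (VFold2 (L []) ?f) (LL ss) = LL (map ((#) k) ss)"
  proof (induction ss)
    case (Cons s ss)
    have "ap (VFold2 (L []) ?f) (LL (s # ss)) = ap (ap ?f (L (map N s))) (ap (VFold2 (L []) ?f) (LL ss))"
      using fold_Cons[OF _ t, of "L []" "L (map N s)" "map (\<lambda>s. L (map N s)) ss"] list_N[of s] LL_rel[of ss] by simp
    then show ?case unfolding Cons f by simp
  qed simp
  moreover have "ev v (prefixT b) = VFold2 (L []) ?f"
    unfolding prefixT_def Let_def by (simp, rule ev_cong) (use b(3) in auto)
  ultimately show ?thesis by simp
qed

lemma prefixT_closed: "wt b \<Longrightarrow> tyof b = NN \<Longrightarrow> fvt b = {} \<Longrightarrow>
   wt (prefixT b) \<and> tyof (prefixT b) = (NN\<^sup>\<star>)\<^sup>\<star> \<rightarrow> (NN\<^sup>\<star>)\<^sup>\<star> \<and> fvt (prefixT b) = {}"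
  by (auto simp: prefixT_def Let_def tyof_lam)

lemma ev_wordsT: "ap (ev v wordsT) (N n) = LL (words n)"
proof -
  let ?r = "Var (1, (NN\<^sup>\<star>)\<^sup>\<star>)"
  let ?b = "lam (0, NN) (lam (1, (NN\<^sup>\<star>)\<^sup>\<star>) (appendT (NN\<^sup>\<star>) \<cdot> (prefixT Ze \<cdot> ?r) \<cdot> (prefixT (Su Ze) \<cdot> ?r)))"
  let ?v = "(\<lambda>x. zval (snd x))"
  let ?f = "ev ?v ?b"
  have tv: "tv ?v" by (simp add: tvs)
  have p: "ap (ev v (prefixT Ze)) (LL ss) = LL (map ((#) 0) ss)" "ap (ev v (prefixT (Su Ze))) (LL ss) = LL (map ((#) 1) ss)" for v ss
    by (rule ev_prefixT; simp add: has_ty_def)+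
  have f: "ap (ap ?f (N i)) (LL ss) = LL (map ((#) 0) ss @ map ((#) 1) ss)" for i ss
  proof -
    have "ap (ap ?f (N i)) (LL ss) = ap (ap (ev (?v((0, NN) := N i, (1, (NN\<^sup>\<star>)\<^sup>\<star>) := LL ss)) (appendT (NN\<^sup>\<star>))) (LL (map ((#) 0) ss))) (LL (map ((#) 1) ss))"
      using LL_rel[of ss] by (simp add: tvs prefixT_closed p del: map_map)
    also have "\<dots> = LL (map ((#) 0) ss @ map ((#) 1) ss)"
      using LL_rel[of "map ((#) 0) ss"] LL_rel[of "map ((#) 1) ss"] by (subst ev_appendT) (simp_all del: map_map listr_L)
    finally show ?thesis .
  qed
  have t: "(?f, ?f) \<in> per (NN \<rightarrow> (NN\<^sup>\<star>)\<^sup>\<star> \<rightarrow> (NN\<^sup>\<star>)\<^sup>\<star>)" using ev_typed[OF tv, of ?b] by (simp add: tvs prefixT_closed)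
  have "ap (VRec2 (LL [[]]) ?f) (N n) = LL (words n)"
  proof (induction n)
    case (Suc n)
    have "ap (VRec2 (LL [[]]) ?f) (N (Suc n)) = ap (ap ?f (N n)) (ap (VRec2 (LL [[]]) ?f) (N n))"
      using rec_Suc[OF _ t, of "LL [[]]" n] LL_rel[of "[[]]"] by simp
    then show ?case unfolding Suc f by simp
  qed simp
  moreover have "ev v wordsT = VRec2 (LL [[]]) ?f"
    unfolding ev_closed_value[of wordsT v, OF wordsT_closed[THEN conjunct2, THEN conjunct2]] closed_value_def by (simp add: wordsT_def Let_def tvs)
  ultimately show ?thesis by simp
qed

lemma ev_countT:
  assumes g: "\<And>i. app g (N i) (N (h i))"
  shows "ap (ap (ev v countT) g) (N n) = N (\<Sum>s\<leftarrow>words n. h (code s))"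
proof -
  let ?b = "lam (2, NN\<^sup>\<star>) (lam (3, NN) (Var (0, NN \<rightarrow> NN) \<cdot> (codeT \<cdot> Var (2, NN\<^sup>\<star>)) \<^bold>+ Var (3, NN)))"
  let ?v = "(\<lambda>x. zval (snd x))((0, NN \<rightarrow> NN) := g, (1, NN) := N n)"
  let ?f = "ev ?v ?b"
  have gt: "(g, g) \<in> fn natr natr" by (rule fn_natI[OF g g]) simp
  have tv: "tv ?v" using gt by (simp add: tvs)
  have f: "ap (ap ?f (L (map N s))) (N m) = N (h (code s) + m)" for s m
    using tv gt list_N[of s] ap_eq[OF g] by (simp add: tvs ev_codeT ev_addT)
  have t: "(?f, ?f) \<in> per (NN\<^sup>\<star> \<rightarrow> NN \<rightarrow> NN)" using ev_typed[OF tv, of ?b] by (simp add: tvs)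
  have "ap (VFold2 (N 0) ?f) (LL ss) = N (\<Sum>s\<leftarrow>ss. h (code s))" for ss
  proof (induction ss)
    case (Cons s ss)
    have "ap (VFold2 (N 0) ?f) (LL (s # ss)) = ap (ap ?f (L (map N s))) (ap (VFold2 (N 0) ?f) (LL ss))"
      using fold_Cons[OF _ t, of "N 0" "L (map N s)" "map (\<lambda>s. L (map N s)) ss"] list_N[of s] LL_rel[of ss] by simp
    then show ?case unfolding Cons f by simp
  qed simp
  moreover have "ap (ap (ev v countT) g) (N n) = ap (VFold2 (N 0) ?f) (LL (words n))"
    unfolding ev_closed_value[of countT v, OF countT_closed[THEN conjunct2, THEN conjunct2]] closed_value_def
    using gt by (simp add: countT_def Let_def tvs ev_wordsT)
  ultimately show ?thesis by simp
qed

section \<open>Soundness of arithmetic and logic\<close>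

text \<open>With a single state and no conditions, large means true. Facts about forcing thereby
  specialise to \<open>sat\<close>, and substitution and congruence need no second
  induction.\<close>

definition point_world :: world where
  "point_world = \<lparr>wcar = {N 0}, wrel = unitr, wpt = \<lambda>_. N 0, widx = {}, wcon = \<lambda>_ _. True\<rparr>"

lemma ok_point_world: "ok point_world" by (simp add: ok_def point_world_def)

lemma large_point_world: "large point_world Q \<longleftrightarrow> Q (N 0)"
proof
  assume "large point_world Q" then show "Q (N 0)" by (auto simp: large_def point_world_def)
next
  assume "Q (N 0)" then show "large point_world Q" by (intro large_all) (simp add: point_world_def)
qed

lemma internal_subst: "internal (subst x u \<phi>) \<longleftrightarrow> internal \<phi>"
  by (induction \<phi>) auto

lemma sat_subst:
  assumes "internal \<phi>" "wff \<phi>" "u \<triangleright> snd x" "free_for u x \<phi>" "tv v"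
  shows "sat v (subst x u \<phi>) \<longleftrightarrow> sat (v(x := ev v u)) \<phi>"
proof -
  have "typed_env point_world (\<lambda>_. v)" using assms(5) by (simp add: typed_env_def tv_def)
  from force_subst[OF assms(2-4) this] show ?thesis
    by (simp add: force_internal[OF ok_point_world] internal_subst assms(1) large_point_world)
qed

fun nval :: "val \<Rightarrow> nat" where "nval (N n) = n" | "nval _ = 0"

lemma fvt_maxvar: "x \<in> fvt t \<Longrightarrow> fst x \<le> maxvar t"
  by (induction t) auto

lemma fresh_notin: "fresh s t \<notin> fvt s" "fresh s t \<notin> fvt t" "snd (fresh s t) = NN"
  using fvt_maxvar[of "fresh s t" s] fvt_maxvar[of "fresh s t" t] by (auto simp: fresh_def)

lemma ev_upd_fresh: "x \<notin> fvt t \<Longrightarrow> ev (v(x := d)) t = ev v t"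
  by (rule ev_cong) (auto simp: fun_upd_apply)

lemma ev_nat: "tv v \<Longrightarrow> t \<triangleright> NN \<Longrightarrow> ev v t = N (nval (ev v t))"
  using ev_typed[of v t] by (auto simp: has_ty_def)

lemma sat_le:
  assumes "tv v" "s \<triangleright> NN" "t \<triangleright> NN"
  shows "sat v (s \<^bold>\<le> t) \<longleftrightarrow> nval (ev v s) \<le> nval (ev v t)"
proof -
  obtain a b where e: "ev v s = N a" "ev v t = N b" using ev_nat assms by blast
  have "sat v (s \<^bold>\<le> t) \<longleftrightarrow> (\<exists>c. a + c = b)"
    by (simp add: le_def Let_def fresh_notin ev_upd_fresh e ev_addT) (auto simp: ev_addT)
  then show ?thesis by (auto simp: e le_iff_add)
qed

lemma internal_le [simp]: "internal (s \<^bold>\<le> t)" by (simp add: le_def Let_def)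
lemma internal_mem [simp]: "internal (s \<^bold>\<in> t)" by (simp add: mem_def Let_def)

lemma sat_mem:
  assumes v: "tv v" and t: "t \<triangleright> \<sigma>" and s: "s \<triangleright> \<sigma>\<^sup>\<star>"
  shows "sat v (t \<^bold>\<in> s) \<longleftrightarrow> (\<exists>c\<in>els (ev v s). (ev v t, c) \<in> per \<sigma>)"
proof -
  let ?i = "fresh t s"
  have ty: "tyof t = \<sigma>" "wt t" "wt s" "tyof s = \<sigma>\<^sup>\<star>" using t s by (auto simp: has_ty_def)
  obtain l where l: "ev v s = L l" "(L l, L l) \<in> per (\<sigma>\<^sup>\<star>)"
    using ev_typed[OF v ty(3)] ty by (auto simp: listr_iff)
  have k: "sat (v(?i := N k)) (Su (Var ?i) \<^bold>\<le> lenT \<sigma> \<cdot> s) \<longleftrightarrow> k < length l" for k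
    using l by (subst sat_le) (auto simp: tv_upd v fresh_notin has_ty_def ty ev_upd_fresh ev_lenT)
  have "sat v (t \<^bold>\<in> s) \<longleftrightarrow> (\<exists>k. k < length l \<and> (ev v t, ap (ap (ev (v(?i := N k)) (nthT \<sigma>)) (L l)) (N k)) \<in> per \<sigma>)"
    by (auto simp: mem_def Let_def ty fresh_notin ev_upd_fresh l k)
  also have "\<dots> \<longleftrightarrow> (\<exists>k<length l. (ev v t, l ! k) \<in> per \<sigma>)"
    using ev_nthT[OF l(2)] by auto
  also have "\<dots> \<longleftrightarrow> (\<exists>c\<in>els (ev v s). (ev v t, c) \<in> per \<sigma>)"
    unfolding l els.simps by (metis in_set_conv_nth)
  finally show ?thesis .
qed

section \<open>Truth of the arithmetical axioms\<close>

lemma axEPA_internal: "\<phi> \<in> axEPA \<Longrightarrow> internal \<phi>"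
  by (induction rule: axEPA.induct) (auto simp: internal_subst)

lemma free_for_Suc: "free_for (Su (Var n)) n \<phi>"
  by (induction \<phi>) auto
lemma free_for_closed: "fvt u = {} \<Longrightarrow> free_for u n \<phi>"
  by (induction \<phi>) auto

lemma sat_refl: "wt t \<Longrightarrow> tv v \<Longrightarrow> sat v (t \<^bold>= t)" by (simp add: ev_typed)

lemma sat_eqI: "wt t \<Longrightarrow> tv v \<Longrightarrow> tyof s = tyof t \<Longrightarrow> ev v s = ev v t \<Longrightarrow> sat v (s \<^bold>= t)"
  by (simp add: ev_typed)

lemma axEPA_sat: "\<phi> \<in> axEPA \<Longrightarrow> tv v \<Longrightarrow> sat v \<phi>"
proof (induction rule: axEPA.induct)
  case (refl t) then show ?case by (rule sat_refl)
next
  case (sym s t) then show ?case by (auto intro: per_sym)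
next
  case (trans s t u) then show ?case by (auto intro: per_trans)
next
  case (cong f g s t)
  then obtain \<tau> where "tyof f = tyof s \<rightarrow> \<tau>" by auto
  then show ?case by (auto intro: fnD2)
next
  case (extensionality f x \<tau> g)
  have f: "(ev v f, ev v f) \<in> fn (per (snd x)) (per \<tau>)" and g: "(ev v g, ev v g) \<in> fn (per (snd x)) (per \<tau>)"
    using ev_typed[of v f] ev_typed[of v g] extensionality by (auto simp: has_ty_def)
  have ty: "tyof (f \<cdot> Var x) = \<tau>" "tyof f = snd x \<rightarrow> \<tau>" using extensionality by (auto simp: has_ty_def)
  have x: "x \<notin> fvt f" "x \<notin> fvt g" using extensionality by auto
  \<comment> \<open>The premise equates values at the same argument only; relatedness of
    \<open>ev v g\<close> to itself passes from an argument to a related one.\<close>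
  have "(ev v f, ev v g) \<in> fn (per (snd x)) (per \<tau>)" if h: "\<And>d. (d, d) \<in> per (snd x) \<Longrightarrow> (ap (ev v f) d, ap (ev v g) d) \<in> per \<tau>"
  proof (rule fnI)
    fix a b assume ab: "(a, b) \<in> per (snd x)"
    show "app (ev v f) a (ap (ev v f) a) \<and> app (ev v g) b (ap (ev v g) b) \<and> (ap (ev v f) a, ap (ev v g) b) \<in> per \<tau>"
      using fnD[OF f ab] fnD[OF g ab] per_trans[OF h[OF per_dom(1)[OF ab]]] by blast
  qed
  then show ?case using ty by (simp add: ev_upd_fresh[OF x(1)] ev_upd_fresh[OF x(2)])
next
  case (K s \<sigma> t \<tau>) then show ?case by (intro sat_eqI) (auto simp: has_ty_def)
next
  case (S s \<rho> \<sigma> \<tau> t u)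
  have s: "(ev v s, ev v s) \<in> fn (per \<rho>) (fn (per \<sigma>) (per \<tau>))" and t: "(ev v t, ev v t) \<in> fn (per \<rho>) (per \<sigma>)"
    and u: "(ev v u, ev v u) \<in> per \<rho>"
    using ev_typed[of v s] ev_typed[of v t] ev_typed[of v u] S by (auto simp: has_ty_def)
  note 1 = fnD[OF s u] and 2 = fnD[OF t u]
  note 3 = fnD[OF conjunct2[OF conjunct2[OF 1]] conjunct2[OF conjunct2[OF 2]]]
  have "ap (VS2 (ev v s) (ev v t)) (ev v u) = ap (ap (ev v s) (ev v u)) (ap (ev v t) (ev v u))"
    by (rule ap_S2[OF conjunct1[OF 1] conjunct1[OF 2] conjunct1[OF 3]])
  then show ?case using S by (intro sat_eqI) (auto simp: has_ty_def)
next
  case (rec_zero a \<rho> f) then show ?case by (intro sat_eqI) (auto simp: has_ty_def)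
next
  case (rec_succ a \<rho> f n)
  have "(ev v a, ev v a) \<in> per \<rho>" "(ev v f, ev v f) \<in> per (NN \<rightarrow> \<rho> \<rightarrow> \<rho>)"
    using ev_typed[of v a] ev_typed[of v f] rec_succ by (auto simp: has_ty_def)
  note 1 = rec_Suc[OF this]
  obtain k where k: "ev v n = N k" using ev_nat rec_succ by blast
  show ?case using rec_succ 1 by (intro sat_eqI) (auto simp: has_ty_def k)
next
  case (fold_nil a \<rho> f \<sigma>) then show ?case by (intro sat_eqI) (auto simp: has_ty_def)
next
  case (fold_cons a \<rho> f \<sigma> b s)
  have 0: "(ev v a, ev v a) \<in> per \<rho>" "(ev v f, ev v f) \<in> per (\<sigma> \<rightarrow> \<rho> \<rightarrow> \<rho>)" "(ev v b, ev v b) \<in> per \<sigma>"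
    "(ev v s, ev v s) \<in> per (\<sigma>\<^sup>\<star>)"
    using ev_typed[of v a] ev_typed[of v f] ev_typed[of v b] ev_typed[of v s] fold_cons by (auto simp: has_ty_def)
  then obtain l where l: "ev v s = L l" by (auto simp: listr_iff)
  show ?case using fold_cons fold_Cons[OF 0(1-3), of l] 0(4) by (intro sat_eqI) (auto simp: has_ty_def l)
next
  case (seq_cases t \<sigma> b s)
  obtain l where l: "ev v t = L l" "list_all2 (\<lambda>x y. (x, y) \<in> per \<sigma>) l l"
    using ev_typed[of v t] seq_cases by (auto simp: has_ty_def listr_iff)
  have ty: "tyof t = \<sigma>\<^sup>\<star>" using seq_cases by (simp add: has_ty_def)
  \<comment> \<open>The two variables differ because their types do: no type is its own sequence
    type.\<close>
  have bs: "b \<noteq> s" using seq_cases(2,3) by (induction \<sigma>) auto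
  show ?case
  proof (cases l)
    case Nil then show ?thesis by (simp add: l ty)
  next
    case (Cons x xs)
    have x: "(x, x) \<in> per \<sigma>" and xs: "list_all2 (\<lambda>x y. (x, y) \<in> per \<sigma>) xs xs" using l(2) Cons by auto
    have 1: "ev (v(b := x, s := L xs)) t = L l" using seq_cases l by (simp add: ev_upd_fresh)
    have 2: "(x, x) \<in> per (snd b)" "(L xs, L xs) \<in> per (snd s)" using x xs seq_cases by simp_all
    have "sat (v(b := x, s := L xs)) (t \<^bold>= cons \<sigma> (Var b) (Var s))" using x xs bs by (simp add: 1 ty Cons)
    then show ?thesis using 2 unfolding sat.simps by blast
  qed
next
  case (succ_nonzero t)
  obtain k where k: "ev v t = N k" using ev_nat succ_nonzero by blast
  then show ?case by simp
next
  case (succ_inj s t)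
  obtain k j where k: "ev v t = N k" "ev v s = N j" using ev_nat succ_inj by blast
  then show ?case using succ_inj by (simp add: has_ty_def)
next
  case (induction \<phi> n)
  have z: "sat v (subst n Ze \<phi>) \<longleftrightarrow> sat (v(n := N 0)) \<phi>"
    using sat_subst[of \<phi> Ze n v] induction by (auto simp: has_ty_def free_for_closed)
  have s: "sat (v(n := N k)) (subst n (Su (Var n)) \<phi>) \<longleftrightarrow> sat (v(n := N (Suc k))) \<phi>" for k
    using sat_subst[of \<phi> "Su (Var n)" n "v(n := N k)"] induction by (auto simp: has_ty_def free_for_Suc tv_upd)
  have "sat (v(n := N k)) \<phi>" if "sat (v(n := N 0)) \<phi>" "\<And>k. sat (v(n := N k)) \<phi> \<Longrightarrow> sat (v(n := N (Suc k))) \<phi>" for k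
    by (induction k) (use that in auto)
  moreover have "(d, d) \<in> per (snd n) \<longleftrightarrow> (\<exists>k. d = N k)" for d using induction(3) by auto
  ultimately show ?case by (simp add: z) (metis s)
qed

section \<open>Derived rules for the classical connectives and the standard quantifiers\<close>

abbreviation absurd :: "world \<Rightarrow> bool" where "absurd p \<equiv> large p (\<lambda>_. False)"

lemma absurd_force: "ok p \<Longrightarrow> absurd p \<Longrightarrow> force p E \<phi>"
proof (rule force_stable, assumption)
  fix q \<pi> assume "absurd p" "wle q \<pi> p"
  then show "absurd q" using large_wle[of q \<pi> p "\<lambda>_. False"] by blast
qed

text \<open>Inconsistency of an extension read positively: among finitely many new conditions listed
  by a program, one fails. In this form a refutation delivers candidates.\<close>

lemma absurd_ext:
  assumes ok: "ok p" and ty: "typed_by p C A k" and a: "absurd (ext p C A k S Q)"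
  shows "\<exists>Z1 Z2. computed p (fn A (conds p)) Z1 \<and> computed p (fn A (listr S)) Z2 \<and>
    (\<forall>w\<in>wcar p. \<forall>a\<in>C w. (meets p w (ap (Z1 w) (k a))) \<longrightarrow> (\<exists>x\<in>els (ap (Z2 w) (k a)). \<not> Q w a x))"
proof (rule large_ext[OF ok ty a])
  fix Z1 Z2 assume 1: "computed p (fn A (conds p)) Z1" "computed p (fn A (listr S)) Z2"
    and 2: "\<And>w a. w \<in> wcar p \<Longrightarrow> a \<in> C w \<Longrightarrow> (meets p w (ap (Z1 w) (k a))) \<Longrightarrow>
      (\<forall>x\<in>els (ap (Z2 w) (k a)). Q w a x) \<Longrightarrow> False"
  have "\<exists>x\<in>els (ap (Z2 w) (k a)). \<not> Q w a x"
    if "w \<in> wcar p" "a \<in> C w" "meets p w (ap (Z1 w) (k a))" for w a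
    using 2[OF that] by blast
  then show ?thesis using 1 by blast
qed

lemma absurd_ext0:
  assumes ok: "ok p" and a: "absurd (ext p C unitr (\<lambda>_. N 0) S Q)"
  shows "\<exists>Z1 Z2. computed p (conds p) Z1 \<and> computed p (listr S) Z2 \<and>
    (\<forall>w\<in>wcar p. \<forall>a\<in>C w. (meets p w (Z1 w)) \<longrightarrow> (\<exists>x\<in>els (Z2 w). \<not> Q w a x))"
proof (rule large_ext0[OF ok a])
  fix Z1 Z2 assume 1: "computed p (conds p) Z1" "computed p (listr S) Z2"
    and 2: "\<And>w a. w \<in> wcar p \<Longrightarrow> a \<in> C w \<Longrightarrow> (meets p w (Z1 w)) \<Longrightarrow>
      (\<forall>x\<in>els (Z2 w). Q w a x) \<Longrightarrow> False"
  have "\<exists>x\<in>els (Z2 w). \<not> Q w a x"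
    if "w \<in> wcar p" "a \<in> C w" "meets p w (Z1 w)" for w a
    using 2[OF that] by blast
  then show ?thesis using 1 by blast
qed

text \<open>A standard object may be assumed to be computed exactly, although only a finite list of candidates is
  given: the lists obtained for the single candidates are concatenated.\<close>

lemma St_elim:
  assumes ok: "ok p" and "force p E (St t)"
    and h: "\<And>q \<pi> k. wle q \<pi> p \<Longrightarrow> computed q (per (tyof t)) k \<Longrightarrow>
      (\<And>w. w \<in> wcar q \<Longrightarrow> (k w, ev (E (\<pi> w)) t) \<in> per (tyof t)) \<Longrightarrow> force q (\<lambda>w. E (\<pi> w)) \<phi>"
  shows "force p E \<phi>"
proof (rule force_stable[OF ok])
  fix q \<pi> assume q: "wle q \<pi> p" and a: "\<And>r \<rho>. wle r \<rho> q \<Longrightarrow> force r (\<lambda>w. E (\<pi> (\<rho> w))) \<phi> \<Longrightarrow> absurd r"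
  note okq = wle_ok[OF q]
  let ?\<sigma> = "per (tyof t)"
  obtain l where l: "computed q (listr ?\<sigma>) l" "large q (\<lambda>w. \<exists>c\<in>els (l w). (c, ev (E (\<pi> w)) t) \<in> ?\<sigma>)"
    using force_mono[OF assms(2) q] unfolding force_St[OF okq] by blast
  \<comment> \<open>A value equal to \<open>t\<close> is adjoined as visible data, the situation
    covered by the hypothesis \<open>h\<close>. As \<open>\<phi>\<close> is refuted below
    \<open>q\<close>, this extension is inconsistent.\<close>
  let ?C = "\<lambda>w. {k. (k, ev (E (\<pi> w)) t) \<in> ?\<sigma>}"
  have ty: "typed_by q ?C ?\<sigma> (\<lambda>a. a)" unfolding typed_by_def using per_dom(1) by blast
  let ?u = "ext q ?C ?\<sigma> (\<lambda>a. a) {} (\<lambda>_ _ _. True)"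
  have u: "wle ?u vfst q" by (rule wle_ext[OF okq ty])
  have "force ?u (\<lambda>w. E (\<pi> (vfst w))) \<phi>"
    by (rule h[OF wle_trans[OF u q] computed_var]) auto
  then have "absurd ?u" by (rule a[OF u])
  from absurd_ext[OF okq ty this] obtain Z1 where Z1: "computed q (fn ?\<sigma> (conds q)) Z1"
    and Z1': "\<forall>w\<in>wcar q. \<forall>a\<in>?C w. \<not> (meets q w (ap (Z1 w) a))"
    by blast
  \<comment> \<open>\<open>Z1\<close> yields contradictory conditions at any correct value, and some
    candidate in \<open>l\<close> is correct; so the conditions for all candidates are
    collected.\<close>
  obtain m where m: "computed q (conds q) m" "\<And>w. w \<in> wcar q \<Longrightarrow> els (m w) = (\<Union>x\<in>els (l w). els (ap (Z1 w) x))"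
    by (rule computed_bind[OF okq l(1) Z1]) blast
  have "large q (\<lambda>w. \<not> (\<exists>c\<in>els (l w). (c, ev (E (\<pi> w)) t) \<in> ?\<sigma>))"
  proof (rule largeI[OF m(1)], rule notI, erule bexE)
    fix w c assume w: "w \<in> wcar q" "meets q w (m w)" and c: "c \<in> els (l w)" "(c, ev (E (\<pi> w)) t) \<in> ?\<sigma>"
    have "meets q w (ap (Z1 w) c)" using w(2) c(1) unfolding m(2)[OF w(1)] by blast
    then show False using Z1' w(1) c(2) by blast
  qed
  from large_conj[OF okq l(2) this] show "absurd q" by (rule large_mono) blast
qed

lemma computed_single: "ok p \<Longrightarrow> computed p A k \<Longrightarrow> computed p (listr A) (\<lambda>w. L [k w])"
  using computed_app[OF _ computed_app[OF _ computed_const[OF VCons_rel]], of p A k "\<lambda>_. L []"] computed_const[of "L []" "listr A" p] by simp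

lemma St_intro:
  assumes ok: "ok p" and "computed p (per (tyof t)) k" "large p (\<lambda>w. (k w, ev (E w) t) \<in> per (tyof t))"
  shows "force p E (St t)"
  unfolding force_St[OF ok] using computed_single[OF ok assms(2)] assms(3) by (intro exI[of _ "\<lambda>w. L [k w]"]) simp

text \<open>Conjunction abbreviates a negated implication, so recovering a conjunct needs
  stability.\<close>

lemma force_And: assumes ok: "ok p" shows "force p E (\<phi> \<^bold>\<and> \<psi>) \<longleftrightarrow> force p E \<phi> \<and> force p E \<psi>"
proof
  assume f: "force p E (\<phi> \<^bold>\<and> \<psi>)"
  have 1: "force p E \<phi>"
  proof (rule force_stable[OF ok])
    fix q \<pi> assume q: "wle q \<pi> p" and a: "\<And>r \<rho>. wle r \<rho> q \<Longrightarrow> force r (\<lambda>w. E (\<pi> (\<rho> w))) \<phi> \<Longrightarrow> absurd r"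
    have "force q (\<lambda>w. E (\<pi> w)) (\<phi> \<^bold>\<longrightarrow> \<^bold>\<not> \<psi>)"
      by (rule force_ImpI[OF wle_ok[OF q]]) (use a absurd_force wle_ok in blast)
    then have "force q (\<lambda>w. E (\<pi> w)) Bot" by (rule force_ImpD[OF f q])
    then show "absurd q" using force_Bot[OF wle_ok[OF q]] by blast
  qed
  have 2: "force p E \<psi>"
  proof (rule force_stable[OF ok])
    fix q \<pi> assume q: "wle q \<pi> p" and a: "\<And>r \<rho>. wle r \<rho> q \<Longrightarrow> force r (\<lambda>w. E (\<pi> (\<rho> w))) \<psi> \<Longrightarrow> absurd r"
    have "force q (\<lambda>w. E (\<pi> w)) (\<phi> \<^bold>\<longrightarrow> \<^bold>\<not> \<psi>)"
    proof (rule force_ImpI[OF wle_ok[OF q]], rule force_ImpI, erule wle_ok)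
      fix r \<rho> s \<theta> assume r: "wle r \<rho> q" and s: "wle s \<theta> r" and "force s (\<lambda>w. E (\<pi> (\<rho> (\<theta> w)))) \<psi>"
      then have "absurd s" by (intro a[OF wle_trans[OF s r]])
      then show "force s (\<lambda>w. E (\<pi> (\<rho> (\<theta> w)))) Bot" by (rule absurd_force[OF wle_ok[OF s]])
    qed
    then have "force q (\<lambda>w. E (\<pi> w)) Bot" by (rule force_ImpD[OF f q])
    then show "absurd q" using force_Bot[OF wle_ok[OF q]] by blast
  qed
  show "force p E \<phi> \<and> force p E \<psi>" using 1 2 by blast
next
  assume f: "force p E \<phi> \<and> force p E \<psi>"
  show "force p E (\<phi> \<^bold>\<and> \<psi>)"
  proof (rule force_ImpI[OF ok])
    fix q \<pi> assume q: "wle q \<pi> p" and i: "force q (\<lambda>w. E (\<pi> w)) (\<phi> \<^bold>\<longrightarrow> \<^bold>\<not> \<psi>)"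
    note r = wle_refl[OF wle_ok[OF q]]
    have "force q (\<lambda>w. E (\<pi> w)) (\<^bold>\<not> \<psi>)" by (rule force_ImpD[OF i r]) (use f force_mono[OF _ q] in blast)
    then show "force q (\<lambda>w. E (\<pi> w)) Bot" by (rule force_ImpD[OF _ r]) (use f force_mono[OF _ q] in blast)
  qed
qed

lemma typed_envD: "typed_env p E \<Longrightarrow> w \<in> wcar p \<Longrightarrow> (E w y, E w y) \<in> per (snd y)"
  unfolding typed_env_def by blast

lemma Exists_intro:
  assumes ok: "ok p" and c: "\<And>w. w \<in> wcar p \<Longrightarrow> (c w, c w) \<in> per (snd x)" and f: "force p (\<lambda>w. (E w)(x := c w)) \<phi>"
  shows "force p E (Exists x \<phi>)"
proof (rule force_ImpI[OF ok])
  fix q \<pi> assume q: "wle q \<pi> p" and a: "force q (\<lambda>w. E (\<pi> w)) (Forall x (\<^bold>\<not> \<phi>))"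
  note r = wle_refl[OF wle_ok[OF q]]
  have "force q (\<lambda>w. (E (\<pi> w))(x := c (\<pi> w))) (\<^bold>\<not> \<phi>)"
    by (rule force_ForallD[OF a r]) (use c wle_car[OF q] in blast)
  from force_ImpD[OF this r force_mono[OF f q]]
  have "absurd q" using force_Bot[OF wle_ok[OF q]] by blast
  then show "force q (\<lambda>w. E (\<pi> w)) Bot" by (rule absurd_force[OF wle_ok[OF q]])
qed

text \<open>The classical existential quantifier provides witnesses only in extensions, which is
  enough when the goal is inconsistency.\<close>

lemma Exists_elim:
  assumes ok: "ok p" and f: "force p E (Exists x \<phi>)"
    and h: "\<And>q \<pi> c. wle q \<pi> p \<Longrightarrow> (\<And>w. w \<in> wcar q \<Longrightarrow> (c w, c w) \<in> per (snd x)) \<Longrightarrow>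
      force q (\<lambda>w. (E (\<pi> w))(x := c w)) \<phi> \<Longrightarrow> absurd q"
  shows "absurd p"
proof -
  have "force p E (Forall x (\<^bold>\<not> \<phi>))"
  proof (rule force_ForallI[OF ok], rule force_ImpI, erule wle_ok)
    fix q \<pi> c r \<rho> assume q: "wle q \<pi> p" and c: "\<And>w. w \<in> wcar q \<Longrightarrow> (c w, c w) \<in> per (snd x)"
      and r: "wle r \<rho> q" and "force r (\<lambda>w. (E (\<pi> (\<rho> w)))(x := c (\<rho> w))) \<phi>"
    then have "absurd r" using c[OF wle_car[OF r]] by (intro h[OF wle_trans[OF r q], of "\<lambda>w. c (\<rho> w)"])
    then show "force r (\<lambda>w. (E (\<pi> (\<rho> w)))(x := c (\<rho> w))) Bot" by (rule absurd_force[OF wle_ok[OF r]])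
  qed
  from force_ImpD[OF f wle_refl[OF ok] this] show ?thesis using force_Bot[OF ok] by blast
qed

text \<open>\<open>St_elim\<close> supplies a value that a program computes exactly, and
  \<open>force_cong\<close> passes from it to the extensionally equal original one.\<close>

lemma Forallst_I:
  assumes ok: "ok p" and wf: "wff \<phi>" and typed_env: "typed_env p E"
    and h: "\<And>q \<pi> k. wle q \<pi> p \<Longrightarrow> computed q (per (snd x)) k \<Longrightarrow> force q (\<lambda>w. (E (\<pi> w))(x := k w)) \<phi>"
  shows "force p E (Forallst x \<phi>)"
proof (rule force_ForallI[OF ok], rule force_ImpI, erule wle_ok)
  fix q \<pi> c r \<rho> assume q: "wle q \<pi> p" and c: "\<And>w. w \<in> wcar q \<Longrightarrow> (c w, c w) \<in> per (snd x)"
    and r: "wle r \<rho> q" and st: "force r (\<lambda>w. (E (\<pi> (\<rho> w)))(x := c (\<rho> w))) (St (Var x))"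
  show "force r (\<lambda>w. (E (\<pi> (\<rho> w)))(x := c (\<rho> w))) \<phi>"
  proof (rule St_elim[OF wle_ok[OF r] st])
    fix s \<theta> k assume s: "wle s \<theta> r" and k: "computed s (per (tyof (Var x))) k"
      and e: "\<And>w. w \<in> wcar s \<Longrightarrow> (k w, ev ((E (\<pi> (\<rho> (\<theta> w))))(x := c (\<rho> (\<theta> w)))) (Var x)) \<in> per (tyof (Var x))"
    note sp = wle_trans[OF s wle_trans[OF r q]]
    have f: "force s (\<lambda>w. (E (\<pi> (\<rho> (\<theta> w))))(x := k w)) \<phi>" by (rule h[OF sp]) (use k in simp)
    show "force s (\<lambda>w. (E (\<pi> (\<rho> (\<theta> w))))(x := c (\<rho> (\<theta> w)))) \<phi>"
    proof (rule force_cong[OF wf _ f])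
      fix w y assume w: "w \<in> wcar s"
      show "(((E (\<pi> (\<rho> (\<theta> w))))(x := k w)) y, ((E (\<pi> (\<rho> (\<theta> w))))(x := c (\<rho> (\<theta> w)))) y) \<in> per (snd y)"
        using e[OF w] typed_envD[OF typed_env_wle[OF typed_env sp] w, of y] by (cases "y = x") simp_all
    qed
  qed
qed

lemma force_St_var: "ok p \<Longrightarrow> computed p (per (snd x)) k \<Longrightarrow> force p (\<lambda>w. (E w)(x := k w)) (St (Var x))"
  by (rule St_intro[where k = k]) (auto intro!: large_all intro: computed_typed)

lemma Forallst_D:
  assumes f: "force p E (Forallst x \<phi>)" and q: "wle q \<pi> p" and k: "computed q (per (snd x)) k"
  shows "force q (\<lambda>w. (E (\<pi> w))(x := k w)) \<phi>"
proof -
  note ok = wle_ok[OF q]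
  have "force q (\<lambda>w. (E (\<pi> w))(x := k w)) (St (Var x) \<^bold>\<longrightarrow> \<phi>)"
    by (rule force_ForallD[OF f q]) (rule computed_typed[OF ok k])
  then show ?thesis by (rule force_ImpD[OF _ wle_refl[OF ok] force_St_var[OF ok k]])
qed

lemma Existsst_I:
  assumes ok: "ok p" and k: "computed p (per (snd x)) k" and f: "force p (\<lambda>w. (E w)(x := k w)) \<phi>"
  shows "force p E (Existsst x \<phi>)"
  by (rule Exists_intro[OF ok computed_typed[OF ok k]]) (auto simp: force_And[OF ok] f force_St_var[OF ok k])

lemma Existsst_E:
  assumes ok: "ok p" and wf: "wff \<phi>" and typed_env: "typed_env p E" and f: "force p E (Existsst x \<phi>)"
    and h: "\<And>q \<pi> k. wle q \<pi> p \<Longrightarrow> computed q (per (snd x)) k \<Longrightarrow> force q (\<lambda>w. (E (\<pi> w))(x := k w)) \<phi> \<Longrightarrow> absurd q"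
  shows "absurd p"
proof (rule Exists_elim[OF ok f])
  fix q \<pi> c assume q: "wle q \<pi> p" and c: "\<And>w. w \<in> wcar q \<Longrightarrow> (c w, c w) \<in> per (snd x)"
    and "force q (\<lambda>w. (E (\<pi> w))(x := c w)) (St (Var x) \<^bold>\<and> \<phi>)"
  then have st: "force q (\<lambda>w. (E (\<pi> w))(x := c w)) (St (Var x))" and g: "force q (\<lambda>w. (E (\<pi> w))(x := c w)) \<phi>"
    using force_And[OF wle_ok[OF q]] by blast+
  have "force q (\<lambda>w. (E (\<pi> w))(x := c w)) Bot"
  proof (rule St_elim[OF wle_ok[OF q] st])
    fix r \<rho> k assume r: "wle r \<rho> q" and k: "computed r (per (tyof (Var x))) k"
      and e: "\<And>w. w \<in> wcar r \<Longrightarrow> (k w, ev ((E (\<pi> (\<rho> w)))(x := c (\<rho> w))) (Var x)) \<in> per (tyof (Var x))"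
    note rp = wle_trans[OF r q]
    have "force r (\<lambda>w. (E (\<pi> (\<rho> w)))(x := k w)) \<phi>"
    proof (rule force_cong[OF wf _ force_mono[OF g r]])
      fix w y assume w: "w \<in> wcar r"
      show "(((E (\<pi> (\<rho> w)))(x := c (\<rho> w))) y, ((E (\<pi> (\<rho> w)))(x := k w)) y) \<in> per (snd y)"
        using per_sym[OF e[OF w]] typed_envD[OF typed_env_wle[OF typed_env rp] w, of y] by (cases "y = x") simp_all
    qed
    then have "absurd r" by (intro h[OF rp]) (use k in simp_all)
    then show "force r (\<lambda>w. (E (\<pi> (\<rho> w)))(x := c (\<rho> w))) Bot" by (rule absurd_force[OF wle_ok[OF r]])
  qed
  then show "absurd q" using force_Bot[OF wle_ok[OF q]] by blast
qed

definition valid :: "fm \<Rightarrow> bool" where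
  "valid \<phi> \<longleftrightarrow> (\<forall>p E. ok p \<longrightarrow> typed_env p E \<longrightarrow> force p E \<phi>)"

lemma valid_ImpI:
  assumes "\<And>p E. ok p \<Longrightarrow> typed_env p E \<Longrightarrow> force p E \<phi> \<Longrightarrow> force p E \<psi>"
  shows "valid (\<phi> \<^bold>\<longrightarrow> \<psi>)"
  unfolding valid_def
  by (intro allI impI force_ImpI, assumption) (use assms wle_ok typed_env_wle in blast)

lemma soundness:
  assumes ax: "\<And>\<phi>. \<phi> \<in> \<Gamma> \<Longrightarrow> wff \<phi> \<Longrightarrow> valid \<phi>" and "\<Gamma> \<turnstile> \<phi>"
  shows "valid \<phi>"
  using assms(2)
proof (induction rule: derives.induct)
  case (ax \<phi>) then show ?case using assms(1) by blast
next
  case (imp1 \<phi> \<psi>)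
  show ?case
  proof (rule valid_ImpI)
    fix p E assume ok: "ok p" and f: "force p E \<phi>"
    show "force p E (\<psi> \<^bold>\<longrightarrow> \<phi>)" by (intro force_ImpI[OF ok] force_mono[OF f])
  qed
next
  case (imp2 \<phi> \<psi> \<chi>)
  show ?case
  proof (rule valid_ImpI)
    fix p E assume ok: "ok p" and f: "force p E (\<phi> \<^bold>\<longrightarrow> \<psi> \<^bold>\<longrightarrow> \<chi>)"
    show "force p E ((\<phi> \<^bold>\<longrightarrow> \<psi>) \<^bold>\<longrightarrow> \<phi> \<^bold>\<longrightarrow> \<chi>)"
    proof (rule force_ImpI[OF ok], rule force_ImpI, erule wle_ok)
      fix q \<pi> r \<rho> assume q: "wle q \<pi> p" and g: "force q (\<lambda>w. E (\<pi> w)) (\<phi> \<^bold>\<longrightarrow> \<psi>)"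
        and r: "wle r \<rho> q" and h: "force r (\<lambda>w. E (\<pi> (\<rho> w))) \<phi>"
      show "force r (\<lambda>w. E (\<pi> (\<rho> w))) \<chi>"
        by (rule force_ImpD[OF force_ImpD[OF f wle_trans[OF r q] h] wle_refl[OF wle_ok[OF r]] force_ImpD[OF g r h]])
    qed
  qed
next
  case (dneg \<phi>)
  show ?case
  proof (rule valid_ImpI, rule force_stable, assumption)
    fix p E q \<pi> assume f: "force p E (\<^bold>\<not> (\<^bold>\<not> \<phi>))" and q: "wle q \<pi> p"
      and a: "\<And>r \<rho>. wle r \<rho> q \<Longrightarrow> force r (\<lambda>w. E (\<pi> (\<rho> w))) \<phi> \<Longrightarrow> absurd r"
    have "force q (\<lambda>w. E (\<pi> w)) (\<^bold>\<not> \<phi>)"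
      by (rule force_ImpI[OF wle_ok[OF q]]) (use a absurd_force wle_ok in blast)
    from force_ImpD[OF f q this] show "absurd q" using force_Bot[OF wle_ok[OF q]] by blast
  qed
next
  case (all_inst \<phi> u x)
  show ?case
  proof (rule valid_ImpI)
    fix p E assume ok: "ok p" and t: "typed_env p E" and f: "force p E (Forall x \<phi>)"
    have "(ev (E w) u, ev (E w) u) \<in> per (snd x)" if "w \<in> wcar p" for w
      using ev_typed[of "E w" u] t that all_inst(2) by (auto simp: typed_env_def tv_def has_ty_def)
    then have "force p (\<lambda>w. (E w)(x := ev (E w) u)) \<phi>" by (rule force_ForallD[OF f wle_refl[OF ok]])
    then show "force p E (subst x u \<phi>)" using force_subst[OF all_inst(1-3) t] by blast
  qed
next
  case (all_dist \<phi> \<psi> x)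
  show ?case
  proof (rule valid_ImpI)
    fix p E assume ok: "ok p" and t: "typed_env p E" and f: "force p E (Forall x (\<phi> \<^bold>\<longrightarrow> \<psi>))"
    show "force p E (\<phi> \<^bold>\<longrightarrow> Forall x \<psi>)"
    proof (rule force_ImpI[OF ok], rule force_ForallI, erule wle_ok)
      fix q \<pi> r \<rho> c assume q: "wle q \<pi> p" and g: "force q (\<lambda>w. E (\<pi> w)) \<phi>" and r: "wle r \<rho> q"
        and c: "\<And>w. w \<in> wcar r \<Longrightarrow> (c w, c w) \<in> per (snd x)"
      have i: "force r (\<lambda>w. (E (\<pi> (\<rho> w)))(x := c w)) (\<phi> \<^bold>\<longrightarrow> \<psi>)"
        by (rule force_ForallD[OF f wle_trans[OF r q] c])
      have "force r (\<lambda>w. (E (\<pi> (\<rho> w)))(x := c w)) \<phi>"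
      proof (rule force_cong[OF all_dist(1) _ force_mono[OF g r]])
        fix w y assume w: "w \<in> wcar r" and "y \<in> fv \<phi>"
        then have "y \<noteq> x" using all_dist(3) by blast
        then show "(E (\<pi> (\<rho> w)) y, ((E (\<pi> (\<rho> w)))(x := c w)) y) \<in> per (snd y)"
          using typed_envD[OF typed_env_wle[OF t wle_trans[OF r q]] w, of y] by simp
      qed
      then show "force r (\<lambda>w. (E (\<pi> (\<rho> w)))(x := c w)) \<psi>"
        by (rule force_ImpD[OF i wle_refl[OF wle_ok[OF r]]])
    qed
  qed
next
  case (mp \<phi> \<psi>)
  then show ?case unfolding valid_def using force_ImpD[OF _ wle_refl] by blast
next
  case (gen \<phi> x)
  show ?case unfolding valid_def
  proof (intro allI impI, rule force_ForallI, assumption)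
    fix p E q \<pi> c assume "typed_env p E" "wle q \<pi> p" "\<And>w. w \<in> wcar q \<Longrightarrow> (c w, c w) \<in> per (snd x)"
    then show "force q (\<lambda>w. (E (\<pi> w))(x := c w)) \<phi>"
      using gen.IH wle_ok typed_env_upd[OF typed_env_wle] unfolding valid_def by blast
  qed
qed

section \<open>The axioms of P and the transfer principle\<close>

lemma typed_env_tv: "typed_env p E \<Longrightarrow> w \<in> wcar p \<Longrightarrow> tv (E w)"
  unfolding typed_env_def tv_def by blast

lemma valid_internal:
  assumes "internal \<phi>" "\<And>v. tv v \<Longrightarrow> sat v \<phi>" shows "valid \<phi>"
  unfolding valid_def
proof (intro allI impI)
  fix p E assume "ok p" "typed_env p E"
  then show "force p E \<phi>" using assms(2) typed_env_tv by (simp add: force_internal assms(1) large_all)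
qed

lemma sat_cong:
  assumes "internal \<phi>" "wff \<phi>" "\<And>x. x \<in> fv \<phi> \<Longrightarrow> (v x, v' x) \<in> per (snd x)" "sat v \<phi>"
  shows "sat v' \<phi>"
proof -
  have "force point_world (\<lambda>_. v) \<phi>" using assms by (simp add: force_internal[OF ok_point_world] large_point_world)
  then have "force point_world (\<lambda>_. v') \<phi>" by (rule force_cong[OF assms(2) assms(3), rotated])
  then show ?thesis using assms(1) by (simp add: force_internal[OF ok_point_world] large_point_world)
qed

lemma wle_list:
  assumes le: "wle q \<pi> p" and l: "computed q (conds p) l"
  shows "large q (\<lambda>w. meets p (\<pi> w) (l w))"
proof -
  note ok = wle_ok[OF le]
  obtain Y where Y: "computed q (fn unitr (conds p)) Y" "\<And>w a. w \<in> wcar q \<Longrightarrow> (a, a) \<in> unitr \<Longrightarrow> ap (Y w) a = l w"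
    by (rule computed_drop[OF ok l]) blast
  obtain Z' where Z': "computed q (fn unitr (conds q)) Z'"
    "\<And>w x z. w \<in> wcar q \<Longrightarrow> (x, x) \<in> unitr \<Longrightarrow> (meets q w (ap (Z' w) x)) \<Longrightarrow> z \<in> els (ap (Y w) x) \<Longrightarrow>
       wcon p (\<pi> w) z"
    by (rule computed_transport[OF le Y(1)]) blast
  have n: "(N 0, N 0) \<in> unitr" by simp
  show ?thesis
  proof (rule large_fn[OF ok Z'(1)], rule ballI)
    fix w z assume w: "w \<in> wcar q" and c: "meets q w (ap (Z' w) (N 0))" and z: "z \<in> els (l w)"
    show "wcon p (\<pi> w) z" by (rule Z'(2)[OF w n c]) (simp add: Y(2)[OF w n] z)
  qed
qed

lemma valid_st_eq: "wff (s \<^bold>= t) \<Longrightarrow> valid (St s \<^bold>\<and> s \<^bold>= t \<^bold>\<longrightarrow> St t)"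
proof (rule valid_ImpI)
  fix p E assume wf: "wff (s \<^bold>= t)" and ok: "ok p" and f: "force p E (St s \<^bold>\<and> s \<^bold>= t)"
  have ty: "tyof t = tyof s" using wf by simp
  obtain l where l: "computed p (listr (per (tyof s))) l" "large p (\<lambda>w. \<exists>c\<in>els (l w). (c, ev (E w) s) \<in> per (tyof s))"
    using f unfolding force_And[OF ok] force_St[OF ok] by blast
  have e: "large p (\<lambda>w. (ev (E w) s, ev (E w) t) \<in> per (tyof s))"
    using f unfolding force_And[OF ok] force_Eq[OF ok] by blast
  have "large p (\<lambda>w. \<exists>c\<in>els (l w). (c, ev (E w) t) \<in> per (tyof s))"
    by (rule large_mono[OF large_conj[OF ok l(2) e]]) (use per_trans in blast)
  then show "force p E (St t)" unfolding force_St[OF ok] ty using l(1) by blast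
qed

lemma valid_st_closed: "wt t \<Longrightarrow> fvt t = {} \<Longrightarrow> valid (St t)"
  unfolding valid_def
  by (intro allI impI St_intro[where k = "\<lambda>_. closed_value t"] computed_const closed_value_rel large_all) (simp_all add: ev_closed_value closed_value_rel)

lemma valid_st_app: "wt (f \<cdot> s) \<Longrightarrow> valid (St f \<^bold>\<and> St s \<^bold>\<longrightarrow> St (f \<cdot> s))"
proof (rule valid_ImpI)
  fix p E assume wf: "wt (f \<cdot> s)" and ok: "ok p" and f: "force p E (St f \<^bold>\<and> St s)"
  obtain \<tau> where ty: "tyof f = tyof s \<rightarrow> \<tau>" using wf by auto
  have sf: "force p E (St f)" "force p E (St s)" using f unfolding force_And[OF ok] by blast+
  show "force p E (St (f \<cdot> s))"
  proof (rule St_elim[OF ok sf(1)])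
    fix q \<pi> k assume q: "wle q \<pi> p" and k: "computed q (per (tyof f)) k"
      and ke: "\<And>w. w \<in> wcar q \<Longrightarrow> (k w, ev (E (\<pi> w)) f) \<in> per (tyof f)"
    show "force q (\<lambda>w. E (\<pi> w)) (St (f \<cdot> s))"
    proof (rule St_elim[OF wle_ok[OF q] force_mono[OF sf(2) q]])
      fix r \<rho> j assume r: "wle r \<rho> q" and j: "computed r (per (tyof s)) j"
        and je: "\<And>w. w \<in> wcar r \<Longrightarrow> (j w, ev (E (\<pi> (\<rho> w))) s) \<in> per (tyof s)"
      have c: "computed r (per \<tau>) (\<lambda>w. ap (k (\<rho> w)) (j w))"
        by (rule computed_app[OF wle_ok[OF r] computed_wle[OF r k[unfolded ty per.simps]] j])
      show "force r (\<lambda>w. E (\<pi> (\<rho> w))) (St (f \<cdot> s))"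
      proof (rule St_intro[OF wle_ok[OF r], of _ "\<lambda>w. ap (k (\<rho> w)) (j w)"])
        show "computed r (per (tyof (f \<cdot> s))) (\<lambda>w. ap (k (\<rho> w)) (j w))" using c ty by simp
        show "large r (\<lambda>w. (ap (k (\<rho> w)) (j w), ev (E (\<pi> (\<rho> w))) (f \<cdot> s)) \<in> per (tyof (f \<cdot> s)))"
        proof (rule large_all)
          fix w assume w: "w \<in> wcar r"
          have "(ap (k (\<rho> w)) (j w), ap (ev (E (\<pi> (\<rho> w))) f) (ev (E (\<pi> (\<rho> w))) s)) \<in> per \<tau>"
            by (rule fnD2[OF ke[OF wle_car[OF r w], unfolded ty per.simps] je[OF w]])
          then show "(ap (k (\<rho> w)) (j w), ev (E (\<pi> (\<rho> w))) (f \<cdot> s)) \<in> per (tyof (f \<cdot> s))" using ty by simp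
        qed
      qed
    qed
  qed
qed

text \<open>The realizers are iterated with the recursor; the second recursion collects the finitely many
  conditions used along the way, which depend on the challenges passed down.\<close>

lemma ext_induct:
  assumes ok: "ok q" and wf: "wff \<phi>" and n: "snd n = NN" and t: "typed_env q E"
    and base: "force q (\<lambda>w. (E w)(n := N 0)) \<phi>"
    and step: "force (gen q natr) (\<lambda>u. (E (vfst u))(n := vsnd u)) (\<phi> \<^bold>\<longrightarrow> subst n (Su (Var n)) \<phi>)"
    and k: "computed q natr k"
  shows "force q (\<lambda>w. (E w)(n := k w)) \<phi>"
proof -
  let ?g = "gen q natr" and ?A = "witness \<phi>" and ?S = "challenge \<phi>" and ?W = "widx q"
  note okg = ok_gen[OF ok, of natr]
  have su: "witness (subst n (Su (Var n)) \<phi>) = ?A" "challenge (subst n (Su (Var n)) \<phi>) = ?S"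
    using subst_witness_challenge[of "Su (Var n)" n \<phi>] n by auto
  obtain Y0 Z0 where Y0: "computed q ?A Y0" and Z0: "computed q (fn ?S (listr ?W)) Z0"
    and h0: "\<And>w x. w \<in> wcar q \<Longrightarrow> (x, x) \<in> ?S \<Longrightarrow> (meets q w (ap (Z0 w) x)) \<Longrightarrow> realizes \<phi> ((E w)(n := N 0)) (Y0 w) x"
    by (rule forceE[OF base]) blast
  obtain Y Z where Y: "computed ?g (prodr (fn ?A ?A) (fn ?A (fn ?S (listr ?S)))) Y" and Z: "computed ?g (fn (prodr ?A ?S) (listr (sumr ?W {}))) Z"
    and h: "\<And>u x. u \<in> wcar ?g \<Longrightarrow> (x, x) \<in> prodr ?A ?S \<Longrightarrow> (meets ?g u (ap (Z u) x)) \<Longrightarrow>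
      realizes (\<phi> \<^bold>\<longrightarrow> subst n (Su (Var n)) \<phi>) ((E (vfst u))(n := vsnd u)) (Y u) x"
    by (rule forceE[OF step]) (simp add: su)
  obtain f1 where f1: "computed q (fn natr (fn ?A ?A)) f1" "\<And>w a. w \<in> wcar q \<Longrightarrow> (a, a) \<in> natr \<Longrightarrow> ap (f1 w) a = vfst (Y (Pr w a))"
    by (rule computed_lam[OF ok computed_fst[OF okg Y]]) blast
  obtain G1 where G1: "computed q (fn natr (fn ?A (fn ?S (listr ?S)))) G1"
    "\<And>w a. w \<in> wcar q \<Longrightarrow> (a, a) \<in> natr \<Longrightarrow> ap (G1 w) a = vsnd (Y (Pr w a))"
    by (rule computed_lam[OF ok computed_snd[OF okg Y]]) blast
  obtain Z1 where Z1: "computed q (fn natr (fn (prodr ?A ?S) (listr (sumr ?W {})))) Z1"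
    "\<And>w a. w \<in> wcar q \<Longrightarrow> (a, a) \<in> natr \<Longrightarrow> ap (Z1 w) a = Z (Pr w a)"
    by (rule computed_lam[OF ok Z]) blast
  obtain Z2 where Z2: "computed q (fn natr (fn (prodr ?A ?S) (listr ?W))) Z2"
    "\<And>w a b. w \<in> wcar q \<Longrightarrow> (a, a) \<in> natr \<Longrightarrow> (b, b) \<in> prodr ?A ?S \<Longrightarrow> ap (ap (Z2 w) a) b = ap VLefts (ap (ap (Z1 w) a) b)"
    by (rule computed_post2[OF ok Z1(1) VLefts_rel]) blast
  have hs: "realizes \<phi> ((E w)(n := N (Suc i))) (ap (ap (f1 w) (N i)) a) b"
    if w: "w \<in> wcar q" and a: "(a, a) \<in> ?A" and b: "(b, b) \<in> ?S"
      and c: "meets q w (ap (ap (Z2 w) (N i)) (Pr a b))"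
      and j: "\<forall>j\<in>els (ap (ap (ap (G1 w) (N i)) a) b). realizes \<phi> ((E w)(n := N i)) a j" for w i a b
  proof -
    have i: "(N i, N i) \<in> natr" by simp
    have ab: "(Pr a b, Pr a b) \<in> prodr ?A ?S" using a b by simp
    have u: "Pr w (N i) \<in> wcar ?g" using w by simp
    have t1: "(ap (ap (Z1 w) (N i)) (Pr a b), ap (ap (Z1 w) (N i)) (Pr a b)) \<in> listr (sumr ?W {})"
      by (rule fnD2[OF fnD2[OF computed_typed[OF ok Z1(1) w] i] ab])
    have "meets ?g (Pr w (N i)) (ap (Z (Pr w (N i))) (Pr a b))"
    proof
      fix z assume "z \<in> els (ap (Z (Pr w (N i))) (Pr a b))"
      then have z: "z \<in> els (ap (ap (Z1 w) (N i)) (Pr a b))" using Z1(2)[OF w i] by simp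
      obtain y where y: "z = VInl y" using els_dom[OF t1 z] by (auto simp: sumr_def)
      then have "y \<in> els (ap (ap (Z2 w) (N i)) (Pr a b))"
        unfolding Z2(2)[OF w i ab] els_lefts[OF t1] using z by simp
      then show "wcon ?g (Pr w (N i)) z" using c y by simp
    qed
    from h[OF u ab this]
    have "realizes (subst n (Su (Var n)) \<phi>) ((E w)(n := N i)) (ap (ap (f1 w) (N i)) a) b"
      using j f1(2)[OF w i] G1(2)[OF w i] by simp
    moreover have "tv ((E w)(n := N i))" by (rule tv_upd[OF typed_env_tv[OF t w]]) (simp add: n)
    moreover have su: "Su (Var n) \<triangleright> snd n" using n by (simp add: has_ty_def)
    ultimately show ?thesis
      using realizes_subst[OF wf su free_for_Suc, where v = "(E w)(n := N i)"] tv_D[of "(E w)(n := N i)"] by simp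
  qed
  let ?R1 = "\<lambda>w. ap (ap VRec (Y0 w)) (f1 w)"
  have R1: "computed q (fn natr ?A) ?R1" by (rule computed_app[OF ok computed_app[OF ok computed_const[OF VRec_rel] Y0] f1(1)])
  let ?L = "fn ?S (listr ?W)"
  let ?g2 = "gen ?g ?L"
  note ok2 = ok_gen[OF okg, of ?L]
  let ?w = "\<lambda>u. vfst (vfst u)" and ?i = "\<lambda>u. vsnd (vfst u)"
  have ci: "computed ?g2 natr ?i" by (rule computed_weak[OF okg computed_gen_var])
  have weak: "computed ?g2 B (\<lambda>u. f (?w u))" if "computed q B f" for B f
    by (rule computed_weak[OF okg computed_weak[OF ok that]])
  have cy: "computed ?g2 ?A (\<lambda>u. ap (?R1 (?w u)) (?i u))" by (rule computed_app[OF ok2 weak[OF R1] ci])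
  \<comment> \<open>Conditions under which the induction step applies to the realizer already built
    for the predecessor.\<close>
  obtain H1 where H1: "computed ?g2 ?L H1"
    "\<And>u x. u \<in> wcar ?g2 \<Longrightarrow> (x, x) \<in> ?S \<Longrightarrow> ap (H1 u) x = ap (ap (Z2 (?w u)) (?i u)) (Pr (ap (?R1 (?w u)) (?i u)) x)"
  proof -
    note ok3 = ok_gen[OF ok2, of ?S]
    have c: "computed (gen ?g2 ?S) (listr ?W) (\<lambda>v. ap (ap (Z2 (?w (vfst v))) (?i (vfst v))) (Pr (ap (?R1 (?w (vfst v))) (?i (vfst v))) (vsnd v)))"
      by (rule computed_app[OF ok3 computed_weak[OF ok2 computed_app[OF ok2 weak[OF Z2(1)] ci]] computed_pair[OF ok3 computed_weak[OF ok2 cy] computed_gen_var]])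
    show ?thesis by (rule computed_lam[OF ok2 c]) (rule that, auto)
  qed
  \<comment> \<open>For the challenges sent back to the predecessor, the conditions are looked up in
    the map built at the previous stage, which \<open>zd\<close> makes available.\<close>
  obtain zd where zd: "computed ?g2 (fn ?S ?L) zd" "\<And>u x. u \<in> wcar ?g2 \<Longrightarrow> (x, x) \<in> ?S \<Longrightarrow> ap (zd u) x = vsnd u"
    by (rule computed_drop[OF ok2 computed_gen_var]) blast
  obtain H2 where H2: "computed ?g2 ?L H2"
    "\<And>u x. u \<in> wcar ?g2 \<Longrightarrow> (x, x) \<in> ?S \<Longrightarrow> els (ap (H2 u) x) =
      (\<Union>y\<in>els (ap (ap (ap (G1 (?w u)) (?i u)) (ap (?R1 (?w u)) (?i u))) x). els (ap (ap (zd u) x) y))"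
    by (rule computed_lam_bind[OF ok2 computed_app[OF ok2 computed_app[OF ok2 weak[OF G1(1)] ci] cy] zd(1)]) blast
  obtain H where H: "computed ?g2 ?L H"
    "\<And>u x. u \<in> wcar ?g2 \<Longrightarrow> (x, x) \<in> ?S \<Longrightarrow> els (ap (H u) x) = els (ap (H1 u) x) \<union> els (ap (H2 u) x)"
    by (rule computed_lam_append[OF ok2 H1(1) H2(1)]) blast
  obtain f2' where f2': "computed ?g (fn ?L ?L) f2'" "\<And>u a. u \<in> wcar ?g \<Longrightarrow> (a, a) \<in> ?L \<Longrightarrow> ap (f2' u) a = H (Pr u a)"
    by (rule computed_lam[OF okg H(1)]) blast
  obtain f2 where f2: "computed q (fn natr (fn ?L ?L)) f2" "\<And>w a. w \<in> wcar q \<Longrightarrow> (a, a) \<in> natr \<Longrightarrow> ap (f2 w) a = f2' (Pr w a)"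
    by (rule computed_lam[OF ok f2'(1)]) blast
  let ?R2 = "\<lambda>w. ap (ap VRec (Z0 w)) (f2 w)"
  have R2: "computed q (fn natr ?L) ?R2" by (rule computed_app[OF ok computed_app[OF ok computed_const[OF VRec_rel] Z0] f2(1)])
  have main: "(x, x) \<in> ?S \<Longrightarrow> (meets q w (ap (ap (?R2 w) (N i)) x)) \<Longrightarrow>
      realizes \<phi> ((E w)(n := N i)) (ap (?R1 w) (N i)) x" if w: "w \<in> wcar q" for w i x
  proof (induction i arbitrary: x)
    case 0 then show ?case using h0[OF w] by simp
  next
    case (Suc i)
    have i: "(N i, N i) \<in> natr" by simp
    let ?\<zeta> = "ap (?R2 w) (N i)" and ?y = "ap (?R1 w) (N i)"
    have \<zeta>: "(?\<zeta>, ?\<zeta>) \<in> ?L" by (rule fnD2[OF computed_typed[OF ok R2 w] i])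
    have y: "(?y, ?y) \<in> ?A" by (rule fnD2[OF computed_typed[OF ok R1 w] i])
    let ?u = "Pr (Pr w (N i)) ?\<zeta>"
    have u: "?u \<in> wcar ?g2" using w \<zeta> by simp
    have r1: "ap (?R1 w) (N (Suc i)) = ap (ap (f1 w) (N i)) ?y"
      using ap_Rec_Suc[OF computed_typed[OF ok Y0 w] computed_typed[OF ok f1(1) w], of i] by simp
    have "ap (?R2 w) (N (Suc i)) = ap (ap (f2 w) (N i)) ?\<zeta>"
      using ap_Rec_Suc[OF computed_typed[OF ok Z0 w] computed_typed[OF ok f2(1) w], of i] by simp
    also have "\<dots> = H ?u" using f2(2)[OF w i] f2'(2)[OF _ \<zeta>, of "Pr w (N i)"] w by simp
    finally have r2: "els (ap (ap (?R2 w) (N (Suc i))) x) = els (ap (ap (Z2 w) (N i)) (Pr ?y x)) \<union>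
        (\<Union>j\<in>els (ap (ap (ap (G1 w) (N i)) ?y) x). els (ap ?\<zeta> j))"
      using H(2)[OF u Suc.prems(1)] H1(2)[OF u Suc.prems(1)] H2(2)[OF u Suc.prems(1)] zd(2)[OF u Suc.prems(1)] by simp
    show ?case unfolding r1
    proof (rule hs[OF w y Suc.prems(1)])
      show "meets q w (ap (ap (Z2 w) (N i)) (Pr ?y x))" using Suc.prems(2) r2 by blast
      show "\<forall>j\<in>els (ap (ap (ap (G1 w) (N i)) ?y) x). realizes \<phi> ((E w)(n := N i)) ?y j"
      proof
        fix j assume j: "j \<in> els (ap (ap (ap (G1 w) (N i)) ?y) x)"
        have "(j, j) \<in> ?S"
          by (rule els_dom[OF fnD2[OF fnD2[OF fnD2[OF computed_typed[OF ok G1(1) w] i] y] Suc.prems(1)] j])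
        then show "realizes \<phi> ((E w)(n := N i)) ?y j"
          by (rule Suc.IH) (use Suc.prems(2) r2 j in blast)
      qed
    qed
  qed
  show ?thesis
  proof (rule forceI[OF computed_app[OF ok R1 k] computed_app[OF ok R2 k]])
    fix w x assume w: "w \<in> wcar q" and x: "(x, x) \<in> ?S" and c: "meets q w (ap (ap (?R2 w) (k w)) x)"
    obtain i where "k w = N i" using computed_typed[OF ok k w] by auto
    then show "realizes \<phi> ((E w)(n := k w)) (ap (?R1 w) (k w)) x" using main[OF w x] c by simp
  qed
qed

lemma valid_external_induction:
  assumes wf: "wff \<phi>" and n: "snd n = NN"
  shows "valid (subst n Ze \<phi> \<^bold>\<and> Forallst n (\<phi> \<^bold>\<longrightarrow> subst n (Su (Var n)) \<phi>) \<^bold>\<longrightarrow> Forallst n \<phi>)"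
proof (rule valid_ImpI)
  fix p E assume ok: "ok p" and t: "typed_env p E"
    and f: "force p E (subst n Ze \<phi> \<^bold>\<and> Forallst n (\<phi> \<^bold>\<longrightarrow> subst n (Su (Var n)) \<phi>))"
  have f0: "force p E (subst n Ze \<phi>)" and fs: "force p E (Forallst n (\<phi> \<^bold>\<longrightarrow> subst n (Su (Var n)) \<phi>))"
    using f unfolding force_And[OF ok] by blast+
  have f0': "force p (\<lambda>w. (E w)(n := N 0)) \<phi>"
    using force_subst[OF wf, of Ze n p E] f0 t n by (simp add: has_ty_def free_for_closed)
  show "force p E (Forallst n \<phi>)"
  proof (rule Forallst_I[OF ok wf t])
    fix q \<pi> k assume q: "wle q \<pi> p" and k: "computed q (per (snd n)) k"
    note okq = wle_ok[OF q]
    show "force q (\<lambda>w. (E (\<pi> w))(n := k w)) \<phi>"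
    proof (rule ext_induct[OF okq wf n typed_env_wle[OF t q] force_mono[OF f0' q]])
      show "computed q natr k" using k n by simp
      \<comment> \<open>Instantiating the premise at a generic standard number gives a single
        realizer for all steps, as the recursion requires.\<close>
      show "force (gen q natr) (\<lambda>u. (E (\<pi> (vfst u)))(n := vsnd u)) (\<phi> \<^bold>\<longrightarrow> subst n (Su (Var n)) \<phi>)"
        by (rule Forallst_D[OF fs wle_trans[OF wle_ext[OF okq gen_typed] q]], unfold n per.simps, rule computed_gen_var)
    qed
  qed
qed

lemma ty_neq: "(\<sigma>::ty) \<noteq> \<sigma>\<^sup>\<star>" "\<sigma> \<noteq> \<rho> \<rightarrow> \<sigma>\<^sup>\<star>" "\<rho> \<noteq> \<rho> \<rightarrow> \<tau>"
proof -
  have "size (\<sigma>::ty) \<noteq> size (\<sigma>\<^sup>\<star>)" "size \<sigma> \<noteq> size (\<rho> \<rightarrow> \<sigma>\<^sup>\<star>)" "size \<rho> \<noteq> size (\<rho> \<rightarrow> \<tau>)" by simp_all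
  then show "(\<sigma>::ty) \<noteq> \<sigma>\<^sup>\<star>" "\<sigma> \<noteq> \<rho> \<rightarrow> \<sigma>\<^sup>\<star>" "\<rho> \<noteq> \<rho> \<rightarrow> \<tau>" by metis+
qed

text \<open>Adjoin a hidden \<open>y\<close> with the conditions that \<open>\<phi>\<close> holds
  for every standard \<open>z\<close>. If the conclusion is refuted, this world is inconsistent, and
  a program lists finitely many \<open>z\<close> of which every \<open>y\<close> violates one. That
  list is standard, so the premise gives a \<open>y\<close> satisfying \<open>\<phi>\<close> at all
  its entries.\<close>

lemma valid_idealisation:
  assumes wf: "wff \<phi>" and int: "internal \<phi>" and x: "snd x = (snd z)\<^sup>\<star>" "x \<notin> fv \<phi>" "x \<noteq> y" and yz: "y \<noteq> z"
  shows "valid (Forallst x (Exists y (Forall z (Var z \<^bold>\<in> Var x \<^bold>\<longrightarrow> \<phi>))) \<^bold>\<longrightarrow> Exists y (Forallst z \<phi>))"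
proof (rule valid_ImpI)
  fix p E assume ok: "ok p" and t: "typed_env p E" and f: "force p E (Forallst x (Exists y (Forall z (Var z \<^bold>\<in> Var x \<^bold>\<longrightarrow> \<phi>))))"
  have xz: "x \<noteq> z" using x(1) ty_neq(1)[of "snd z"] by auto
  show "force p E (Exists y (Forallst z \<phi>))"
  proof (rule force_ImpI[OF ok])
    fix q \<pi> assume q: "wle q \<pi> p" and a: "force q (\<lambda>w. E (\<pi> w)) (Forall y (\<^bold>\<not> Forallst z \<phi>))"
    note okq = wle_ok[OF q]
    let ?E = "\<lambda>w. E (\<pi> w)"
    let ?D = "\<lambda>_::val. {d. (d, d) \<in> per (snd y)}"
    let ?Q = "\<lambda>w d c. sat ((?E w)(y := d, z := c)) \<phi>"
    let ?u = "ext q ?D unitr (\<lambda>_. N 0) (per (snd z)) ?Q"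
    have u: "wle ?u vfst q" by (rule wle_ext[OF okq typed_unit])
    have d: "(vsnd w, vsnd w) \<in> per (snd y)" if "w \<in> wcar ?u" for w using that by auto
    have "force ?u (\<lambda>w. (?E (vfst w))(y := vsnd w)) (Forallst z \<phi>)"
    proof (rule Forallst_I[OF wle_ok[OF u] wf typed_env_upd[OF typed_env_wle[OF t wle_trans[OF u q]] d]])
      fix r \<rho> k assume r: "wle r \<rho> ?u" and k: "computed r (per (snd z)) k"
      from ext_constraint[OF r k]
      show "force r (\<lambda>w. (?E (vfst (\<rho> w)))(y := vsnd (\<rho> w), z := k w)) \<phi>"
        unfolding force_internal[OF wle_ok[OF r] int] .
    qed
    from force_ImpD[OF force_ForallD[OF a u d] wle_refl[OF wle_ok[OF u]] this]
    have "absurd ?u" using force_Bot[OF wle_ok[OF u]] by blast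
    from absurd_ext0[OF okq this] obtain Z1 Z2 where Z: "computed q (conds q) Z1" "computed q (listr (per (snd z))) Z2"
      and ZZ: "\<forall>w\<in>wcar q. \<forall>a\<in>?D w. (meets q w (Z1 w)) \<longrightarrow> (\<exists>c\<in>els (Z2 w). \<not> ?Q w a c)" by blast
    have "force q (\<lambda>w. (?E w)(x := Z2 w)) (Exists y (Forall z (Var z \<^bold>\<in> Var x \<^bold>\<longrightarrow> \<phi>)))"
      by (rule Forallst_D[OF f q]) (use Z(2) x(1) in simp)
    then have 1: "large q (\<lambda>w. sat ((?E w)(x := Z2 w)) (Exists y (Forall z (Var z \<^bold>\<in> Var x \<^bold>\<longrightarrow> \<phi>))))"
      using int by (subst (asm) force_internal[OF okq]) auto
    have 2: "large q (\<lambda>w. meets q w (Z1 w))" by (rule largeI[OF Z(1)])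
    have "absurd q"
    proof (rule large_mono[OF large_conj[OF okq 1 2]], elim conjE)
      fix w assume w: "w \<in> wcar q" and s: "sat ((?E w)(x := Z2 w)) (Exists y (Forall z (Var z \<^bold>\<in> Var x \<^bold>\<longrightarrow> \<phi>)))"
        and c: "meets q w (Z1 w)"
      have tvE: "tv (?E w)" by (rule typed_env_tv[OF typed_env_wle[OF t q] w])
      have Z2t: "(Z2 w, Z2 w) \<in> per (snd x)" using computed_typed[OF okq Z(2) w] x(1) by simp
      from s obtain d where d: "(d, d) \<in> per (snd y)"
        and sd: "\<And>c. (c, c) \<in> per (snd z) \<Longrightarrow> sat ((?E w)(x := Z2 w, y := d, z := c)) (Var z \<^bold>\<in> Var x) \<Longrightarrow>
          sat ((?E w)(x := Z2 w, y := d, z := c)) \<phi>" by auto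
      obtain c where c: "c \<in> els (Z2 w)" "\<not> ?Q w d c" using ZZ w d c by blast
      have ct: "(c, c) \<in> per (snd z)" by (rule els_dom[OF computed_typed[OF okq Z(2) w] c(1)])
      let ?v = "(?E w)(x := Z2 w, y := d, z := c)"
      have tv: "tv ?v" by (intro tv_upd tvE Z2t d ct)
      have "sat ?v (Var z \<^bold>\<in> Var x)"
        using sat_mem[OF tv, of "Var z" "snd z" "Var x"] x xz c(1) ct by (auto simp: has_ty_def)
      then have "sat ?v \<phi>" by (rule sd[OF ct])
      then have "?Q w d c"
      proof (rule sat_cong[OF int wf, rotated])
        fix a assume "a \<in> fv \<phi>"
        then have "a \<noteq> x" using x(2) by blast
        then have "((?E w)(y := d, z := c)) a = ?v a" by (simp add: fun_upd_def)
        then show "(?v a, ((?E w)(y := d, z := c)) a) \<in> per (snd a)" by (simp only: tv_D[OF tv])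
      qed
      then show False using c(2) by blast
    qed
    then show "force q (\<lambda>w. E (\<pi> w)) Bot" by (rule absurd_force[OF okq])
  qed
qed

lemma wff_mem: "t \<triangleright> \<sigma> \<Longrightarrow> s \<triangleright> \<sigma>\<^sup>\<star> \<Longrightarrow> wff (t \<^bold>\<in> s)"
  by (simp add: mem_def le_def Let_def has_ty_def fresh_notin)

text \<open>Adjoin a visible \<open>x\<close> with the conditions that no standard \<open>y\<close>
  satisfies \<open>\<phi>\<close>. The premise makes this inconsistent; the indices of the finitely
  many conditions used are listed by a program from \<open>x\<close>, and this program is
  \<open>F\<close>.\<close>

lemma valid_HAC:
  assumes wf: "wff \<phi>" and int: "internal \<phi>" and F: "snd F = snd x \<rightarrow> (snd y)\<^sup>\<star>" "F \<notin> fv \<phi>" and xy: "x \<noteq> y"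
  shows "valid (Forallst x (Existsst y \<phi>) \<^bold>\<longrightarrow> Existsst F (Forallst x (Exists y (Var y \<^bold>\<in> Var F \<cdot> Var x \<^bold>\<and> \<phi>))))"
proof (rule valid_ImpI)
  fix p E assume ok: "ok p" and t: "typed_env p E" and f: "force p E (Forallst x (Existsst y \<phi>))"
  have Fx: "F \<noteq> x" "F \<noteq> y" using F(1) ty_neq(2)[of "snd y" "snd x"] ty_neq(3)[of "snd x" "(snd y)\<^sup>\<star>"] by auto
  let ?C = "\<lambda>_::val. {a. (a, a) \<in> per (snd x)}"
  let ?Q = "\<lambda>w a c. \<not> sat ((E w)(x := a, y := c)) \<phi>"
  let ?u = "ext p ?C (per (snd x)) (\<lambda>a. a) (per (snd y)) ?Q"
  have ty: "typed_by p ?C (per (snd x)) (\<lambda>a. a)" by (simp add: typed_by_def)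
  have u: "wle ?u vfst p" by (rule wle_ext[OF ok ty])
  have d: "(vsnd w, vsnd w) \<in> per (snd x)" if "w \<in> wcar ?u" for w using that by auto
  have e: "force ?u (\<lambda>w. (E (vfst w))(x := vsnd w)) (Existsst y \<phi>)"
    by (rule Forallst_D[OF f u computed_var])
  have "absurd ?u"
  proof (rule Existsst_E[OF wle_ok[OF u] wf typed_env_upd[OF typed_env_wle[OF t u] d] e])
    fix q \<pi> k assume q: "wle q \<pi> ?u" and k: "computed q (per (snd y)) k"
      and g: "force q (\<lambda>w. (E (vfst (\<pi> w)))(x := vsnd (\<pi> w), y := k w)) \<phi>"
    show "absurd q"
      by (rule large_mono[OF large_conj[OF wle_ok[OF q] g[unfolded force_internal[OF wle_ok[OF q] int]] ext_constraint[OF q k]]]) blast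
  qed
  from absurd_ext[OF ok ty this] obtain Z1 Z2 where Z: "computed p (fn (per (snd x)) (conds p)) Z1"
    "computed p (fn (per (snd x)) (listr (per (snd y)))) Z2"
    and ZZ: "\<forall>w\<in>wcar p. \<forall>a\<in>?C w. (meets p w (ap (Z1 w) a)) \<longrightarrow> (\<exists>c\<in>els (ap (Z2 w) a). \<not> ?Q w a c)" by blast
  let ?\<psi> = "Exists y (Var y \<^bold>\<in> Var F \<cdot> Var x \<^bold>\<and> \<phi>)"
  have wf': "wff ?\<psi>" using wf wff_mem[of "Var y" "snd y" "Var F \<cdot> Var x"] F(1) by (simp add: has_ty_def)
  have int': "internal ?\<psi>" using int by simp
  have Z2F: "computed p (per (snd F)) Z2" using Z(2) F(1) by simp
  show "force p E (Existsst F (Forallst x ?\<psi>))"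
  proof (rule Existsst_I[OF ok Z2F], rule Forallst_I[OF ok wf' typed_env_upd[OF t computed_typed[OF ok Z2F]]])
    fix q \<pi> k assume q: "wle q \<pi> p" and k: "computed q (per (snd x)) k"
    note okq = wle_ok[OF q]
    have l: "large q (\<lambda>w. meets p (\<pi> w) (ap (Z1 (\<pi> w)) (k w)))"
      by (rule wle_list[OF q computed_app[OF okq computed_wle[OF q Z(1)] k]])
    show "force q (\<lambda>w. (E (\<pi> w))(F := Z2 (\<pi> w), x := k w)) ?\<psi>"
      unfolding force_internal[OF okq int']
    proof (rule large_mono[OF l])
      fix w assume w: "w \<in> wcar q" and c: "meets p (\<pi> w) (ap (Z1 (\<pi> w)) (k w))"
      have kt: "(k w, k w) \<in> per (snd x)" by (rule computed_typed[OF okq k w])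
      have wp: "\<pi> w \<in> wcar p" by (rule wle_car[OF q w])
      obtain b where b: "b \<in> els (ap (Z2 (\<pi> w)) (k w))" and sb: "sat ((E (\<pi> w))(x := k w, y := b)) \<phi>"
        using ZZ wp kt c by blast
      have bt: "(b, b) \<in> per (snd y)" by (rule els_dom[OF fnD2[OF computed_typed[OF ok Z(2) wp] kt] b])
      let ?v = "(E (\<pi> w))(F := Z2 (\<pi> w), x := k w, y := b)"
      have tv: "tv ?v" by (intro tv_upd typed_env_tv[OF typed_env_wle[OF t q] w] computed_typed[OF ok Z2F wp] kt bt)
      have m: "sat ?v (Var y \<^bold>\<in> Var F \<cdot> Var x)"
        using sat_mem[OF tv, of "Var y" "snd y" "Var F \<cdot> Var x"] F(1) Fx xy b bt by (auto simp: has_ty_def)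
      have "sat ?v \<phi>"
      proof (rule sat_cong[OF int wf _ sb])
        fix a assume "a \<in> fv \<phi>"
        then have "a \<noteq> F" using F(2) by blast
        then have "((E (\<pi> w))(x := k w, y := b)) a = ?v a" by (simp add: fun_upd_def)
        then show "(((E (\<pi> w))(x := k w, y := b)) a, ?v a) \<in> per (snd a)" by (simp only: tv_D[OF tv])
      qed
      then show "sat ((E (\<pi> w))(F := Z2 (\<pi> w), x := k w)) ?\<psi>" using m bt by auto
    qed
  qed
qed

lemma axP_valid: "\<phi> \<in> axP \<Longrightarrow> valid \<phi>"
proof (induction rule: axP.induct)
  case (EPA \<phi>) then show ?case by (intro valid_internal axEPA_internal axEPA_sat)
qed (rule valid_st_eq valid_st_closed valid_st_app valid_external_induction valid_idealisation valid_HAC; assumption)+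

lemma ev_initseg:
  assumes "\<And>i. app (ev v g) (N i) (N (h i))" "ev v n = N k"
  shows "ev v (initseg g n) = N (code (map h [0..<k]))"
  using ev_initT[of "ev v g" h v k] ev_codeT[of v "map h [0..<k]"] assms by (simp del: map_map)

text \<open>The witness is \<open>VMu\<close> applied to \<open>f\<close>. As the premise is
  internal, it provides an actual branch on a large set of states; so \<open>branch\<close> makes a
  correct choice there, and \<open>VMu1\<close> computes the chosen branch.\<close>

lemma Pi11_valid: "valid Pi11_TRANS"
proof -
  let ?f = "(0::nat, NN \<rightarrow> NN)" and ?g = "(1::nat, NN \<rightarrow> NN)" and ?n = "(2::nat, NN)"
  let ?z = "Forall ?n (Var ?f \<cdot> initseg (Var ?g) (Var ?n) \<^bold>= Ze)"
  have wz: "wff ?z" "internal ?z" by simp_all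
  have sz: "sat v ?z \<longleftrightarrow> (\<forall>k. h (code (map j [0..<k])) = 0)"
    if h: "\<And>i. app (v ?f) (N i) (N (h i))" and j: "\<And>i. app (v ?g) (N i) (N (j i))" for v h j
  proof -
    have e: "ev (v(?n := N k)) (initseg (Var ?g) (Var ?n)) = N (code (map j [0..<k]))" for k
      by (rule ev_initseg) (simp_all add: j del: One_nat_def)
    have "ev (v(?n := N k)) (Var ?f \<cdot> initseg (Var ?g) (Var ?n)) = N (h (code (map j [0..<k])))" for k
      unfolding ev.simps(3)[of _ "Var ?f"] e using ap_eq[OF h] by simp
    then show ?thesis by (auto simp del: ev.simps(3))
  qed
  show ?thesis
    unfolding valid_def Pi11_TRANS_def Let_def
  proof (intro allI impI)
    fix p E assume ok: "ok p" and t: "typed_env p E"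
    show "force p E (Forallst ?f (Exists ?g ?z \<^bold>\<longrightarrow> Existsst ?g ?z))"
    proof (rule Forallst_I[OF ok _ t])
      show "wff (Exists ?g ?z \<^bold>\<longrightarrow> Existsst ?g ?z)" by simp
      fix q \<pi> k assume q: "wle q \<pi> p" and k: "computed q (per (snd ?f)) k"
      show "force q (\<lambda>w. (E (\<pi> w))(?f := k w)) (Exists ?g ?z \<^bold>\<longrightarrow> Existsst ?g ?z)"
      proof (rule force_ImpI[OF wle_ok[OF q]])
        fix r \<rho> assume r: "wle r \<rho> q" and f: "force r (\<lambda>w. (E (\<pi> (\<rho> w)))(?f := k (\<rho> w))) (Exists ?g ?z)"
        note okr = wle_ok[OF r]
        have ei: "internal (Exists ?g ?z)" by simp
        have kr: "computed r (per (snd ?f)) (\<lambda>w. k (\<rho> w))" by (rule computed_wle[OF r k])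
        have c: "computed r (per (snd ?g)) (\<lambda>w. ap VMu (k (\<rho> w)))"
          by (rule computed_app[OF okr computed_const]) (use VMu_rel kr in simp_all)
        show "force r (\<lambda>w. (E (\<pi> (\<rho> w)))(?f := k (\<rho> w))) (Existsst ?g ?z)"
        proof (rule Existsst_I[OF okr c], unfold force_internal[OF okr wz(2)],
            rule large_mono[OF f[unfolded force_internal[OF okr ei]]])
          fix w assume w: "w \<in> wcar r" and s: "sat ((E (\<pi> (\<rho> w)))(?f := k (\<rho> w))) (Exists ?g ?z)"
          have "(k (\<rho> w), k (\<rho> w)) \<in> fn natr natr" using computed_typed[OF okr kr w] by simp
          then obtain h where h: "\<And>n. app (k (\<rho> w)) (N n) (N (h n))" by (rule fn_nat_nat) blast
          from s obtain b where b: "(b, b) \<in> per (snd ?g)" and sb: "sat ((E (\<pi> (\<rho> w)))(?f := k (\<rho> w), ?g := b)) ?z"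
            by auto
          obtain j where j: "\<And>n. app b (N n) (N (j n))" 
            using b[unfolded snd_conv per.simps] by (rule fn_nat_nat) blast
          have "\<forall>k. h (code (map j [0..<k])) = 0"
            using sz[of "(E (\<pi> (\<rho> w)))(?f := k (\<rho> w), ?g := b)" h j] sb h j by (simp del: sat.simps)
          then have "\<forall>k. h (code (map (branch h) [0..<k])) = 0"
            unfolding branch_def by (rule someI[of "\<lambda>g. \<forall>k. h (code (map g [0..<k])) = 0"])
          moreover have "app (VMu1 (k (\<rho> w))) (N i) (N (branch h i))" for i by (rule appl.intros(29)[OF h])
          ultimately show "sat ((E (\<pi> (\<rho> w)))(?f := k (\<rho> w), ?g := ap VMu (k (\<rho> w)))) ?z"
            using sz[of "(E (\<pi> (\<rho> w)))(?f := k (\<rho> w), ?g := ap VMu (k (\<rho> w)))" h "branch h"] h by (simp del: sat.simps)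
        qed
      qed
    qed
  qed
qed

section \<open>Failure of LMP\<close>

lemma length_words: "length (words n) = 2 ^ n"
  by (induction n) auto

lemma words_binary: "s \<in> set (words n) \<Longrightarrow> set s \<subseteq> {0, 1}"
  by (induction n arbitrary: s) fastforce+

lemma prefix_count: "length (filter (prefix u) (words n)) \<le> (if length u \<le> n then 2 ^ (n - length u) else 0)"
proof (induction n arbitrary: u)
  case 0 then show ?case by (cases u) auto
next
  case (Suc n)
  show ?case
  proof (cases u)
    case Nil then show ?thesis using length_words[of "Suc n"] by (simp del: words.simps)
  next
    case (Cons a u')
    have f: "filter (prefix u) (map ((#) b) xs) = (if a = b then map ((#) b) (filter (prefix u') xs) else [])" for b xs
      by (induction xs) (auto simp: Cons)
    have "length (filter (prefix u) (words (Suc n))) \<le> length (filter (prefix u') (words n))" by (simp add: f)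
    also have "\<dots> \<le> (if length u \<le> Suc n then 2 ^ (Suc n - length u) else 0)" using Suc.IH[of u'] by (simp add: Cons split: if_splits)
    finally show ?thesis .
  qed
qed

lemma union_count:
  "length (filter (\<lambda>s. \<exists>u\<in>set us. P u s) xs) \<le> (\<Sum>u\<leftarrow>us. length (filter (P u) xs))"
proof (induction us)
  case (Cons u us)
  have "length (filter (\<lambda>s. P u s \<or> (\<exists>u\<in>set us. P u s)) xs) \<le> length (filter (P u) xs) + length (filter (\<lambda>s. \<exists>u\<in>set us. P u s) xs)"
    by (induction xs) auto
  then show ?case using Cons by simp
qed simp

text \<open>Lengths start at 2 so that the sum stays within half of \<open>2 ^ n\<close>; this
  accounts for the offset in \<open>cut\<close> and for the bound 1/2 in
  \<open>tree_world\<close>.\<close>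

lemma geometric: "2 * (\<Sum>j\<in>{2..n}. 2 ^ (n - j)) \<le> (2::nat) ^ n"
proof (cases n)
  case (Suc m)
  \<comment> \<open>The additional 2 is the tail missing from the series; with it the inequality is
    preserved by doubling.\<close>
  have "2 * (\<Sum>j\<in>{2..Suc m}. 2 ^ (Suc m - j)) + 2 \<le> (2::nat) ^ Suc m"
  proof (induction m)
    case (Suc m)
    have "(\<Sum>j\<in>{2..Suc (Suc m)}. 2 ^ (Suc (Suc m) - j)) = (\<Sum>j\<in>{2..Suc m}. 2 * 2 ^ (Suc m - j)) + (1::nat)"
      by (simp add: Suc_diff_le)
    then show ?case using Suc by (simp add: sum_distrib_left[symmetric])
  qed simp
  then show ?thesis using Suc by simp
qed simp

text \<open>Pairwise different lengths turn the union bound into a sum in which each length from 2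
  on occurs at most once.\<close>

lemma cover_count:
  assumes inj: "inj_on length (set us)" and two: "\<And>u. u \<in> set us \<Longrightarrow> 2 \<le> length u"
  shows "2 * length (filter (\<lambda>s. \<exists>u\<in>set us. prefix u s) (words n)) \<le> 2 ^ n"
proof -
  let ?g = "\<lambda>j. if j \<le> n then 2 ^ (n - j) else (0::nat)"
  \<comment> \<open>Injectivity concerns the set of neighbourhoods, so repetitions in the list are
    removed before summing.\<close>
  have "length (filter (\<lambda>s. \<exists>u\<in>set (remdups us). prefix u s) (words n)) \<le> (\<Sum>u\<leftarrow>remdups us. length (filter (prefix u) (words n)))"
    by (rule union_count)
  also have "\<dots> \<le> (\<Sum>u\<leftarrow>remdups us. ?g (length u))" by (rule sum_list_mono) (rule prefix_count)
  also have "\<dots> = (\<Sum>u\<in>set us. ?g (length u))" by (simp add: sum_list_distinct_conv_sum_set)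
  also have "\<dots> = (\<Sum>j\<in>length ` set us. ?g j)" using inj by (simp add: sum.reindex)
  also have "\<dots> = (\<Sum>j\<in>length ` set us \<inter> {..n}. 2 ^ (n - j))" by (auto simp: sum.inter_restrict intro!: sum.cong)
  also have "\<dots> \<le> (\<Sum>j\<in>{2..n}. 2 ^ (n - j))" by (rule sum_mono2) (use two in auto)
  finally show ?thesis using geometric[of n] by simp
qed

lemma orc_code: "orc k (code s) = (if set s \<subseteq> {0, 1} \<and> (\<forall>u\<in>set (from_nat k :: nat list list). \<not> prefix u s) then 1 else 0)"
proof -
  have "(\<exists>t. code s = code t \<and> set t \<subseteq> {0, 1} \<and> (\<forall>u\<in>set (from_nat k :: nat list list). \<not> prefix u t)) \<longleftrightarrow>
    set s \<subseteq> {0, 1} \<and> (\<forall>u\<in>set (from_nat k :: nat list list). \<not> prefix u s)"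
    using code_inj by metis
  then show ?thesis by (simp add: orc_def)
qed

lemma orc_measure:
  fixes us :: "nat list list"
  assumes "inj_on length (set us)" "\<And>u. u \<in> set us \<Longrightarrow> 2 \<le> length u"
  shows "2 ^ n \<le> 2 * (\<Sum>s\<leftarrow>words n. orc (to_nat us) (code s))"
proof -
  let ?b = "\<lambda>s. \<exists>u\<in>set us. prefix u s"
  have "(\<Sum>s\<leftarrow>xs. orc (to_nat us) (code s)) = length (filter (\<lambda>s. \<not> ?b s) xs)" if "\<And>s. s \<in> set xs \<Longrightarrow> set s \<subseteq> {0, 1}" for xs
    using that by (induction xs) (auto simp: orc_code)
  then have "(\<Sum>s\<leftarrow>words n. orc (to_nat us) (code s)) = length (filter (\<lambda>s. \<not> ?b s) (words n))"
    using words_binary by blast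
  moreover have "length (filter ?b (words n)) + length (filter (\<lambda>s. \<not> ?b s) (words n)) = 2 ^ n"
    using sum_length_filter_compl[of ?b "words n"] length_words[of n] by simp
  ultimately show ?thesis using cover_count[OF assms, of n] by simp
qed

section \<open>Neighbourhoods of the standard sequences\<close>

definition vnat :: "val \<Rightarrow> nat \<Rightarrow> nat" where "vnat b i = nval (ap b (N i))"
definition cut :: "val \<Rightarrow> nat list" where "cut b = map (vnat b) [0..<Suc (Suc (nval (ap VId b)))]"

lemma vnat_app: assumes "(b, b) \<in> fn natr natr" shows "app b (N i) (N (vnat b i))"
proof -
  obtain h where h: "\<And>n. app b (N n) (N (h n))" using assms by (rule fn_nat_nat) blast
  then show ?thesis using ap_eq[OF h] by (simp add: vnat_def)
qed

text \<open>Equal lengths mean equal indices, hence the same function by \<open>index_inj\<close>.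
  Different programs for one sequence therefore do not produce different neighbourhoods.\<close>

lemma cut_inj:
  assumes b: "(b, b) \<in> fn natr natr" and c: "(c, c) \<in> fn natr natr" and e: "length (cut b) = length (cut c)"
  shows "cut b = cut c"
proof -
  have i: "(vnat b, nval (ap VId b)) \<in> index" if b: "(b, b) \<in> fn natr natr" for b
  proof -
    have "app VId b (ap VId b)" using fnD[OF VId_rel b] by blast
    then obtain f k where f: "\<And>n. app b (N n) (N (f n))" "ap VId b = N k" "(f, k) \<in> index" by (rule applE_Id) blast
    have "vnat b = f" using ap_eq[OF f(1)] by (simp add: vnat_def fun_eq_iff)
    then show ?thesis using f by simp
  qed
  have "nval (ap VId b) = nval (ap VId c)" using e by (simp add: cut_def)
  then have "vnat b = vnat c" using i[OF b] i[OF c] index_inj by metis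
  then show ?thesis using e by (simp add: cut_def)
qed

abbreviation vT :: var where "vT \<equiv> (0, NN \<rightarrow> NN)"

lemma internal_tree: "internal (binary_tree vT)"
  by (simp add: binary_tree_def bounded_by_one_def Let_def)

lemma list_NE:
  assumes "(l, l) \<in> listr natr" obtains s where "l = L (map N s)"
proof -
  obtain t where t: "l = L t" "\<forall>x\<in>set t. \<exists>n. x = N n" using assms by (auto simp: listr_iff list_all2_same)
  have "map (\<lambda>x. N (nval x)) t = t" by (rule map_idI) (use t(2) in auto)
  then have "l = L (map N (map nval t))" by (simp add: t(1) comp_def)
  then show ?thesis by (rule that)
qed

text \<open>Membership forbids certain initial segments, a requirement that passes to all initial
  segments.\<close>

lemma sat_tree:
  assumes v: "tv v" and t: "\<And>i. app (v vT) (N i) (N (orc k i))"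
  shows "sat v (binary_tree vT)"
proof -
  let ?s = "(0::nat, NN\<^sup>\<star>)" and ?t = "(1::nat, NN\<^sup>\<star>)" and ?a = "(2::nat, NN)"
  have ne: "(fresh (Var vT) (Var vT)) \<noteq> vT" by (simp add: fresh_def)
  have 1: "sat v (bounded_by_one (Var vT))"
  proof -
    have "sat (v(fresh (Var vT) (Var vT) := N i)) (Var vT \<cdot> Var (fresh (Var vT) (Var vT)) \<^bold>\<le> Su Ze)" for i
      by (subst sat_le) (simp_all add: tv_upd v has_ty_def fresh_notin ne not_sym[OF ne] ap_eq[OF t] orc_def)
    then show ?thesis by (auto simp: bounded_by_one_def Let_def fresh_notin)
  qed
  have it: "sat w (in_tree c (Var vT)) \<longleftrightarrow> orc k (code s) = 1" if "w vT = v vT" "ev w c = N (code s)" for w c s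
    using that ap_eq[OF t] by auto
  have 2: "sat v (Forall ?s (in_tree (codeT \<cdot> Var ?s) (Var vT) \<^bold>\<longrightarrow> Forall ?a (Var ?a \<^bold>\<in> Var ?s \<^bold>\<longrightarrow> Var ?a \<^bold>\<le> Su Ze)))"
    unfolding sat.simps(4,5)
  proof (intro allI impI)
    fix l a assume l: "(l, l) \<in> per (snd ?s)" and i: "sat (v(?s := l)) (in_tree (codeT \<cdot> Var ?s) (Var vT))"
      and a: "(a, a) \<in> per (snd ?a)" and m: "sat (v(?s := l, ?a := a)) (Var ?a \<^bold>\<in> Var ?s)"
    obtain s where s: "l = L (map N s)" using l[unfolded snd_conv per.simps] by (rule list_NE)
    obtain n where n: "a = N n" using a by auto
    have tv: "tv (v(?s := l, ?a := a))" by (intro tv_upd v l a)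
    have "orc k (code s) = 1" using i it[of "v(?s := l)" "codeT \<cdot> Var ?s" s] by (simp add: s ev_codeT)
    then have b: "set s \<subseteq> {0, 1}" unfolding orc_code by (meson zero_neq_one)
    have "\<exists>c\<in>els l. (a, c) \<in> natr"
      using m sat_mem[OF tv, of "Var ?a" NN "Var ?s"] by (simp add: has_ty_def)
    then have "n \<in> set s" unfolding s n by auto
    then have "n = 0 \<or> n = 1" using b by blast
    then have "n \<le> 1" by presburger
    then show "sat (v(?s := l, ?a := a)) (Var ?a \<^bold>\<le> Su Ze)"
      using sat_le[OF tv, of "Var ?a" "Su Ze"] by (simp add: has_ty_def n)
  qed
  have 3: "sat v (Forall ?s (Forall ?t (in_tree (codeT \<cdot> (appendT NN \<cdot> Var ?s \<cdot> Var ?t)) (Var vT) \<^bold>\<longrightarrow> in_tree (codeT \<cdot> Var ?s) (Var vT))))"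
    unfolding sat.simps(4,5)
  proof (intro allI impI)
    fix l l' assume l: "(l, l) \<in> per (snd ?s)" and l': "(l', l') \<in> per (snd ?t)"
      and i: "sat (v(?s := l, ?t := l')) (in_tree (codeT \<cdot> (appendT NN \<cdot> Var ?s \<cdot> Var ?t)) (Var vT))"
    obtain s where s: "l = L (map N s)" using l[unfolded snd_conv per.simps] by (rule list_NE)
    obtain t where t: "l' = L (map N t)" using l'[unfolded snd_conv per.simps] by (rule list_NE)
    let ?w = "v(?s := l, ?t := l')"
    have a: "ev ?w (appendT NN \<cdot> Var ?s \<cdot> Var ?t) = L (map N (s @ t))"
      using ev_appendT[of "map N s" NN "map N t" ?w] list_N[of s] list_N[of t] by (simp add: s t)
    have "orc k (code (s @ t)) = 1"
      using i it[of ?w "codeT \<cdot> (appendT NN \<cdot> Var ?s \<cdot> Var ?t)" "s @ t"] a ev_codeT[of ?w "s @ t"] by simp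
    then have "set (s @ t) \<subseteq> {0, 1}" "\<forall>u\<in>set (from_nat k :: nat list list). \<not> prefix u (s @ t)"
      unfolding orc_code by (simp_all only: split: if_splits)
    then have "orc k (code s) = 1" unfolding orc_code using prefix_prefix by auto
    then show "sat ?w (in_tree (codeT \<cdot> Var ?s) (Var vT))"
      using it[of ?w "codeT \<cdot> Var ?s" s] by (simp add: s ev_codeT)
  qed
  have conj: "sat v (\<phi> \<^bold>\<and> \<psi>)" if "sat v \<phi>" "sat v \<psi>" for \<phi> \<psi> using that by simp
  show ?thesis unfolding binary_tree_def Let_def by (intro conj 1 2 3)
qed

abbreviation base :: "var \<Rightarrow> val" where "base \<equiv> (\<lambda>x. zval (snd x))"

text \<open>The states are the binary trees, as nonstandard objects: the data are trivial. The conditions state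
  that the measure is at least \<open>1/2\<close> and that no \<open>\<beta>\<close> is a path.\<close>

definition tree_world :: world where
  "tree_world = \<lparr>wcar = {t. (t, t) \<in> fn natr natr \<and> sat (base(vT := t)) (binary_tree vT)},
     wrel = unitr, wpt = \<lambda>_. N 0, widx = sumr natr (fn natr natr),
     wcon = \<lambda>t z. case z of
         VInl n \<Rightarrow> 2 ^ nval n \<le> 2 * (\<Sum>s\<leftarrow>words (nval n). vnat t (code s))
       | VInr b \<Rightarrow> ap t (N (code (cut b))) \<noteq> N 1
       | _ \<Rightarrow> True\<rparr>"

lemma ok_tree_world: "ok tree_world" by (simp add: ok_def tree_world_def)

text \<open>As the data are constant, a program lists the same finitely many conditions for all
  trees, and the tree avoiding just the neighbourhoods listed meets every one of them.\<close>

lemma tree_world_consistent: "\<not> absurd tree_world"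
proof
  assume "absurd tree_world"
  then obtain Z where Z: "computed tree_world (conds tree_world) Z"
    "\<And>w. w \<in> wcar tree_world \<Longrightarrow> \<exists>z\<in>els (Z w). \<not> wcon tree_world w z"
    unfolding large_def by blast
  then obtain F where F: "(F, F) \<in> fn unitr (listr (sumr natr (fn natr natr)))" "\<And>w. w \<in> wcar tree_world \<Longrightarrow> app F (N 0) (Z w)"
    by (auto simp: computed_def tree_world_def)
  define l where "l = ap F (N 0)"
  have Zl: "Z w = l" if "w \<in> wcar tree_world" for w using ap_eq[OF F(2)[OF that]] by (simp add: l_def)
  have l: "(l, l) \<in> listr (sumr natr (fn natr natr))" unfolding l_def by (rule fnD2[OF F(1)]) simp
  then obtain zs where zs: "l = L zs" by (auto simp: listr_iff)
  define us where "us = map cut (rights zs)"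
  have rt: "(b, b) \<in> fn natr natr" if "b \<in> set (rights zs)" for b
    using els_dom[OF l, of "VInr b"] that by (simp add: zs set_rights)
  have inj: "inj_on length (set us)" unfolding us_def by (intro inj_onI) (use cut_inj rt in fastforce)
  have two: "2 \<le> length u" if "u \<in> set us" for u using that by (auto simp: us_def cut_def)
  \<comment> \<open>\<open>VOrc\<close> applied to a code of the finite list is itself a program, so
    this tree is an object of the type structure and a state.\<close>
  let ?t = "VOrc (to_nat us)"
  have app: "app ?t (N i) (N (orc (to_nat us) i))" for i by (rule appl.intros(27))
  have tt: "(?t, ?t) \<in> fn natr natr" by (rule VOrc_rel)
  have "sat (base(vT := ?t)) (binary_tree vT)"
    by (rule sat_tree[of _ "to_nat us"]) (use tt app in \<open>auto intro: tv_upd tv_zval\<close>)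
  then have car: "?t \<in> wcar tree_world" using tt by (simp add: tree_world_def)
  have v: "vnat ?t i = orc (to_nat us) i" for i using ap_eq[OF app] by (simp add: vnat_def)
  obtain z where z: "z \<in> set zs" "\<not> wcon tree_world ?t z" using Z(2)[OF car] Zl[OF car] zs by auto
  have "(z, z) \<in> sumr natr (fn natr natr)" using els_dom[OF l, of z] z by (simp add: zs)
  then consider n where "z = VInl (N n)" | b where "z = VInr b" by (auto simp: sumr_def)
  then show False
  proof cases
    case 1 then show False using z(2) orc_measure[OF inj two, of n] by (simp add: tree_world_def v)
  next
    case 2
    then have "cut b \<in> set us" using z(1) by (auto simp: us_def set_rights)
    then have "orc (to_nat us) (code (cut b)) = 0" by (auto simp: orc_code)
    then show False using z(2) ap_eq[OF app] 2 by (simp add: tree_world_def)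
  qed
qed

text \<open>At the generic tree both premises of \<open>LMP\<close> hold. A standard path would be
  computed by a program, and its own neighbourhood, which ends at a standard number, has been
  excluded from the tree.\<close>

lemma LMP_invalid: "\<not> valid LMP"
proof
  assume "valid LMP"
  let ?p = tree_world and ?E = "\<lambda>w. base(vT := w)"
  note ok = ok_tree_world
  let ?b = "(1::nat, NN \<rightarrow> NN)" and ?m = "(2::nat, NN)" and ?k = "(0::nat, NN)" and ?n = "(1::nat, NN)"
  have t: "typed_env ?p (\<lambda>_. base)" using tv_zval by (simp add: typed_env_def tv_def)
  have car: "(w, w) \<in> per (snd vT)" if "w \<in> wcar ?p" for w using that by (simp add: tree_world_def)
  have tE: "typed_env ?p ?E" by (rule typed_env_upd[OF t car])
  let ?\<psi> = "bounded_by_one (Var ?b) \<^bold>\<and> Forallst ?m (in_tree (initseg (Var ?b) (Var ?m)) (Var vT))"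
  have "force ?p (\<lambda>_. base) LMP" using \<open>valid LMP\<close> ok t by (auto simp: valid_def)
  then have f: "force ?p (\<lambda>_. base) (Forall vT (binary_tree vT \<^bold>\<longrightarrow> positive_measure vT \<^bold>\<longrightarrow> Existsst ?b ?\<psi>))"
    by (simp add: LMP_def Let_def)
  have f: "force ?p ?E (binary_tree vT \<^bold>\<longrightarrow> positive_measure vT \<^bold>\<longrightarrow> Existsst ?b ?\<psi>)"
    by (rule force_ForallD[OF f wle_refl[OF ok] car])
  have tree: "force ?p ?E (binary_tree vT)"
    unfolding force_internal[OF ok internal_tree] by (rule large_all) (simp add: tree_world_def)
  \<comment> \<open>The value 2 of \<open>k\<close> expresses the measure bound 1/2 that the
    conditions impose.\<close>
  have c2: "computed ?p (per (snd ?k)) (\<lambda>_. N 2)" by (rule computed_const) simp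
  have pos: "force ?p ?E (positive_measure vT)"
    unfolding positive_measure_def Let_def
  proof (rule Existsst_I[OF ok c2], rule Forallst_I[OF ok _ typed_env_upd[OF tE computed_typed[OF ok c2]]])
    show "wff (pow2T \<cdot> Var ?n \<^bold>\<le> Var ?k \<^bold>* (countT \<cdot> Var vT \<cdot> Var ?n))"
      by (simp add: le_def Let_def fresh_notin)
    fix q \<pi> k assume q: "wle q \<pi> ?p" and k: "computed q (per (snd ?n)) k"
    note okq = wle_ok[OF q]
    have kn: "computed q natr k" using k by simp
    \<comment> \<open>The measure condition at \<open>n\<close> can be invoked because a program
      computes \<open>n\<close>; this is why the bound is obtained for standard
      \<open>n\<close>.\<close>
    have "computed q (widx ?p) (\<lambda>w. VInl (k w))"
      using computed_app[OF okq computed_const[OF VInlC_rel] kn, of "fn natr natr"] by (simp add: tree_world_def)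
    from wle_list[OF q computed_single[OF okq this]]
    have 1: "large q (\<lambda>w. wcon ?p (\<pi> w) (VInl (k w)))" by simp
    show "force q (\<lambda>w. (?E (\<pi> w))(?k := N 2, ?n := k w)) (pow2T \<cdot> Var ?n \<^bold>\<le> Var ?k \<^bold>* (countT \<cdot> Var vT \<cdot> Var ?n))"
      unfolding force_internal[OF okq internal_le]
    proof (rule large_mono[OF 1])
      fix w assume w: "w \<in> wcar q" and c: "wcon ?p (\<pi> w) (VInl (k w))"
      obtain i where i: "k w = N i" using computed_typed[OF okq kn w] by auto
      have tw: "(\<pi> w, \<pi> w) \<in> fn natr natr" using car[OF wle_car[OF q w]] by simp
      let ?v = "(?E (\<pi> w))(?k := N 2, ?n := k w)"
      have tv: "tv ?v" using tw by (intro tv_upd tv_zval) (simp_all add: i)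
      have e: "ap (ap (ev ?v countT) (\<pi> w)) (N i) = N (\<Sum>s\<leftarrow>words i. vnat (\<pi> w) (code s))"
        by (rule ev_countT[OF vnat_app[OF tw]])
      show "sat ?v (pow2T \<cdot> Var ?n \<^bold>\<le> Var ?k \<^bold>* (countT \<cdot> Var vT \<cdot> Var ?n))"
        using c e by (subst sat_le[OF tv]) (simp_all add: has_ty_def ev_pow2T i ev_mulT tree_world_def mult.commute)
    qed
  qed
  have g: "force ?p ?E (Existsst ?b ?\<psi>)"
    by (rule force_ImpD[OF force_ImpD[OF f wle_refl[OF ok] tree] wle_refl[OF ok] pos])
  have "absurd ?p"
  proof (rule Existsst_E[OF ok _ tE g])
    show "wff ?\<psi>" by (simp add: bounded_by_one_def le_def Let_def fresh_notin)
    fix q \<pi> k assume q: "wle q \<pi> ?p" and k: "computed q (per (snd ?b)) k" and h: "force q (\<lambda>w. (?E (\<pi> w))(?b := k w)) ?\<psi>"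
    note okq = wle_ok[OF q]
    have kn: "computed q (fn natr natr) k" using k by simp
    \<comment> \<open>The length of \<open>cut\<close>. Because the algebra contains
      \<open>VId\<close>, it is computed from the path and hence an admissible standard
      \<open>m\<close>.\<close>
    define j where "j w = ap VSuc (ap VSuc (ap VId (k w)))" for w
    have j: "computed q (per (snd ?m)) j"
      unfolding j_def snd_conv per.simps
      by (rule computed_app[OF okq computed_const[OF VSuc_rel] computed_app[OF okq computed_const[OF VSuc_rel] computed_app[OF okq computed_const[OF VId_rel] kn]]])
    have h2: "force q (\<lambda>w. (?E (\<pi> w))(?b := k w)) (Forallst ?m (in_tree (initseg (Var ?b) (Var ?m)) (Var vT)))"
      using h unfolding force_And[OF okq] by blast
    have ie: "internal (in_tree (initseg (Var ?b) (Var ?m)) (Var vT))" by simp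
    have 1: "large q (\<lambda>w. sat ((?E (\<pi> w))(?b := k w, ?m := j w)) (in_tree (initseg (Var ?b) (Var ?m)) (Var vT)))"
      using Forallst_D[OF h2 wle_refl[OF okq] j] unfolding force_internal[OF okq ie] .
    have "computed q (widx ?p) (\<lambda>w. VInr (k w))"
      using computed_app[OF okq computed_const[OF VInrC_rel] kn, of natr] by (simp add: tree_world_def)
    from wle_list[OF q computed_single[OF okq this]]
    have 2: "large q (\<lambda>w. wcon ?p (\<pi> w) (VInr (k w)))" by simp
    show "absurd q"
    proof (rule large_mono[OF large_conj[OF okq 1 2]], elim conjE)
      fix w assume w: "w \<in> wcar q" and c: "wcon ?p (\<pi> w) (VInr (k w))"
        and s: "sat ((?E (\<pi> w))(?b := k w, ?m := j w)) (in_tree (initseg (Var ?b) (Var ?m)) (Var vT))"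
      let ?v = "(?E (\<pi> w))(?b := k w, ?m := j w)"
      have kt: "(k w, k w) \<in> fn natr natr" by (rule computed_typed[OF okq kn w])
      obtain i where i: "ap VId (k w) = N i" using fnD2[OF VId_rel kt] by auto
      have "ev ?v (initseg (Var ?b) (Var ?m)) = N (code (map (vnat (k w)) [0..<Suc (Suc i)]))"
        by (rule ev_initseg) (simp_all add: vnat_app[OF kt] j_def i del: One_nat_def)
      also have "\<dots> = N (code (cut (k w)))" by (simp add: cut_def i)
      finally have e: "ev ?v (initseg (Var ?b) (Var ?m)) = N (code (cut (k w)))" .
      have "ap (\<pi> w) (N (code (cut (k w)))) = N 1" using s e by simp
      then show False using c by (simp add: tree_world_def)
    qed
  qed
  then show False using tree_world_consistent by blast
qed

theorem theorem4p10:
  assumes "consistent (axP \<union> {Pi11_TRANS})"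
  shows "\<not> (axP \<union> {Pi11_TRANS} \<turnstile> LMP)"
proof
  assume "axP \<union> {Pi11_TRANS} \<turnstile> LMP"
  then have "valid LMP" by (rule soundness[rotated]) (use axP_valid Pi11_valid in blast)
  then show False using LMP_invalid by blast
qed

end
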